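(* Let $G$ be a noncompact connected Lie group with left Haar measure $\lambda$, and let $\mathfrak{X}=\{X_1,\dots,X_\nu\}$ be a family of linearly independent left-invariant vector fields on $G$. Let $\mathcal{P}=(\mathcal{P}_{ij})$ be a matrix-valued differential operator (from $\mathfrak{n}$-vectors to $\mathfrak{m}$-vectors of functions) of degree $m\ge1$ along derivatives of $\mathfrak{X}$, whose principal part $\mathcal{P}_m$ is left invariant and whose lower order part $\mathcal{P}_{<m}$ has coefficients in $L^\infty(G,\lambda)$. Regard $\mathcal{P}$ as an operator with domain $\mathrm{Dom}(\mathcal{P})=C_c^\infty(G)^{\mathfrak{n}}$. Let $p\in[1,\infty)$, and assume that $\mathcal{P}$ is $\mathfrak{X}$-maximal hypoelliptic in $L^p(\Omega)$ for some nonempty open $\Omega\subseteq G$, and that $\mathcal{P}$ is closable as an operator from $L^{p}(\lambda)^{\mathfrak{n}}$ to $L^p(\lambda)^{\mathfrak{m}}$. Let $\overline{\mathcal{P}}$ denote its closure. Then $$\mathrm{Dom}(\overline{\mathcal{P}})=\overline{C_c^{\infty}(G)^{\mathfrak{n}}}^{\;L^{p,\mathfrak{n}}_m(\lambda,\mathfrak{X})},$$ i.e. the domain of $\overline{\mathcal{P}}$ is the closure of $C_c^\infty(G)^{\mathfrak{n}}$ in the Sobolev space $L^{p,\mathfrak{n}}_m(\lambda,\mathfrak{X})$.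
   Context: Setting. $G$ is a noncompact connected Lie group, its Lie algebra $\mathfrak{g}$ is identified with the left-invariant vector fields on $G$, and $\lambda$ is a left Haar measure. All $L^p$ spaces are with respect to $\lambda$. Functions are real-valued. $\mathfrak{n},\mathfrak{m}$ are positive integers. For $\alpha=(\alpha_1,\dots,\alpha_k)$ set $\|\alpha\|_p=\sum_{i=1}^k\|\alpha_i\|_{L^p(\lambda)}$. $C_c^{\infty}(\Omega)^{\mathfrak{n}}$ denotes the $\mathfrak{n}$-vectors of smooth functions with compact support in the open set $\Omega$. Operators. $\mathfrak{X}=\{X_1,\dots,X_\nu\}\subset\mathfrak{g}$ is a finite linearly independent family (no Hörmander condition is assumed). For a multi-index $I=(I_1,\dots,I_k)\in\{1,\dots,\nu\}^k$, $|I|=k$, put $X_I=X_{I_1}\cdots X_{I_k}$ (with $X_I=\mathrm{id}$ for $|I|=0$). A differential operator along derivatives of $\mathfrak{X}$ is given by $$\mathcal{P}(\alpha_1,\dots,\alpha_{\mathfrak{n}})=\Big(\sum_{i=1}^{\mathfrak{n}}\mathcal{P}_{i1}\alpha_i,\dots,\sum_{i=1}^{\mathfrak{n}}\mathcal{P}_{i\mathfrak{m}}\alpha_i\Big),\qquad \mathcal{P}_{ij}=\sum_{0\le|I|\le m}a^I_{ij}X_I,$$ with measurable coefficients $a^I_{ij}$ on $G$. It has degree (order) $m\geq1$ if all $\mathcal{P}_{ij}$ have order $\le m$ and at least one has order exactly $m$. Its principal part is $\mathcal{P}_m=\big(\sum_{|I|=m}a^I_{ij}X_I\big)_{ij}$,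 and its lower order part is $\mathcal{P}_{<m}=\mathcal{P}-\mathcal{P}_m$, with coefficients $a_{ij}^I$, $|I|<m$. A matrix-valued operator is left invariant if each of its entries commutes with all left translations $(\tau_x^*u)(y)=u(x^{-1}y)$, $x\in G$. Seminorms. For $u\in C_c^\infty(G)$ and $\ell\ge 0$, $|u|^{\mathfrak{X}}_{\ell,p}=\sum_{|I|=\ell}\|X_Iu\|_p$, the sum running over all $I\in\{1,\dots,\nu\}^\ell$ (so $|u|^{\mathfrak{X}}_{0,p}=\|u\|_p$); for $\alpha\in C_c^\infty(G)^{\mathfrak{n}}$, $|\alpha|^{\mathfrak{X}}_{\ell,p}=\sum_{i=1}^{\mathfrak{n}}|\alpha_i|^{\mathfrak{X}}_{\ell,p}$. Maximal hypoellipticity. For $\Omega\subseteq G$ open, $\mathcal{P}$ of degree $m$ is $\mathfrak{X}$-maximal hypoelliptic in $L^p(\Omega)$ if there is a constant $C(\Omega)$ such that $$\sum_{\ell=0}^m|\alpha|^{\mathfrak{X}}_{\ell,p}\le C(\Omega)\,(\|\mathcal{P}\alpha\|_p+\|\alpha\|_p)\qquad\forall\,\alpha\in C_c^\infty(\Omega)^{\mathfrak{n}}.$$ Sobolev spaces. For a positive integer $\sigma$, $L^p_\sigma(\lambda,\mathfrak{X})=\{u\in L^p(\lambda): X_Iu\in L^p(\lambda)\ \text{for all } |I|\le\sigma\}$ (derivatives along fields of $\mathfrak{X}$, in the distributional sense), with norm $\|u\|_{L^p_\sigma(\lambda,\mathfrak{X})}=\sum_{0\le|I|\le\sigma}\|X_Iu\|_{L^p(\lambda)}$.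 $L^{p,\mathfrak{n}}_\sigma(\lambda,\mathfrak{X})$ is the space of $\mathfrak{n}$-vectors with entries in $L^p_\sigma(\lambda,\mathfrak{X})$, with norm the sum of the norms of the entries. *)

theory Defs
  imports "HOL-Analysis.Analysis"
begin

section \<open>Lie groups\<close>

fun Ck_on :: "nat \<Rightarrow> ('a::euclidean_space \<Rightarrow> 'b::real_normed_vector) \<Rightarrow> 'a set \<Rightarrow> bool" where
  "Ck_on 0 f S \<longleftrightarrow> continuous_on S f"
| "Ck_on (Suc k) f S \<longleftrightarrow>
     (\<forall>x\<in>S. f differentiable (at x)) \<and> (\<forall>v. Ck_on k (\<lambda>x. frechet_derivative f (at x) v) S)"

text \<open>Only used for open \<open>S\<close>.\<close>
definition smooth_on :: "('a::euclidean_space \<Rightarrow> 'b::real_normed_vector) \<Rightarrow> 'a set \<Rightarrow> bool" where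
  "smooth_on f S \<longleftrightarrow> (\<forall>k. Ck_on k f S)"

text \<open>A chart is a pair \<open>(U, \<phi>)\<close>; only the values of \<open>\<phi>\<close> on \<open>U\<close> matter, and \<open>inv_into U \<phi>\<close> is the
  inverse chart. Atlases need not be maximal.\<close>
type_synonym ('g, 'e) atlas = "('g set \<times> ('g \<Rightarrow> 'e)) set"

definition smooth_atlas :: "('g::topological_space, 'e::euclidean_space) atlas \<Rightarrow> bool" where
  "smooth_atlas A \<longleftrightarrow>
     (\<forall>(U, \<phi>)\<in>A. open U \<and> open (\<phi> ` U) \<and> homeomorphism U (\<phi> ` U) \<phi> (inv_into U \<phi>)) \<and>
     (\<Union>(U, \<phi>)\<in>A. U) = UNIV \<and>
     (\<forall>(U, \<phi>)\<in>A. \<forall>(V, \<psi>)\<in>A. smooth_on (\<psi> \<circ> inv_into U \<phi>) (\<phi> ` (U \<inter> V)))"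

text \<open>The group law is written additively because the library's class of topological groups is;
  it is not assumed to be commutative (class \<open>group_add\<close>). So \<open>x + y\<close> is the product \<open>xy\<close>,
  \<open>- x\<close> is the inverse of \<open>x\<close>, and \<open>0\<close> is the identity.\<close>
definition lie_group ::
  "('g::{topological_group_add, t2_space, second_countable_topology}, 'e::euclidean_space) atlas
     \<Rightarrow> bool" where
  "lie_group A \<longleftrightarrow> smooth_atlas A \<and>
     (\<forall>(U, \<phi>)\<in>A. \<forall>(V, \<psi>)\<in>A. \<forall>(W, \<theta>)\<in>A.
        smooth_on (\<lambda>(a, b). \<theta> (inv_into U \<phi> a + inv_into V \<psi> b))
          {(a, b). a \<in> \<phi> ` U \<and> b \<in> \<psi> ` V \<and> inv_into U \<phi> a + inv_into V \<psi> b \<in> W}) \<and>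
     (\<forall>(U, \<phi>)\<in>A. \<forall>(W, \<theta>)\<in>A.
        smooth_on (\<lambda>a. \<theta> (- inv_into U \<phi> a)) {a \<in> \<phi> ` U. - inv_into U \<phi> a \<in> W})"

definition left_haar_measure :: "'g::topological_group_add measure \<Rightarrow> bool" where
  "left_haar_measure M \<longleftrightarrow> sets M = sets borel \<and>
     emeasure M UNIV \<noteq> 0 \<and>
     (\<forall>K. compact K \<longrightarrow> emeasure M K < \<infinity>) \<and>
     (\<forall>x. distr M M (\<lambda>y. x + y) = M)"

definition smooth_fun :: "('g::topological_space, 'e::euclidean_space) atlas \<Rightarrow> ('g \<Rightarrow> real) set" where
  "smooth_fun A = {u. \<forall>(U, \<phi>)\<in>A. smooth_on (u \<circ> inv_into U \<phi>) (\<phi> ` U)}"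

definition Cc_infty ::
  "('g::topological_space, 'e::euclidean_space) atlas \<Rightarrow> 'g set \<Rightarrow> ('g \<Rightarrow> real) set" where
  "Cc_infty A \<Omega> = {u \<in> smooth_fun A. compact (closure {x. u x \<noteq> 0}) \<and> closure {x. u x \<noteq> 0} \<subseteq> \<Omega>}"

definition Cc_infty_vec ::
  "('g::topological_space, 'e::euclidean_space) atlas \<Rightarrow> 'g set \<Rightarrow> ('n::finite \<Rightarrow> 'g \<Rightarrow> real) set"
  where "Cc_infty_vec A \<Omega> = {\<alpha>. \<forall>i. \<alpha> i \<in> Cc_infty A \<Omega>}"

definition ltrans :: "'g::group_add \<Rightarrow> ('g \<Rightarrow> real) \<Rightarrow> 'g \<Rightarrow> real" where
  "ltrans x u = (\<lambda>y. u (- x + y))"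

text \<open>Vector fields are the derivations of the algebra of smooth functions; what \<open>X\<close> does to
  functions that are not smooth is irrelevant.\<close>
definition left_invariant_field ::
  "('g::topological_group_add, 'e::euclidean_space) atlas \<Rightarrow> (('g \<Rightarrow> real) \<Rightarrow> 'g \<Rightarrow> real) \<Rightarrow> bool" where
  "left_invariant_field A X \<longleftrightarrow>
     (\<forall>u\<in>smooth_fun A. X u \<in> smooth_fun A) \<and>
     (\<forall>u\<in>smooth_fun A. \<forall>v\<in>smooth_fun A. X (\<lambda>y. u y + v y) = (\<lambda>y. X u y + X v y)) \<and>
     (\<forall>c. \<forall>u\<in>smooth_fun A. X (\<lambda>y. c * u y) = (\<lambda>y. c * X u y)) \<and>
     (\<forall>u\<in>smooth_fun A. \<forall>v\<in>smooth_fun A. X (\<lambda>y. u y * v y) = (\<lambda>y. u y * X v y + v y * X u y)) \<and>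
     (\<forall>x. \<forall>u\<in>smooth_fun A. X (ltrans x u) = ltrans x (X u))"

definition lin_indep_fields ::
  "('g::topological_space, 'e::euclidean_space) atlas
     \<Rightarrow> ('k::finite \<Rightarrow> ('g \<Rightarrow> real) \<Rightarrow> 'g \<Rightarrow> real) \<Rightarrow> bool" where
  "lin_indep_fields A X \<longleftrightarrow>
     (\<forall>c. (\<forall>u\<in>smooth_fun A. \<forall>y. (\<Sum>i\<in>UNIV. c i * X i u y) = 0) \<longrightarrow> (\<forall>i. c i = 0))"


section \<open>Differential operators along a family of vector fields\<close>

text \<open>A multi-index \<open>I = (I\<^sub>1,\<dots>,I\<^sub>k)\<close> is a list, and \<open>foldr X I\<close> is \<open>X\<^sub>I = X\<^bsub>I\<^sub>1\<^esub> \<circ> \<dots> \<circ> X\<^bsub>I\<^sub>k\<^esub>\<close>.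
  The argument \<open>S\<close> is the set of multi-indices of the terms that are kept: with all coefficients
  of an operator of degree \<open>m\<close> given, \<open>{I. length I \<le> m}\<close> yields the operator and
  \<open>{I. length I = m}\<close> its principal part.\<close>
definition diff_entry ::
  "('k \<Rightarrow> ('g \<Rightarrow> real) \<Rightarrow> 'g \<Rightarrow> real) \<Rightarrow> 'k list set \<Rightarrow> ('k list \<Rightarrow> 'g \<Rightarrow> real)
     \<Rightarrow> ('g \<Rightarrow> real) \<Rightarrow> 'g \<Rightarrow> real" where
  "diff_entry X S c u = (\<lambda>y. \<Sum>I\<in>S. c I y * foldr X I u y)"

definition diff_op ::
  "('k \<Rightarrow> ('g \<Rightarrow> real) \<Rightarrow> 'g \<Rightarrow> real) \<Rightarrow> 'k list set
     \<Rightarrow> ('n::finite \<Rightarrow> 'm::finite \<Rightarrow> 'k list \<Rightarrow> 'g \<Rightarrow> real)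
     \<Rightarrow> ('n \<Rightarrow> 'g \<Rightarrow> real) \<Rightarrow> 'm \<Rightarrow> 'g \<Rightarrow> real" where
  "diff_op X S a \<alpha> = (\<lambda>j y. \<Sum>i\<in>UNIV. diff_entry X S (a i j) (\<alpha> i) y)"

text \<open>Coefficients are measurable functions, so identities between operators are meant
  almost everywhere.\<close>
definition left_invariant_op ::
  "('g::topological_group_add, 'e::euclidean_space) atlas \<Rightarrow> 'g measure
     \<Rightarrow> (('g \<Rightarrow> real) \<Rightarrow> 'g \<Rightarrow> real) \<Rightarrow> bool" where
  "left_invariant_op A M T \<longleftrightarrow>
     (\<forall>x. \<forall>u\<in>Cc_infty A UNIV. AE y in M. T (ltrans x u) y = ltrans x (T u) y)"

text \<open>The coefficients of order \<open>m\<close> are not required to be unique (the \<open>X\<^sub>I\<close> may satisfy linear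
  relations); degree exactly \<open>m\<close> means that one of them does not vanish almost everywhere.\<close>
definition has_degree ::
  "'g::topological_space measure \<Rightarrow> nat \<Rightarrow> ('n \<Rightarrow> 'm \<Rightarrow> 'k list \<Rightarrow> 'g \<Rightarrow> real) \<Rightarrow> bool" where
  "has_degree M m a \<longleftrightarrow>
     (\<forall>i j I. length I \<le> m \<longrightarrow> a i j I \<in> borel_measurable M) \<and>
     (\<exists>i j I. length I = m \<and> \<not> (AE y in M. a i j I y = 0))"

definition ess_bounded :: "'g measure \<Rightarrow> ('g \<Rightarrow> real) \<Rightarrow> bool" where
  "ess_bounded M f \<longleftrightarrow> f \<in> borel_measurable M \<and> (\<exists>C. AE y in M. \<bar>f y\<bar> \<le> C)"


section \<open>Norms, maximal hypoellipticity and closures\<close>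

definition Lp :: "'g measure \<Rightarrow> real \<Rightarrow> ('g \<Rightarrow> real) set" where
  "Lp M p = {f \<in> borel_measurable M. integrable M (\<lambda>x. \<bar>f x\<bar> powr p)}"

text \<open>The norm takes the value \<open>\<infinity>\<close> outside \<open>L\<^sup>p\<close>.\<close>
definition Lp_norm :: "'g measure \<Rightarrow> real \<Rightarrow> ('g \<Rightarrow> real) \<Rightarrow> ennreal" where
  "Lp_norm M p f =
     (if f \<in> Lp M p then ennreal ((\<integral>x. \<bar>f x\<bar> powr p \<partial>M) powr (1 / p)) else \<infinity>)"

definition Lp_norm_vec :: "'g measure \<Rightarrow> real \<Rightarrow> ('n::finite \<Rightarrow> 'g \<Rightarrow> real) \<Rightarrow> ennreal" where
  "Lp_norm_vec M p \<alpha> = (\<Sum>i\<in>UNIV. Lp_norm M p (\<alpha> i))"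

definition seminorm_X ::
  "'g measure \<Rightarrow> ('k::finite \<Rightarrow> ('g \<Rightarrow> real) \<Rightarrow> 'g \<Rightarrow> real) \<Rightarrow> nat \<Rightarrow> real \<Rightarrow> ('g \<Rightarrow> real) \<Rightarrow> ennreal"
  where "seminorm_X M X l p u = (\<Sum>I\<in>{I. length I = l}. Lp_norm M p (foldr X I u))"

definition seminorm_X_vec ::
  "'g measure \<Rightarrow> ('k::finite \<Rightarrow> ('g \<Rightarrow> real) \<Rightarrow> 'g \<Rightarrow> real) \<Rightarrow> nat \<Rightarrow> real
     \<Rightarrow> ('n::finite \<Rightarrow> 'g \<Rightarrow> real) \<Rightarrow> ennreal" where
  "seminorm_X_vec M X l p \<alpha> = (\<Sum>i\<in>UNIV. seminorm_X M X l p (\<alpha> i))"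

definition maximal_hypoelliptic ::
  "('g::topological_space, 'e::euclidean_space) atlas \<Rightarrow> 'g measure
     \<Rightarrow> ('k::finite \<Rightarrow> ('g \<Rightarrow> real) \<Rightarrow> 'g \<Rightarrow> real) \<Rightarrow> nat \<Rightarrow> real \<Rightarrow> 'g set
     \<Rightarrow> (('n::finite \<Rightarrow> 'g \<Rightarrow> real) \<Rightarrow> ('m::finite \<Rightarrow> 'g \<Rightarrow> real)) \<Rightarrow> bool" where
  "maximal_hypoelliptic A M X m p \<Omega> P \<longleftrightarrow>
     (\<exists>C>0. \<forall>\<alpha>\<in>Cc_infty_vec A \<Omega>.
        (\<Sum>l\<le>m. seminorm_X_vec M X l p \<alpha>)
          \<le> ennreal C * (Lp_norm_vec M p (P \<alpha>) + Lp_norm_vec M p \<alpha>))"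

text \<open>The closure in \<open>L\<^sup>p \<times> L\<^sup>p\<close> of the graph of \<open>P\<close> with domain \<open>D\<close>. Elements of \<open>L\<^sup>p\<close> are
  represented by functions, and this relation is saturated under equality almost everywhere.\<close>
definition graph_closure ::
  "'g measure \<Rightarrow> real \<Rightarrow> ('n::finite \<Rightarrow> 'g \<Rightarrow> real) set
     \<Rightarrow> (('n \<Rightarrow> 'g \<Rightarrow> real) \<Rightarrow> ('m::finite \<Rightarrow> 'g \<Rightarrow> real))
     \<Rightarrow> (('n \<Rightarrow> 'g \<Rightarrow> real) \<times> ('m \<Rightarrow> 'g \<Rightarrow> real)) set" where
  "graph_closure M p D P =
     {(\<alpha>, g). (\<forall>i. \<alpha> i \<in> Lp M p) \<and> (\<forall>j. g j \<in> Lp M p) \<and>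
        (\<forall>\<epsilon>>0. \<exists>\<beta>\<in>D. Lp_norm_vec M p (\<lambda>i y. \<alpha> i y - \<beta> i y) < \<epsilon> \<and>
                     Lp_norm_vec M p (\<lambda>j y. g j y - P \<beta> j y) < \<epsilon>)}"

definition closable_op ::
  "'g measure \<Rightarrow> real \<Rightarrow> ('n::finite \<Rightarrow> 'g \<Rightarrow> real) set
     \<Rightarrow> (('n \<Rightarrow> 'g \<Rightarrow> real) \<Rightarrow> ('m::finite \<Rightarrow> 'g \<Rightarrow> real)) \<Rightarrow> bool" where
  "closable_op M p D P \<longleftrightarrow>
     (\<forall>\<alpha> g h. (\<alpha>, g) \<in> graph_closure M p D P \<and> (\<alpha>, h) \<in> graph_closure M p D P
        \<longrightarrow> (\<forall>j. AE y in M. g j y = h j y))"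

definition dom_closure ::
  "'g measure \<Rightarrow> real \<Rightarrow> ('n::finite \<Rightarrow> 'g \<Rightarrow> real) set
     \<Rightarrow> (('n \<Rightarrow> 'g \<Rightarrow> real) \<Rightarrow> ('m::finite \<Rightarrow> 'g \<Rightarrow> real)) \<Rightarrow> ('n \<Rightarrow> 'g \<Rightarrow> real) set" where
  "dom_closure M p D P = Domain (graph_closure M p D P)"


section \<open>Sobolev spaces\<close>

definition formal_adjoint ::
  "('g::topological_space, 'e::euclidean_space) atlas \<Rightarrow> 'g measure
     \<Rightarrow> (('g \<Rightarrow> real) \<Rightarrow> 'g \<Rightarrow> real) \<Rightarrow> ('g \<Rightarrow> real) \<Rightarrow> 'g \<Rightarrow> real" where
  "formal_adjoint A M T \<phi> = (THE \<psi>. \<psi> \<in> Cc_infty A UNIV \<and>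
     (\<forall>w\<in>Cc_infty A UNIV. (\<integral>y. T w y * \<phi> y \<partial>M) = (\<integral>y. w y * \<psi> y \<partial>M)))"

definition locally_integrable :: "'g::topological_space measure \<Rightarrow> ('g \<Rightarrow> real) \<Rightarrow> bool" where
  "locally_integrable M f \<longleftrightarrow>
     f \<in> borel_measurable M \<and> (\<forall>K. compact K \<longrightarrow> set_integrable M K f)"

text \<open>\<open>f\<close> is the distributional derivative \<open>X\<^sub>I u\<close>; locally integrable functions are identified
  with distributions through \<open>M\<close>.\<close>
definition is_weak_deriv ::
  "('g::topological_space, 'e::euclidean_space) atlas \<Rightarrow> 'g measure
     \<Rightarrow> ('k \<Rightarrow> ('g \<Rightarrow> real) \<Rightarrow> 'g \<Rightarrow> real) \<Rightarrow> 'k list \<Rightarrow> ('g \<Rightarrow> real) \<Rightarrow> ('g \<Rightarrow> real) \<Rightarrow> bool" where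
  "is_weak_deriv A M X I u f \<longleftrightarrow> locally_integrable M u \<and> locally_integrable M f \<and>
     (\<forall>\<phi>\<in>Cc_infty A UNIV.
        (\<integral>y. f y * \<phi> y \<partial>M) = (\<integral>y. u y * formal_adjoint A M (foldr X I) \<phi> y \<partial>M))"

text \<open>Weak derivatives are unique up to null sets, so the norm does not depend on the choice.\<close>
definition weak_deriv ::
  "('g::topological_space, 'e::euclidean_space) atlas \<Rightarrow> 'g measure
     \<Rightarrow> ('k \<Rightarrow> ('g \<Rightarrow> real) \<Rightarrow> 'g \<Rightarrow> real) \<Rightarrow> 'k list \<Rightarrow> ('g \<Rightarrow> real) \<Rightarrow> 'g \<Rightarrow> real" where
  "weak_deriv A M X I u = (SOME f. is_weak_deriv A M X I u f)"

definition Sobolev ::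
  "('g::topological_space, 'e::euclidean_space) atlas \<Rightarrow> 'g measure
     \<Rightarrow> ('k \<Rightarrow> ('g \<Rightarrow> real) \<Rightarrow> 'g \<Rightarrow> real) \<Rightarrow> nat \<Rightarrow> real \<Rightarrow> ('g \<Rightarrow> real) set" where
  "Sobolev A M X s p =
     {u \<in> Lp M p. \<forall>I. length I \<le> s \<longrightarrow> (\<exists>f\<in>Lp M p. is_weak_deriv A M X I u f)}"

definition Sobolev_norm ::
  "('g::topological_space, 'e::euclidean_space) atlas \<Rightarrow> 'g measure
     \<Rightarrow> ('k::finite \<Rightarrow> ('g \<Rightarrow> real) \<Rightarrow> 'g \<Rightarrow> real) \<Rightarrow> nat \<Rightarrow> real \<Rightarrow> ('g \<Rightarrow> real) \<Rightarrow> ennreal" where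
  "Sobolev_norm A M X s p u = (\<Sum>I\<in>{I. length I \<le> s}. Lp_norm M p (weak_deriv A M X I u))"

definition Sobolev_vec ::
  "('g::topological_space, 'e::euclidean_space) atlas \<Rightarrow> 'g measure
     \<Rightarrow> ('k \<Rightarrow> ('g \<Rightarrow> real) \<Rightarrow> 'g \<Rightarrow> real) \<Rightarrow> nat \<Rightarrow> real \<Rightarrow> ('n::finite \<Rightarrow> 'g \<Rightarrow> real) set" where
  "Sobolev_vec A M X s p = {\<alpha>. \<forall>i. \<alpha> i \<in> Sobolev A M X s p}"

definition Sobolev_norm_vec ::
  "('g::topological_space, 'e::euclidean_space) atlas \<Rightarrow> 'g measure
     \<Rightarrow> ('k::finite \<Rightarrow> ('g \<Rightarrow> real) \<Rightarrow> 'g \<Rightarrow> real) \<Rightarrow> nat \<Rightarrow> real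
     \<Rightarrow> ('n::finite \<Rightarrow> 'g \<Rightarrow> real) \<Rightarrow> ennreal" where
  "Sobolev_norm_vec A M X s p \<alpha> = (\<Sum>i\<in>UNIV. Sobolev_norm A M X s p (\<alpha> i))"

definition Sobolev_closure ::
  "('g::topological_space, 'e::euclidean_space) atlas \<Rightarrow> 'g measure
     \<Rightarrow> ('k::finite \<Rightarrow> ('g \<Rightarrow> real) \<Rightarrow> 'g \<Rightarrow> real) \<Rightarrow> nat \<Rightarrow> real
     \<Rightarrow> ('n::finite \<Rightarrow> 'g \<Rightarrow> real) set \<Rightarrow> ('n \<Rightarrow> 'g \<Rightarrow> real) set" where
  "Sobolev_closure A M X s p D =
     {\<alpha> \<in> Sobolev_vec A M X s p.
        \<forall>\<epsilon>>0. \<exists>\<beta>\<in>D. Sobolev_norm_vec A M X s p (\<lambda>i y. \<alpha> i y - \<beta> i y) < \<epsilon>}"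

end

theory Submission
  imports Defs
begin

text \<open>
  Everything follows from comparing the graph norm of the operator with the Sobolev norm on test
  functions. For the upper bound, left invariance of the principal part and Fubini's theorem show
  that, on given test functions, its coefficients may be frozen at almost every point of the group,
  hence at a point of a set of positive measure on which they are bounded.
  For the lower bound, maximal hypoellipticity on \<open>\<Omega>\<close> is applied to left translates of
  \<open>ltrans x \<phi> \<cdot> \<alpha>\<close>, where \<open>\<phi>\<close> is a fixed bump function supported in \<open>\<Omega>\<close>, and the resulting
  inequalities for \<open>p\<close>-th powers are integrated over \<open>x\<close>: by Tonelli and left invariance of
  the measure this replaces a partition of unity. The commutators and the lower order part produce
  only derivatives of order less than \<open>m\<close>, which are absorbed with the interpolation inequality
  \<open>\<parallel>X u\<parallel> \<le> \<epsilon> \<parallel>X X u\<parallel> + C \<parallel>u\<parallel>\<close>. The latter comes from Taylor expansion along an integral curve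
  \<open>\<gamma>\<close> of \<open>X\<close> through the identity, since \<open>u (y + \<gamma> t)\<close> has derivative \<open>X u (y + \<gamma> t)\<close> by left
  invariance and right translations are bounded on \<open>L\<^sup>p\<close>, locally uniformly.
\<close>

section \<open>Calculus of \<open>C\<^sup>k\<close> functions\<close>

text \<open>The top order coefficients are merely measurable, and linear relations among the
  \<open>X\<^sub>I\<close> keep left invariance from forcing them to be constant. The commutator
  with a cut-off compares the operator on a vector and on its cut-off version, which must be frozen
  at the same point; hence test functions are frozen in pairs. The lower order part need not be
  invariant; it enters only through its absolute value, at the price of derivatives of order less
  than \<open>m\<close>. Estimates concern \<open>p\<close>-th powers, with no care for constants:
  these can be integrated over the translation parameter, and elementary inequalities with a free
  parameter do the work of Hoelder and Minkowski. The group may fail to be unimodular, so right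
  translation and inversion change the measure; uniqueness of left Haar measure supplies the modular
  function. The norm comparison gives the two inclusions because \<open>L\<^sup>p\<close> is
  complete and weak derivatives are stable under \<open>L\<^sup>p\<close> limits.\<close>

lemma Ck_on_cong:
  assumes "open S" "\<And>x. x \<in> S \<Longrightarrow> f x = g x" "Ck_on k f S"
  shows "Ck_on k g S"
  using assms(2,3)
proof (induction k arbitrary: f g)
  case 0
  then show ?case using continuous_on_cong[of S S f g] by simp
next
  case (Suc k)
  have d: "f differentiable (at x)" "g differentiable (at x)"
    "frechet_derivative f (at x) = frechet_derivative g (at x)" if "x \<in> S" for x
  proof -
    show 1: "f differentiable (at x)" using Suc.prems that by simp
    then show 2: "g differentiable (at x)"
      unfolding differentiable_def
      using has_derivative_transform_within_open[OF _ assms(1) that, of f _ UNIV g] Suc.prems(1) by blast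
    show "frechet_derivative f (at x) = frechet_derivative g (at x)"
      using frechet_derivative_transform_within_open[OF 1 assms(1) that] Suc.prems(1) by blast
  qed
  have "Ck_on k (\<lambda>x. frechet_derivative g (at x) v) S" for v
    using Suc.IH[of "\<lambda>x. frechet_derivative f (at x) v"] Suc.prems(2) d(3) by simp
  then show ?case using d by simp
qed

lemma Ck_on_SucI:
  assumes "open S" "\<And>x. x \<in> S \<Longrightarrow> (f has_derivative D x) (at x)"
    "\<And>v. Ck_on k (\<lambda>x. D x v) S"
  shows "Ck_on (Suc k) f S"
proof -
  have "frechet_derivative f (at x) = D x" if "x \<in> S" for x
    using frechet_derivative_at[OF assms(2)[OF that]] by simp
  then have "Ck_on k (\<lambda>x. frechet_derivative f (at x) v) S" for v
    using Ck_on_cong[OF assms(1) _ assms(3)[of v]] by simp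
  then show ?thesis using assms(2) by (auto simp: differentiable_def)
qed

lemma Ck_on_SucE:
  assumes "Ck_on (Suc k) f S"
  shows "\<And>x. x \<in> S \<Longrightarrow> (f has_derivative frechet_derivative f (at x)) (at x)"
    and "Ck_on k (\<lambda>x. frechet_derivative f (at x) v) S"
  using assms by (auto simp: frechet_derivative_works)

lemma Ck_on_subset: "Ck_on k f S \<Longrightarrow> T \<subseteq> S \<Longrightarrow> Ck_on k f T"
  by (induction k arbitrary: f) (auto intro: continuous_on_subset)

lemma Ck_on_SucD:
  assumes "Ck_on (Suc k) f S" shows "Ck_on k f S"
  using assms
proof (induction k arbitrary: f)
  case 0
  then show ?case
    by (simp add: continuous_at_imp_continuous_on differentiable_imp_continuous_within)
qed auto

lemma Ck_on_imp_continuous_on: "Ck_on k f S \<Longrightarrow> continuous_on S f"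
  by (induction k) (use Ck_on_SucD in auto)

lemma Ck_on_local:
  assumes "open S" "\<And>x. x \<in> S \<Longrightarrow> \<exists>T. open T \<and> x \<in> T \<and> Ck_on k f (S \<inter> T)"
  shows "Ck_on k f S"
  using assms(2)
proof (induction k arbitrary: f)
  case 0
  have "isCont f x" if "x \<in> S" for x
    using 0[OF that] assms(1) that
    by (metis Ck_on.simps(1) IntI continuous_on_eq_continuous_at open_Int)
  then show ?case using continuous_at_imp_continuous_on by auto
next
  case (Suc k)
  have "f differentiable (at x)" if "x \<in> S" for x
    using Suc.prems[OF that] that by auto
  moreover have "Ck_on k (\<lambda>x. frechet_derivative f (at x) v) S" for v
  proof (rule Suc.IH)
    fix x assume "x \<in> S"
    then obtain T where "open T" "x \<in> T" "Ck_on (Suc k) f (S \<inter> T)" using Suc.prems by blast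
    then show "\<exists>T. open T \<and> x \<in> T \<and> Ck_on k (\<lambda>x. frechet_derivative f (at x) v) (S \<inter> T)"
      using Ck_on_SucE(2) by blast
  qed
  ultimately show ?case by simp
qed

lemma Ck_on_const: "Ck_on k (\<lambda>x. c) S"
  by (induction k arbitrary: c) auto

lemma Ck_on_bounded_linear:
  assumes "open S" "bounded_linear h" shows "Ck_on k h S"
proof (cases k)
  case 0
  then show ?thesis using assms(2) by (simp add: linear_continuous_on)
next
  case (Suc n)
  have "Ck_on (Suc n) h S"
    by (rule Ck_on_SucI[OF assms(1), where D="\<lambda>x. h"])
      (auto simp: assms bounded_linear_imp_has_derivative Ck_on_const)
  then show ?thesis using Suc by simp
qed

lemma Ck_on_add:
  assumes "open S" "Ck_on k f S" "Ck_on k g S" shows "Ck_on k (\<lambda>x. f x + g x) S"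
  using assms(2,3)
proof (induction k arbitrary: f g)
  case (Suc k)
  note f = Ck_on_SucE[OF Suc.prems(1)] and g = Ck_on_SucE[OF Suc.prems(2)]
  show ?case
    by (rule Ck_on_SucI[OF assms(1) has_derivative_add[OF f(1) g(1)] Suc.IH[OF f(2) g(2)]])
qed (auto intro: continuous_on_add)

lemma Ck_on_linear_comp:
  assumes "open S" "bounded_linear h" "Ck_on k f S" shows "Ck_on k (\<lambda>x. h (f x)) S"
  using assms(3)
proof (induction k arbitrary: f)
  case 0
  then show ?case using assms(2)
    by (auto intro: continuous_on_compose2 linear_continuous_on)
next
  case (Suc k)
  note f = Ck_on_SucE[OF Suc.prems(1)]
  show ?case
    by (rule Ck_on_SucI[OF assms(1) bounded_linear.has_derivative[OF assms(2) f(1)] Suc.IH[OF f(2)]])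
qed

lemma Ck_on_scaleR:
  fixes r :: "_ \<Rightarrow> real"
  assumes "open S" "Ck_on k r S" "Ck_on k f S" shows "Ck_on k (\<lambda>x. r x *\<^sub>R f x) S"
  using assms(2,3)
proof (induction k arbitrary: r f)
  case (Suc k)
  note r = Ck_on_SucE[OF Suc.prems(1)] and f = Ck_on_SucE[OF Suc.prems(2)]
  show ?case
  proof (rule Ck_on_SucI[OF assms(1) has_derivative_scaleR[OF r(1) f(1)]])
    show "Ck_on k (\<lambda>x. r x *\<^sub>R frechet_derivative f (at x) v + frechet_derivative r (at x) v *\<^sub>R f x) S" for v
      by (intro Ck_on_add[OF assms(1)] Suc.IH r(2) f(2) Ck_on_SucD[OF Suc.prems(1)] Ck_on_SucD[OF Suc.prems(2)])
  qed
qed (auto intro: continuous_on_scaleR)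

lemma Ck_on_mult:
  fixes f g :: "_ \<Rightarrow> real"
  assumes "open S" "Ck_on k f S" "Ck_on k g S" shows "Ck_on k (\<lambda>x. f x * g x) S"
  using Ck_on_scaleR[OF assms] by simp

lemma Ck_on_sum:
  assumes "open S" "\<And>i. i \<in> I \<Longrightarrow> Ck_on k (f i) S"
  shows "Ck_on k (\<lambda>x. \<Sum>i\<in>I. f i x) S"
  using assms(2) by (induction I rule: infinite_finite_induct)
    (auto intro: Ck_on_const Ck_on_add[OF assms(1)])

text \<open>The induction varies \<open>g\<close> and keeps \<open>f\<close>. The chain rule applies
  \<open>frechet_derivative g (at (f x))\<close> to a direction that itself depends on
  \<open>x\<close>. Expanding this direction in \<open>Basis\<close> leaves partial derivatives of
  \<open>g\<close> composed with \<open>f\<close>, to which the induction hypothesis applies, times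
  coefficients of class \<open>k\<close>.\<close>

lemma Ck_on_compose:
  fixes f :: "'a::euclidean_space \<Rightarrow> 'b::euclidean_space" and g :: "'b \<Rightarrow> 'c::real_normed_vector"
  assumes "open S" "open T" "f ` S \<subseteq> T" "Ck_on k f S" "Ck_on k g T"
  shows "Ck_on k (\<lambda>x. g (f x)) S"
  using assms(4,5)
proof (induction k arbitrary: g)
  case 0
  then show ?case using assms(3) by (auto intro: continuous_on_compose2)
next
  case (Suc k)
  note f = Ck_on_SucE[OF Suc.prems(1)] and g = Ck_on_SucE[OF Suc.prems(2)]
  let ?D = "\<lambda>x v. \<Sum>b\<in>Basis. (frechet_derivative f (at x) v \<bullet> b) *\<^sub>R frechet_derivative g (at (f x)) b"
  have lin: "frechet_derivative g (at (f x)) w = (\<Sum>b\<in>Basis. (w \<bullet> b) *\<^sub>R frechet_derivative g (at (f x)) b)"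
    if "x \<in> S" for x w
  proof -
    have l: "linear (frechet_derivative g (at (f x)))"
      using g(1)[of "f x"] that assms(3) by (meson differentiable_def image_subset_iff linear_frechet_derivative)
    have "frechet_derivative g (at (f x)) w = frechet_derivative g (at (f x)) (\<Sum>b\<in>Basis. (w \<bullet> b) *\<^sub>R b)"
      by (simp add: euclidean_representation)
    then show ?thesis by (simp add: linear_sum[OF l] linear_cmul[OF l])
  qed
  have "((\<lambda>x. g (f x)) has_derivative ?D x) (at x)" if "x \<in> S" for x
  proof -
    have "(\<lambda>v. frechet_derivative g (at (f x)) (frechet_derivative f (at x) v)) = ?D x"
      by (rule ext, rule lin[OF that])
    then show ?thesis
      using diff_chain_at[OF f(1)[OF that] g(1)[of "f x"]] that assms(3) by (auto simp: o_def)
  qed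
  then show ?case
  proof (rule Ck_on_SucI[OF assms(1)])
    show "Ck_on k (\<lambda>x. ?D x v) S" for v
      by (intro Ck_on_sum Ck_on_scaleR assms(1) Suc.IH g(2) Ck_on_SucD[OF Suc.prems(1)]
          Ck_on_linear_comp[OF _ bounded_linear_inner_left] f(2))
  qed
qed

lemma smooth_on_cong:
  "open S \<Longrightarrow> (\<And>x. x \<in> S \<Longrightarrow> f x = g x) \<Longrightarrow> smooth_on f S \<Longrightarrow> smooth_on g S"
  unfolding smooth_on_def using Ck_on_cong by blast

lemma smooth_on_local:
  assumes "open S" "\<And>x. x \<in> S \<Longrightarrow> \<exists>T. open T \<and> x \<in> T \<and> smooth_on f (S \<inter> T)"
  shows "smooth_on f S"
  unfolding smooth_on_def using assms by (meson Ck_on_local smooth_on_def)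

lemma smooth_on_subset: "smooth_on f S \<Longrightarrow> T \<subseteq> S \<Longrightarrow> smooth_on f T"
  by (auto simp: smooth_on_def intro: Ck_on_subset)

lemma smooth_on_const: "smooth_on (\<lambda>x. c) S"
  by (auto simp: smooth_on_def intro: Ck_on_const)

lemma smooth_on_bounded_linear: "open S \<Longrightarrow> bounded_linear h \<Longrightarrow> smooth_on h S"
  by (auto simp: smooth_on_def intro: Ck_on_bounded_linear)

lemma smooth_on_add:
  "open S \<Longrightarrow> smooth_on f S \<Longrightarrow> smooth_on g S \<Longrightarrow> smooth_on (\<lambda>x. f x + g x) S"
  by (auto simp: smooth_on_def intro: Ck_on_add)

lemma smooth_on_mult:
  fixes f g :: "_ \<Rightarrow> real"
  shows "open S \<Longrightarrow> smooth_on f S \<Longrightarrow> smooth_on g S \<Longrightarrow> smooth_on (\<lambda>x. f x * g x) S"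
  by (auto simp: smooth_on_def intro: Ck_on_mult)

lemma smooth_on_sum:
  "open S \<Longrightarrow> (\<And>i. i \<in> I \<Longrightarrow> smooth_on (f i) S) \<Longrightarrow> smooth_on (\<lambda>x. \<Sum>i\<in>I. f i x) S"
  by (auto simp: smooth_on_def intro: Ck_on_sum)

lemma smooth_on_compose:
  fixes f :: "'a::euclidean_space \<Rightarrow> 'b::euclidean_space" and g :: "'b \<Rightarrow> 'c::real_normed_vector"
  shows "open S \<Longrightarrow> open T \<Longrightarrow> f ` S \<subseteq> T \<Longrightarrow> smooth_on f S \<Longrightarrow> smooth_on g T
    \<Longrightarrow> smooth_on (\<lambda>x. g (f x)) S"
  unfolding smooth_on_def by (metis Ck_on_compose)

lemma smooth_on_imp_continuous_on: "smooth_on f S \<Longrightarrow> continuous_on S f"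
  by (auto simp: smooth_on_def dest: spec[of _ 0])

lemma smooth_on_inner_self: "smooth_on (\<lambda>x::'a::euclidean_space. x \<bullet> x) UNIV"
proof -
  have "smooth_on (\<lambda>x::'a. \<Sum>b\<in>Basis. (x \<bullet> b) * (x \<bullet> b)) UNIV"
    by (intro smooth_on_sum smooth_on_mult smooth_on_bounded_linear bounded_linear_inner_left) auto
  then show ?thesis by (subst euclidean_inner)
qed

section \<open>Smooth cut-off functions on a Euclidean space\<close>

lemma Ck_on_real_deriv:
  fixes f :: "real \<Rightarrow> real"
  assumes "open S" "\<And>x. x \<in> S \<Longrightarrow> (f has_real_derivative f' x) (at x)" "Ck_on k f' S"
  shows "Ck_on (Suc k) f S"
proof (rule Ck_on_SucI[OF assms(1)])
  show "(f has_derivative (*) (f' x)) (at x)" if "x \<in> S" for x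
    using assms(2)[OF that] by (simp add: has_field_derivative_def)
  show "Ck_on k (\<lambda>x. f' x * v) S" for v
    by (intro Ck_on_mult assms Ck_on_const)
qed

lemma DERIV_inverse_power:
  fixes x :: real
  assumes "x \<noteq> 0"
  shows "((\<lambda>t. inverse t ^ n) has_real_derivative (- real n) * inverse x ^ (n + 1)) (at x)"
proof (cases n)
  case (Suc k)
  show ?thesis
    by (rule DERIV_cong[OF DERIV_power[OF DERIV_inverse[OF assms]]]) (simp add: Suc algebra_simps)
qed simp

lemma smooth_on_inverse: "smooth_on (inverse :: real \<Rightarrow> real) {0<..}"
proof -
  \<comment> \<open>All powers are treated together, since the derivative of one is a multiple of
    the next.\<close>
  have "Ck_on k (\<lambda>t::real. inverse t ^ n) {0<..}" for k n
  proof (induction k arbitrary: n)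
    case 0
    then show ?case by (auto intro!: continuous_intros)
  next
    case (Suc k)
    show ?case
    proof (rule Ck_on_real_deriv)
      show "((\<lambda>t. inverse t ^ n) has_real_derivative (- real n) * inverse x ^ (n + 1)) (at x)"
        if "x \<in> {0<..}" for x
        using DERIV_inverse_power that by auto
    qed (intro Ck_on_mult Ck_on_const Suc open_greaterThan)+
  qed
  from this[of _ 1] show ?thesis by (simp add: smooth_on_def)
qed

text \<open>Only \<open>n = 0\<close>, the classical flat function, is of interest. The powers make
  the family closed under differentiation up to linear combinations, so that smoothness of all
  members follows by one induction.\<close>

definition flat_exp :: "nat \<Rightarrow> real \<Rightarrow> real" where
  "flat_exp n t = (if t > 0 then inverse t ^ n * exp (- inverse t) else 0)"

lemma flat_exp_tendsto: "(flat_exp n \<longlongrightarrow> 0) (at 0)"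
proof -
  have "((\<lambda>s. s ^ n / exp s) \<longlongrightarrow> (0::real)) at_top" by (rule tendsto_power_div_exp_0)
  then have "((\<lambda>t. inverse t ^ n / exp (inverse t)) \<longlongrightarrow> (0::real)) (at_right 0)"
    by (rule filterlim_compose[OF _ filterlim_inverse_at_top_right])
  then have r: "(flat_exp n \<longlongrightarrow> 0) (at_right 0)"
    by (rule Lim_transform_eventually)
      (auto simp: eventually_at_filter flat_exp_def exp_minus field_simps)
  have "(flat_exp n \<longlongrightarrow> 0) (at_left 0)"
    by (rule tendsto_eventually) (auto simp: eventually_at_filter flat_exp_def)
  with r show ?thesis by (simp add: filterlim_split_at)
qed

lemma flat_exp_deriv:
  "(flat_exp n has_real_derivative flat_exp (n + 2) t - real n * flat_exp (n + 1) t) (at t)"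
proof -
  consider "t > 0" | "t < 0" | "t = 0" by linarith
  then show ?thesis
  proof cases
    case 1
    have "((\<lambda>t. inverse t ^ n * exp (- inverse t)) has_real_derivative
        inverse t ^ (n + 2) * exp (- inverse t) - n * (inverse t ^ (n + 1) * exp (- inverse t))) (at t)"
      by (rule DERIV_cong[OF DERIV_mult[OF DERIV_inverse_power DERIV_chain2[OF DERIV_exp
              DERIV_minus[OF DERIV_inverse]]]]) (use 1 in \<open>auto simp: algebra_simps power2_eq_square\<close>)
    then have "(flat_exp n has_real_derivative
        inverse t ^ (n + 2) * exp (- inverse t) - n * (inverse t ^ (n + 1) * exp (- inverse t))) (at t)"
      by (rule has_field_derivative_transform_within_open[where S="{0<..}"])
        (use 1 in \<open>auto simp: flat_exp_def\<close>)
    then show ?thesis using 1 by (simp add: flat_exp_def)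
  next
    case 2
    have "((\<lambda>t. 0) has_real_derivative 0) (at t)" by simp
    then have "(flat_exp n has_real_derivative 0) (at t)"
      by (rule has_field_derivative_transform_within_open[where S="{..<0}"])
        (use 2 in \<open>auto simp: flat_exp_def\<close>)
    then show ?thesis using 2 by (simp add: flat_exp_def)
  next
    case 3
    \<comment> \<open>The difference quotient at 0 is \<open>flat_exp (n + 1)\<close> itself, whose
      limit is already known.\<close>
    have "((\<lambda>h. (flat_exp n (0 + h) - flat_exp n 0) / h) \<longlongrightarrow> 0) (at 0)"
      by (rule Lim_transform_eventually[OF flat_exp_tendsto[of "n+1"]])
        (auto simp: eventually_at_filter flat_exp_def field_simps)
    then show ?thesis using 3 by (simp add: DERIV_def flat_exp_def)
  qed
qed

lemma smooth_on_flat_exp: "smooth_on (flat_exp n) UNIV"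
proof -
  have "Ck_on k (flat_exp n) UNIV" for k
  proof (induction k arbitrary: n)
    case 0
    then show ?case using flat_exp_deriv by (auto intro!: continuous_at_imp_continuous_on DERIV_isCont)
  next
    case (Suc k)
    have "Ck_on k (\<lambda>t. flat_exp (n + 2) t + (- real n) * flat_exp (n + 1) t) UNIV"
      by (intro Ck_on_add Ck_on_mult Ck_on_const Suc) auto
    then show ?case
      by (intro Ck_on_real_deriv[OF _ flat_exp_deriv]) (auto simp: algebra_simps)
  qed
  then show ?thesis by (simp add: smooth_on_def)
qed

definition smooth_step :: "real \<Rightarrow> real" where
  "smooth_step t = flat_exp 0 t * inverse (flat_exp 0 t + flat_exp 0 (1 - t))"

lemma flat_exp_0_pos [simp]: "flat_exp 0 t > 0 \<longleftrightarrow> t > 0"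
  and flat_exp_nonneg [simp]: "flat_exp 0 t \<ge> 0"
  by (auto simp: flat_exp_def)

lemma smooth_step_denom_pos: "flat_exp 0 t + flat_exp 0 (1 - t) > 0"
  using flat_exp_0_pos[of t] flat_exp_0_pos[of "1 - t"] flat_exp_nonneg[of t] flat_exp_nonneg[of "1-t"]
  by (smt (verit))

lemma smooth_step_props:
  shows smooth_step_eq_0: "t \<le> 0 \<Longrightarrow> smooth_step t = 0"
    and smooth_step_eq_1: "t \<ge> 1 \<Longrightarrow> smooth_step t = 1"
    and smooth_step_nonneg: "0 \<le> smooth_step t"
    and smooth_step_le_1: "smooth_step t \<le> 1"
proof -
  show "t \<le> 0 \<Longrightarrow> smooth_step t = 0" by (auto simp: smooth_step_def flat_exp_def)
  show "t \<ge> 1 \<Longrightarrow> smooth_step t = 1" by (auto simp: smooth_step_def flat_exp_def)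
  show "0 \<le> smooth_step t" by (simp add: smooth_step_def)
  show "smooth_step t \<le> 1"
    using smooth_step_denom_pos[of t] flat_exp_nonneg[of "1 - t"]
    by (simp add: smooth_step_def field_simps del: flat_exp_nonneg)
qed

lemma smooth_on_smooth_step: "smooth_on smooth_step UNIV"
proof -
  have 1: "smooth_on (\<lambda>t. flat_exp 0 (1 + (-1) * t)) UNIV"
    by (rule smooth_on_compose[OF _ _ _ _ smooth_on_flat_exp])
      (intro smooth_on_add smooth_on_mult smooth_on_const smooth_on_bounded_linear
        bounded_linear_ident open_UNIV subset_UNIV)+
  have 2: "smooth_on (\<lambda>t. flat_exp 0 t + flat_exp 0 (1 - t)) UNIV"
    using smooth_on_add[OF _ smooth_on_flat_exp 1] by simp
  have "smooth_on (\<lambda>t. inverse (flat_exp 0 t + flat_exp 0 (1 - t))) UNIV"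
    by (rule smooth_on_compose[OF _ _ _ 2 smooth_on_inverse]) (use smooth_step_denom_pos in auto)
  then show ?thesis unfolding smooth_step_def [abs_def]
    by (intro smooth_on_mult smooth_on_flat_exp) auto
qed

lemma exists_bump_Euclidean:
  fixes z :: "'a::euclidean_space"
  assumes "r > 0"
  obtains \<rho> :: "'a \<Rightarrow> real" where "smooth_on \<rho> UNIV" "\<And>x. 0 \<le> \<rho> x" "\<And>x. \<rho> x \<le> 1"
    "\<And>x. x \<in> cball z r \<Longrightarrow> \<rho> x = 1" "\<And>x. x \<notin> cball z (2 * r) \<Longrightarrow> \<rho> x = 0"
proof
  \<comment> \<open>The squared distance is smooth where the distance is not. This argument of
    \<open>smooth_step\<close> is at least 1 on the ball of radius \<open>r\<close> and at most 0
    once the squared distance reaches twice the square of \<open>r\<close>, in particular outside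
    radius \<open>2 * r\<close>.\<close>
  let ?q = "\<lambda>x. 2 + (-1 / r\<^sup>2) * ((x - z) \<bullet> (x - z))"
  let ?\<rho> = "\<lambda>x. smooth_step (?q x)"
  have tr: "smooth_on (\<lambda>x. x + (- z)) UNIV"
    by (intro smooth_on_add smooth_on_const smooth_on_bounded_linear) auto
  have "smooth_on (\<lambda>x. (x + (- z)) \<bullet> (x + (- z))) UNIV"
    by (rule smooth_on_compose[OF _ _ _ tr smooth_on_inner_self]) auto
  then have q: "smooth_on ?q UNIV"
    by (intro smooth_on_add smooth_on_mult smooth_on_const) auto
  show "smooth_on ?\<rho> UNIV"
    by (rule smooth_on_compose[OF _ _ _ q smooth_on_smooth_step]) auto
  fix x
  have n: "(x - z) \<bullet> (x - z) = (dist z x)\<^sup>2"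
    by (simp add: dist_norm norm_minus_commute power2_norm_eq_inner)
  show "0 \<le> ?\<rho> x" "?\<rho> x \<le> 1" by (rule smooth_step_nonneg smooth_step_le_1)+
  show "?\<rho> x = 1" if "x \<in> cball z r"
  proof (rule smooth_step_eq_1)
    have "(dist z x)\<^sup>2 \<le> r\<^sup>2" using that assms by (intro power_mono) auto
    then show "1 \<le> ?q x" using assms by (simp add: n field_simps)
  qed
  show "?\<rho> x = 0" if "x \<notin> cball z (2 * r)"
  proof (rule smooth_step_eq_0)
    have "(2 * r)\<^sup>2 \<le> (dist z x)\<^sup>2" using that assms by (intro power_mono) auto
    moreover have "2 * r\<^sup>2 \<le> (2 * r)\<^sup>2" by (simp add: power2_eq_square)
    ultimately have "2 * r\<^sup>2 \<le> (dist z x)\<^sup>2" by linarith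
    then show "?q x \<le> 0" using assms by (simp add: n field_simps)
  qed
qed

subsection \<open>Hadamard's lemma\<close>

text \<open>Differentiation under the integral sign brings out a factor \<open>t\<close>. The weight
  \<open>t ^ j\<close> absorbs it, so the induction must carry an arbitrary \<open>j\<close>
  although the application has \<open>j = 0\<close>.\<close>

lemma Ck_on_segment_integral:
  fixes h :: "'a::euclidean_space \<Rightarrow> real"
  assumes "open S" "convex S" "q \<in> S" "Ck_on k h S"
  shows "Ck_on k (\<lambda>x. integral {0..1} (\<lambda>t. t ^ j * h (q + t *\<^sub>R (x - q)))) S"
  using assms(4)
proof (induction k arbitrary: h j)
  case 0
  have seg: "q + t *\<^sub>R (x - q) \<in> S" if "x \<in> S" "t \<in> {0..1}" for x t
    using that assms(2,3) convex_alt[of S] by (auto simp: algebra_simps)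
  have "continuous_on (S \<times> cbox 0 1) (\<lambda>(x, t). t ^ j * h (q + t *\<^sub>R (x - q)))"
    unfolding case_prod_beta
    by (intro continuous_intros continuous_on_compose2[OF 0[unfolded Ck_on.simps(1)]])
      (use seg in auto)
  then have "continuous_on S (\<lambda>x. integral (cbox 0 1) (\<lambda>t. t ^ j * h (q + t *\<^sub>R (x - q))))"
    by (rule integral_continuous_on_param)
  then show ?case by simp
next
  case (Suc k)
  have seg: "q + t *\<^sub>R (x - q) \<in> S" if "x \<in> S" "t \<in> {0..1}" for x t
    using that assms(2,3) convex_alt[of S] by (auto simp: algebra_simps)
  note h = Ck_on_SucE[OF Suc.prems]
  \<comment> \<open>\<open>leibniz_rule\<close> asks for a derivative with values in the bounded
    linear maps, jointly continuous in both variables; continuity is checked on each direction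
    separately.\<close>
  define D where "D x t = Blinfun (\<lambda>v. t ^ Suc j * frechet_derivative h (at (q + t *\<^sub>R (x - q))) v)" for x t
  have D: "blinfun_apply (D x t) = (\<lambda>v. t ^ Suc j * frechet_derivative h (at (q + t *\<^sub>R (x - q))) v)"
    if "x \<in> S" "t \<in> {0..1}" for x t
    unfolding D_def
    by (rule bounded_linear_Blinfun_apply)
      (intro bounded_linear_intros has_derivative_bounded_linear[OF h(1)[OF seg[OF that]]])
  have hc: "continuous_on S h" using Ck_on_imp_continuous_on Suc.prems by blast
  have contD: "continuous_on (S \<times> cbox 0 1) (\<lambda>(x, t). D x t)"
  proof (rule continuous_on_blinfun_componentwise)
    fix i :: 'a
    have c: "continuous_on (S \<times> cbox 0 1)
        (\<lambda>(x, t). t ^ Suc j * frechet_derivative h (at (q + t *\<^sub>R (x - q))) i)"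
      unfolding case_prod_beta
      by (intro continuous_intros continuous_on_compose2[OF Ck_on_imp_continuous_on[OF h(2)]])
        (use seg in auto)
    show "continuous_on (S \<times> cbox 0 1) (\<lambda>x. blinfun_apply (case x of (x, t) \<Rightarrow> D x t) i)"
      by (rule continuous_on_eq[OF c]) (auto simp: D)
  qed
  have der: "((\<lambda>x. t ^ j * h (q + t *\<^sub>R (x - q))) has_derivative blinfun_apply (D x t)) (at x within S)"
    if "x \<in> S" "t \<in> cbox 0 1" for x t
  proof -
    have t: "t \<in> {0..1}" using that by simp
    have "((\<lambda>x. q + t *\<^sub>R (x - q)) has_derivative (\<lambda>v. t *\<^sub>R v)) (at x)"
      by (auto intro!: derivative_eq_intros)
    from diff_chain_at[OF this h(1)[OF seg[OF that(1) t]]]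
    have "((\<lambda>x. h (q + t *\<^sub>R (x - q))) has_derivative
        (\<lambda>v. frechet_derivative h (at (q + t *\<^sub>R (x - q))) (t *\<^sub>R v))) (at x)"
      by (simp add: o_def)
    moreover have "frechet_derivative h (at (q + t *\<^sub>R (x - q))) (t *\<^sub>R v) =
        t * frechet_derivative h (at (q + t *\<^sub>R (x - q))) v" for v
      using linear_cmul[OF has_derivative_linear[OF h(1)[OF seg[OF that(1) t]]], of t v] by simp
    ultimately have "((\<lambda>x. t ^ j * h (q + t *\<^sub>R (x - q))) has_derivative
        (\<lambda>v. t ^ j * (t * frechet_derivative h (at (q + t *\<^sub>R (x - q))) v))) (at x)"
      by (intro has_derivative_mult_right) simp
    then show ?thesis
      by (auto simp: D[OF that(1) t] mult.assoc mult.left_commute intro: has_derivative_at_withinI)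
  qed
  have int: "(\<lambda>t. t ^ j * h (q + t *\<^sub>R (x - q))) integrable_on cbox 0 1" if "x \<in> S" for x
    by (intro integrable_continuous continuous_intros continuous_on_compose2[OF hc])
      (use seg that in auto)
  have "((\<lambda>x. integral (cbox 0 1) (\<lambda>t. t ^ j * h (q + t *\<^sub>R (x - q)))) has_derivative
      (\<lambda>v. integral {0..1} (\<lambda>t. t ^ Suc j * frechet_derivative h (at (q + t *\<^sub>R (x - q))) v))) (at x)"
    if "x \<in> S" for x
  proof -
    have Dint: "D x integrable_on cbox 0 1"
    proof (rule integrable_continuous)
      have "continuous_on (cbox 0 1) (\<lambda>t. (case (x, t) of (x, t) \<Rightarrow> D x t))"
        by (rule continuous_on_compose2[OF contD]) (use that in \<open>auto intro!: continuous_intros\<close>)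
      then show "continuous_on (cbox 0 1) (D x)" by simp
    qed
    have "blinfun_apply (integral (cbox 0 1) (D x)) v =
      integral {0..1} (\<lambda>t. t ^ Suc j * frechet_derivative h (at (q + t *\<^sub>R (x - q))) v)" for v
    proof -
      have "blinfun_apply (integral (cbox 0 1) (D x)) v = integral (cbox 0 1) (\<lambda>t. blinfun_apply (D x t) v)"
        using integral_linear[OF Dint blinfun.bounded_linear_left[of v]] by (simp add: o_def)
      also have "\<dots> = integral {0..1} (\<lambda>t. t ^ Suc j * frechet_derivative h (at (q + t *\<^sub>R (x - q))) v)"
        using D[OF that] by (auto intro!: integral_cong simp del: power_Suc)
      finally show ?thesis .
    qed
    then have "blinfun_apply (integral (cbox 0 1) (D x)) =
      (\<lambda>v. integral {0..1} (\<lambda>t. t ^ Suc j * frechet_derivative h (at (q + t *\<^sub>R (x - q))) v))"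
      by (rule ext)
    with leibniz_rule[OF der int contD that assms(2)] at_within_open[OF that assms(1)]
    show ?thesis by simp
  qed
  then show ?case
    by (intro Ck_on_SucI[OF assms(1)]) (auto intro!: Suc.IH h(2) simp del: power_Suc)
qed

text \<open>The \<open>g b\<close> are the averages of the partial derivatives over the segment from
  \<open>q\<close> to \<open>x\<close>. The factors \<open>(x - q) \<bullet> b\<close> vanish at
  \<open>q\<close>, which lets a derivation evaluated at \<open>q\<close> see nothing but the first
  derivative of \<open>f\<close>.\<close>

lemma Hadamard_lemma:
  fixes f :: "'a::euclidean_space \<Rightarrow> real"
  assumes "open S" "convex S" "q \<in> S" "smooth_on f S"
  obtains g where "\<And>b. smooth_on (g b) S"
    "\<And>x. x \<in> S \<Longrightarrow> f x = f q + (\<Sum>b\<in>Basis. ((x - q) \<bullet> b) * g b x)"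
    "\<And>b. g b q = frechet_derivative f (at q) b"
proof
  define g where "g b x = integral {0..1} (\<lambda>t. frechet_derivative f (at (q + t *\<^sub>R (x - q))) b)" for b x
  have f1: "Ck_on (Suc k) f S" for k using assms(4) unfolding smooth_on_def by blast
  note f = Ck_on_SucE[OF f1]
  have seg: "q + t *\<^sub>R (x - q) \<in> S" if "x \<in> S" "t \<in> {0..1}" for x t
    using that assms(2,3) convex_alt[of S] by (auto simp: algebra_simps)
  show "smooth_on (g b) S" for b
    unfolding smooth_on_def g_def
    using Ck_on_segment_integral[OF assms(1-3) f(2), of _ 0 b] by (simp add: fun_eq_iff)
  show "g b q = frechet_derivative f (at q) b" for b
    by (simp add: g_def)
  show "f x = f q + (\<Sum>b\<in>Basis. ((x - q) \<bullet> b) * g b x)" if "x \<in> S" for x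
  proof -
    have int: "(\<lambda>t. frechet_derivative f (at (q + t *\<^sub>R (x - q))) b) integrable_on {0..1}" for b
      by (intro integrable_continuous_interval continuous_intros
          continuous_on_compose2[OF Ck_on_imp_continuous_on[OF f(2)]]) (use seg that in auto)
    have "((\<lambda>t. frechet_derivative f (at (q + t *\<^sub>R (x - q))) (x - q)) has_integral
        f (q + 1 *\<^sub>R (x - q)) - f (q + 0 *\<^sub>R (x - q))) {0..1}"
    proof (rule fundamental_theorem_of_calculus)
      fix t :: real assume t: "t \<in> {0..1}"
      have "((\<lambda>t. q + t *\<^sub>R (x - q)) has_derivative (\<lambda>s. s *\<^sub>R (x - q))) (at t)"
        by (auto intro!: derivative_eq_intros)
      from diff_chain_at[OF this f(1)[OF seg[OF that t]]]
      have "((\<lambda>t. f (q + t *\<^sub>R (x - q))) has_derivative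
        (\<lambda>s. s * frechet_derivative f (at (q + t *\<^sub>R (x - q))) (x - q))) (at t)"
        using linear_cmul[OF has_derivative_linear[OF f(1)[OF seg[OF that t]]], of _ "x - q"]
        by (simp add: o_def)
      then show "((\<lambda>t. f (q + t *\<^sub>R (x - q))) has_vector_derivative
        frechet_derivative f (at (q + t *\<^sub>R (x - q))) (x - q)) (at t within {0..1})"
        by (simp add: has_vector_derivative_def has_derivative_at_withinI)
    qed simp
    then have "f x - f q = integral {0..1} (\<lambda>t. frechet_derivative f (at (q + t *\<^sub>R (x - q))) (x - q))"
      by (simp add: integral_unique)
    also have "\<dots> = integral {0..1} (\<lambda>t. \<Sum>b\<in>Basis. ((x - q) \<bullet> b) * frechet_derivative f (at (q + t *\<^sub>R (x - q))) b)"
    proof (rule integral_cong)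
      fix t :: real assume t: "t \<in> {0..1}"
      have l: "linear (frechet_derivative f (at (q + t *\<^sub>R (x - q))))"
        using has_derivative_linear[OF f(1)[OF seg[OF that t]]] .
      show "frechet_derivative f (at (q + t *\<^sub>R (x - q))) (x - q) =
        (\<Sum>b\<in>Basis. ((x - q) \<bullet> b) * frechet_derivative f (at (q + t *\<^sub>R (x - q))) b)"
        using linear_sum[OF l, of "\<lambda>b. ((x - q) \<bullet> b) *\<^sub>R b" Basis]
        by (simp add: linear_cmul[OF l] euclidean_representation)
    qed
    also have "\<dots> = (\<Sum>b\<in>Basis. ((x - q) \<bullet> b) * g b x)"
      unfolding g_def by (subst integral_sum) (auto intro!: integrable_on_mult_right int)
    finally show ?thesis by simp
  qed
qed

section \<open>Smooth functions on a manifold and on a Lie group\<close>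

locale smooth_manifold =
  fixes A :: "('g::{t2_space, second_countable_topology}, 'e::euclidean_space) atlas"
  assumes atlas: "smooth_atlas A"
begin

lemma chart:
  assumes "(U, \<phi>) \<in> A"
  shows chart_open: "open U" and chart_open_image: "open (\<phi> ` U)"
    and chart_homeomorphism: "homeomorphism U (\<phi> ` U) \<phi> (inv_into U \<phi>)"
    and chart_inv: "y \<in> U \<Longrightarrow> inv_into U \<phi> (\<phi> y) = y"
    and chart_cont: "continuous_on U \<phi>"
    and chart_inv_cont: "continuous_on (\<phi> ` U) (inv_into U \<phi>)"
    and chart_inv_into: "z \<in> \<phi> ` U \<Longrightarrow> inv_into U \<phi> z \<in> U"
    and chart_f_inv: "z \<in> \<phi> ` U \<Longrightarrow> \<phi> (inv_into U \<phi> z) = z"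
  using assms atlas unfolding smooth_atlas_def homeomorphism_def
  by (auto simp: inv_into_into f_inv_into_f)

lemma chart_transition:
  "(U, \<phi>) \<in> A \<Longrightarrow> (V, \<psi>) \<in> A \<Longrightarrow> smooth_on (\<psi> \<circ> inv_into U \<phi>) (\<phi> ` (U \<inter> V))"
  using atlas unfolding smooth_atlas_def by fast

lemma ex_chart: obtains U \<phi> where "(U, \<phi>) \<in> A" "y \<in> U"
proof -
  have "y \<in> (\<Union>(U, \<phi>)\<in>A. U)" using atlas by (simp add: smooth_atlas_def)
  then show ?thesis using that by auto
qed

lemma chart_image_open:
  assumes "(U, \<phi>) \<in> A" "open W" "W \<subseteq> U" shows "open (\<phi> ` W)"
proof -
  have "openin (top_of_set (\<phi> ` U)) (\<phi> ` W)"
    using homeomorphism_imp_open_map[OF chart_homeomorphism[OF assms(1)]] assms(2,3)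
    by (simp add: openin_open_eq[OF chart_open[OF assms(1)]])
  then show ?thesis using chart_open_image[OF assms(1)] openin_open_trans by blast
qed

lemma chart_preimage_open:
  assumes "(U, \<phi>) \<in> A" "continuous_on (\<phi> ` U) h" "open W"
  shows "open {z \<in> \<phi> ` U. h z \<in> W}"
  using continuous_open_preimage[OF assms(2) chart_open_image[OF assms(1)] assms(3)]
  by (simp add: vimage_def Int_def)

lemma chart_cball:
  assumes "(U, \<phi>) \<in> A" "y \<in> U" "open W" "y \<in> W"
  obtains r where "r > 0" "cball (\<phi> y) r \<subseteq> \<phi> ` (U \<inter> W)"
proof -
  have "open (\<phi> ` (U \<inter> W))"
    using chart_image_open[OF assms(1)] chart_open[OF assms(1)] assms(3) by auto
  moreover have "\<phi> y \<in> \<phi> ` (U \<inter> W)" using assms(2,4) by blast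
  ultimately obtain r where "r > 0" "cball (\<phi> y) r \<subseteq> \<phi> ` (U \<inter> W)"
    using open_contains_cball by blast
  then show ?thesis by (rule that)
qed

lemma chart_inv_compact:
  assumes "(U, \<phi>) \<in> A" "compact K" "K \<subseteq> \<phi> ` U" shows "compact (inv_into U \<phi> ` K)"
  by (rule compact_continuous_image[OF continuous_on_subset[OF chart_inv_cont[OF assms(1)] assms(3)] assms(2)])

lemma smooth_funD: "u \<in> smooth_fun A \<Longrightarrow> (U, \<phi>) \<in> A \<Longrightarrow> smooth_on (u \<circ> inv_into U \<phi>) (\<phi> ` U)"
  by (auto simp: smooth_fun_def)

text \<open>One chart around each point suffices, because the transition maps carry smoothness to
  every other chart of the atlas.\<close>

lemma smooth_funI:
  assumes "\<And>y. \<exists>(U, \<phi>)\<in>A. y \<in> U \<and> (\<exists>T. open T \<and> \<phi> y \<in> T \<and> T \<subseteq> \<phi> ` U \<and> smooth_on (u \<circ> inv_into U \<phi>) T)"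
  shows "u \<in> smooth_fun A"
proof -
  have "smooth_on (u \<circ> inv_into V \<psi>) (\<psi> ` V)" if V: "(V, \<psi>) \<in> A" for V \<psi>
  proof (rule smooth_on_local[OF chart_open_image[OF V]])
    fix z assume z: "z \<in> \<psi> ` V"
    define y where "y = inv_into V \<psi> z"
    have y: "y \<in> V" "\<psi> y = z" using z chart_inv_into[OF V] chart_f_inv[OF V] by (auto simp: y_def)
    obtain U \<phi> T where U: "(U, \<phi>) \<in> A" "y \<in> U" and T: "open T" "\<phi> y \<in> T" "T \<subseteq> \<phi> ` U"
      and sm: "smooth_on (u \<circ> inv_into U \<phi>) T" using assms[of y] by blast
    let ?S = "\<psi> ` (V \<inter> U)"
    have S: "open ?S" using chart_image_open[OF V] chart_open[OF V] chart_open[OF U(1)] by auto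
    have tr: "smooth_on (\<phi> \<circ> inv_into V \<psi>) ?S" using chart_transition[OF V U(1)] .
    let ?R = "?S \<inter> (\<phi> \<circ> inv_into V \<psi>) -` T"
    have R: "open ?R"
      using continuous_open_preimage[OF smooth_on_imp_continuous_on[OF tr] S T(1)] .
    have "z \<in> ?S" using y U(2) by blast
    then have zR: "z \<in> ?R" using T(2) by (simp add: y_def)
    have "smooth_on (\<lambda>x. (u \<circ> inv_into U \<phi>) ((\<phi> \<circ> inv_into V \<psi>) x)) ?R"
      by (rule smooth_on_compose[OF R T(1) _ smooth_on_subset[OF tr] sm]) auto
    then have "smooth_on (u \<circ> inv_into V \<psi>) ?R"
      by (rule smooth_on_cong[OF R, rotated])
        (auto simp: chart_inv[OF V] chart_inv[OF U(1)])
    then show "\<exists>T. open T \<and> z \<in> T \<and> smooth_on (u \<circ> inv_into V \<psi>) (\<psi> ` V \<inter> T)"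
      using R zR by (meson inf_le2 smooth_on_subset)
  qed
  then show ?thesis by (auto simp: smooth_fun_def)
qed

lemma smooth_fun_continuous:
  assumes "u \<in> smooth_fun A" shows "continuous_on T u"
proof -
  have "isCont u y" for y
  proof -
    obtain U \<phi> where U: "(U, \<phi>) \<in> A" "y \<in> U" by (rule ex_chart)
    have "continuous_on U (\<lambda>x. (u \<circ> inv_into U \<phi>) (\<phi> x))"
      by (rule continuous_on_compose2[OF smooth_on_imp_continuous_on[OF smooth_funD[OF assms U(1)]]
            chart_cont[OF U(1)]]) auto
    then have "continuous_on U u"
      by (rule continuous_on_eq) (simp add: chart_inv[OF U(1)])
    then show ?thesis using chart_open[OF U(1)] U(2) continuous_on_eq_continuous_at by blast
  qed
  then show ?thesis by (simp add: continuous_at_imp_continuous_on)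
qed

lemma smooth_fun_const: "(\<lambda>y. c) \<in> smooth_fun A"
  by (auto simp: smooth_fun_def o_def smooth_on_const)

lemma smooth_fun_add:
  "u \<in> smooth_fun A \<Longrightarrow> v \<in> smooth_fun A \<Longrightarrow> (\<lambda>y. u y + v y) \<in> smooth_fun A"
  by (auto simp: smooth_fun_def o_def intro!: smooth_on_add chart_open_image)

lemma smooth_fun_mult:
  "u \<in> smooth_fun A \<Longrightarrow> v \<in> smooth_fun A \<Longrightarrow> (\<lambda>y. u y * v y) \<in> smooth_fun A"
  by (auto simp: smooth_fun_def o_def intro!: smooth_on_mult chart_open_image)

lemma smooth_fun_cmult: "u \<in> smooth_fun A \<Longrightarrow> (\<lambda>y. c * u y) \<in> smooth_fun A"
  using smooth_fun_mult[OF smooth_fun_const] .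

lemma smooth_fun_minus: "u \<in> smooth_fun A \<Longrightarrow> (\<lambda>y. - u y) \<in> smooth_fun A"
  using smooth_fun_cmult[of u "-1"] by simp

lemma smooth_fun_diff:
  "u \<in> smooth_fun A \<Longrightarrow> v \<in> smooth_fun A \<Longrightarrow> (\<lambda>y. u y - v y) \<in> smooth_fun A"
  using smooth_fun_add[OF _ smooth_fun_minus, of u v] by simp

lemma smooth_fun_sum:
  "(\<And>i. i \<in> I \<Longrightarrow> u i \<in> smooth_fun A) \<Longrightarrow> (\<lambda>y. \<Sum>i\<in>I. u i y) \<in> smooth_fun A"
  by (induction I rule: infinite_finite_induct) (auto intro: smooth_fun_const smooth_fun_add)

lemma smooth_fun_compose:
  assumes "u \<in> smooth_fun A" "smooth_on h UNIV" shows "(\<lambda>y. h (u y)) \<in> smooth_fun A"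
proof -
  have "smooth_on (\<lambda>x. h ((u \<circ> inv_into U \<phi>) x)) (\<phi> ` U)" if "(U, \<phi>) \<in> A" for U \<phi>
    by (rule smooth_on_compose[OF chart_open_image[OF that] open_UNIV _ smooth_funD[OF assms(1) that] assms(2)]) simp
  then show ?thesis by (auto simp: smooth_fun_def o_def)
qed

lemma Cc_inftyI:
  assumes "u \<in> smooth_fun A" "compact K" "K \<subseteq> \<Omega>" "\<And>y. y \<notin> K \<Longrightarrow> u y = 0"
  shows "u \<in> Cc_infty A \<Omega>"
proof -
  have "closure {x. u x \<noteq> 0} \<subseteq> K"
    by (rule closure_minimal[OF _ compact_imp_closed[OF assms(2)]]) (use assms(4) in blast)
  then show ?thesis using assms compact_Int_closed[OF assms(2) closed_closure, of "{x. u x \<noteq> 0}"]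
    by (auto simp: Cc_infty_def Int_absorb1)
qed

lemma Cc_inftyE:
  assumes "u \<in> Cc_infty A \<Omega>"
  obtains K where "u \<in> smooth_fun A" "compact K" "K \<subseteq> \<Omega>" "\<And>y. y \<notin> K \<Longrightarrow> u y = 0"
  using assms closure_subset[of "{x. u x \<noteq> 0}"] by (auto simp: Cc_infty_def)

lemma Cc_infty_smooth: "u \<in> Cc_infty A \<Omega> \<Longrightarrow> u \<in> smooth_fun A"
  by (auto simp: Cc_infty_def)

lemma Cc_infty_mono: "u \<in> Cc_infty A \<Omega> \<Longrightarrow> \<Omega> \<subseteq> \<Omega>' \<Longrightarrow> u \<in> Cc_infty A \<Omega>'"
  by (auto simp: Cc_infty_def)

lemma Cc_infty_mult:
  assumes "u \<in> Cc_infty A \<Omega>" "v \<in> smooth_fun A" shows "(\<lambda>y. u y * v y) \<in> Cc_infty A \<Omega>"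
  using assms(1)
proof (rule Cc_inftyE)
  fix K assume "u \<in> smooth_fun A" "compact K" "K \<subseteq> \<Omega>" "\<And>y. y \<notin> K \<Longrightarrow> u y = 0"
  then show ?thesis using assms(2) by (intro Cc_inftyI[of _ K] smooth_fun_mult) auto
qed

lemma Cc_infty_cmult: "u \<in> Cc_infty A \<Omega> \<Longrightarrow> (\<lambda>y. c * u y) \<in> Cc_infty A \<Omega>"
  using Cc_infty_mult[OF _ smooth_fun_const, of u \<Omega> c] by (simp add: mult.commute)

lemma Cc_infty_add:
  assumes "u \<in> Cc_infty A \<Omega>" "v \<in> Cc_infty A \<Omega>" shows "(\<lambda>y. u y + v y) \<in> Cc_infty A \<Omega>"
proof -
  obtain K L where "u \<in> smooth_fun A" "compact K" "K \<subseteq> \<Omega>" "\<And>y. y \<notin> K \<Longrightarrow> u y = 0"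
    "v \<in> smooth_fun A" "compact L" "L \<subseteq> \<Omega>" "\<And>y. y \<notin> L \<Longrightarrow> v y = 0"
    using assms by (meson Cc_inftyE)
  then show ?thesis by (intro Cc_inftyI[of _ "K \<union> L"] smooth_fun_add) auto
qed

lemma Cc_infty_diff:
  "u \<in> Cc_infty A \<Omega> \<Longrightarrow> v \<in> Cc_infty A \<Omega> \<Longrightarrow> (\<lambda>y. u y - v y) \<in> Cc_infty A \<Omega>"
  using Cc_infty_add[OF _ Cc_infty_cmult[of v \<Omega> "-1"], of u] by simp

lemma Cc_infty_zero: "(\<lambda>y. 0) \<in> Cc_infty A \<Omega>"
  by (rule Cc_inftyI[of _ "{}"]) (auto intro: smooth_fun_const)

lemma Cc_infty_sum:
  "(\<And>i. i \<in> I \<Longrightarrow> u i \<in> Cc_infty A \<Omega>) \<Longrightarrow> (\<lambda>y. \<Sum>i\<in>I. u i y) \<in> Cc_infty A \<Omega>"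
  by (induction I rule: infinite_finite_induct) (auto intro: Cc_infty_zero Cc_infty_add)

text \<open>The extension by zero is smooth because the image of the compact set \<open>K\<close> is
  closed in the Hausdorff group: a point outside \<open>U\<close> has a neighbourhood missing this
  image, and the function vanishes there.\<close>

lemma chart_supported_Cc_infty:
  assumes U: "(U, \<phi>) \<in> A" and K: "compact K" "K \<subseteq> \<phi> ` U"
    and f: "smooth_on f (\<phi> ` U)" "\<And>z. z \<in> \<phi> ` U - K \<Longrightarrow> f z = 0"
  shows "(\<lambda>y. if y \<in> U then f (\<phi> y) else 0) \<in> Cc_infty A (inv_into U \<phi> ` K)"
proof -
  let ?u = "\<lambda>y. if y \<in> U then f (\<phi> y) else 0"
  let ?K = "inv_into U \<phi> ` K"
  have cK: "compact ?K" by (rule chart_inv_compact[OF U K])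
  have z: "?u y = 0" if "y \<notin> ?K" for y
  proof (cases "y \<in> U")
    case True
    then have "\<phi> y \<notin> K" using that chart_inv[OF U True] by (metis imageI)
    then show ?thesis using f(2)[of "\<phi> y"] True by simp
  qed simp
  have "?u \<in> smooth_fun A"
  proof (rule smooth_funI)
    fix y
    show "\<exists>(V, \<psi>)\<in>A. y \<in> V \<and> (\<exists>T. open T \<and> \<psi> y \<in> T \<and> T \<subseteq> \<psi> ` V \<and> smooth_on (?u \<circ> inv_into V \<psi>) T)"
    proof (cases "y \<in> U")
      case True
      have "smooth_on (?u \<circ> inv_into U \<phi>) (\<phi> ` U)"
        by (rule smooth_on_cong[OF chart_open_image[OF U] _ f(1)]) (auto simp: chart_inv[OF U])
      then show ?thesis using U True chart_open_image[OF U] by blast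
    next
      case False
      obtain V \<psi> where V: "(V, \<psi>) \<in> A" "y \<in> V" by (rule ex_chart)
      have o: "open (\<psi> ` (V - ?K))"
        using chart_image_open[OF V(1)] chart_open[OF V(1)] compact_imp_closed[OF cK] by blast
      have yK: "y \<notin> ?K" using False K(2) chart_inv_into[OF U] by auto
      have "smooth_on (?u \<circ> inv_into V \<psi>) (\<psi> ` (V - ?K))"
      proof (rule smooth_on_cong[OF o _ smooth_on_const[of 0]])
        fix x assume "x \<in> \<psi> ` (V - ?K)"
        then obtain w where w: "x = \<psi> w" "w \<in> V" "w \<notin> ?K" by blast
        have "?u w = 0" by (rule z[OF w(3)])
        then show "0 = (?u \<circ> inv_into V \<psi>) x"
          by (simp only: comp_apply w(1) chart_inv[OF V(1) w(2)])
      qed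
      moreover have "\<psi> y \<in> \<psi> ` (V - ?K)" "\<psi> ` (V - ?K) \<subseteq> \<psi> ` V" using V(2) yK by auto
      ultimately have "y \<in> V \<and> (\<exists>T. open T \<and> \<psi> y \<in> T \<and> T \<subseteq> \<psi> ` V \<and> smooth_on (?u \<circ> inv_into V \<psi>) T)"
        using V(2) o by metis
      then show ?thesis by (intro bexI[OF _ V(1)]) simp
    qed
  qed
  then show ?thesis by (rule Cc_inftyI[OF _ cK]) (use z in auto)
qed

lemma exists_bump:
  assumes "open W" "y \<in> W"
  obtains \<eta> N where "\<eta> \<in> Cc_infty A W" "\<And>x. 0 \<le> \<eta> x" "open N" "y \<in> N" "N \<subseteq> W"
    "\<And>x. x \<in> N \<Longrightarrow> \<eta> x = 1"
proof -
  obtain U \<phi> where U: "(U, \<phi>) \<in> A" "y \<in> U" by (rule ex_chart)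
  obtain r where r: "r > 0" "cball (\<phi> y) r \<subseteq> \<phi> ` (U \<inter> W)"
    by (rule chart_cball[OF U assms])
  obtain \<rho> :: "'e \<Rightarrow> real" where \<rho>: "smooth_on \<rho> UNIV" "\<And>x. 0 \<le> \<rho> x" "\<And>x. \<rho> x \<le> 1"
    "\<And>x. x \<in> cball (\<phi> y) (r/2) \<Longrightarrow> \<rho> x = 1" "\<And>x. x \<notin> cball (\<phi> y) (2 * (r/2)) \<Longrightarrow> \<rho> x = 0"
    using exists_bump_Euclidean[OF half_gt_zero[OF r(1)], of "\<phi> y"] by blast
  let ?\<eta> = "\<lambda>y. if y \<in> U then \<rho> (\<phi> y) else 0"
  have 1: "?\<eta> \<in> Cc_infty A (inv_into U \<phi> ` cball (\<phi> y) r)"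
  proof (rule chart_supported_Cc_infty[OF U(1)])
    show "smooth_on \<rho> (\<phi> ` U)" using \<rho>(1) by (rule smooth_on_subset) simp
    show "\<rho> z = 0" if "z \<in> \<phi> ` U - cball (\<phi> y) r" for z using \<rho>(5)[of z] that by simp
  qed (use r(2) in auto)
  have "inv_into U \<phi> ` cball (\<phi> y) r \<subseteq> W"
    using r(2) chart_inv[OF U(1)] by auto
  with 1 have 2: "?\<eta> \<in> Cc_infty A W" by (rule Cc_infty_mono)
  let ?N = "U \<inter> \<phi> -` ball (\<phi> y) (r/2)"
  have "open ?N"
    using continuous_open_preimage[OF chart_cont[OF U(1)] chart_open[OF U(1)]] by blast
  moreover have "x \<in> W" if "x \<in> ?N" for x
  proof -
    have "\<phi> x \<in> cball (\<phi> y) r" using that r(1) by auto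
    then have "\<phi> x \<in> \<phi> ` (U \<inter> W)" using r(2) by blast
    then obtain w where w: "w \<in> U" "w \<in> W" "\<phi> x = \<phi> w" by blast
    have "x \<in> U" using that by blast
    then have "x = w" using chart_inv[OF U(1), of x] chart_inv[OF U(1) w(1)] w(3) by metis
    then show ?thesis using w(2) by simp
  qed
  ultimately show ?thesis
    using 2 \<rho>(2,4) U(2) r(1) by (intro that[of ?\<eta> ?N]) auto
qed

text \<open>Local compactness comes from the charts, by way of the support of a bump
  function.\<close>

lemma exists_compact_nbhd:
  fixes y :: 'g
  assumes "open W" "y \<in> W"
  obtains N K where "open N" "y \<in> N" "N \<subseteq> K" "compact K" "K \<subseteq> W"
proof -
  obtain \<eta> N where \<eta>: "\<eta> \<in> Cc_infty A W" "open N" "y \<in> N" "\<And>x. x \<in> N \<Longrightarrow> \<eta> x = 1"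
    using exists_bump[OF assms] by metis
  obtain K where "compact K" "K \<subseteq> W" "\<And>y. y \<notin> K \<Longrightarrow> \<eta> y = 0" using Cc_inftyE[OF \<eta>(1)] by metis
  then show ?thesis using that[of N K] \<eta> by (metis subsetI zero_neq_one)
qed

end

section \<open>Left translations on a Lie group\<close>

locale lie_grp =
  fixes A :: "('g::{topological_group_add, t2_space, second_countable_topology},
               'e::euclidean_space) atlas"
  assumes lie: "lie_group A"

sublocale lie_grp \<subseteq> smooth_manifold
  using lie by unfold_locales (simp add: lie_group_def)

context lie_grp
begin

lemma continuous_translation:
  "continuous_on T (\<lambda>y::'g. x + y)" "continuous_on T (\<lambda>y::'g. y + x)"
  by (intro continuous_intros)+

lemma smooth_fun_ltrans:
  assumes "u \<in> smooth_fun A" shows "ltrans x u \<in> smooth_fun A"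
proof (rule smooth_funI)
  fix y
  obtain V \<psi> where V: "(V, \<psi>) \<in> A" "y \<in> V" by (rule ex_chart)
  obtain W \<theta> where W: "(W, \<theta>) \<in> A" "-x + y \<in> W" by (rule ex_chart)
  obtain U \<phi> where U: "(U, \<phi>) \<in> A" "-x \<in> U" by (rule ex_chart)
  let ?Q = "{(a, b). a \<in> \<phi> ` U \<and> b \<in> \<psi> ` V \<and> inv_into U \<phi> a + inv_into V \<psi> b \<in> W}"
  have sm: "smooth_on (\<lambda>(a, b). \<theta> (inv_into U \<phi> a + inv_into V \<psi> b)) ?Q"
    using lie V W U unfolding lie_group_def by fast
  have "continuous_on (\<phi> ` U \<times> \<psi> ` V) (\<lambda>p. inv_into U \<phi> (fst p) + inv_into V \<psi> (snd p))"
    by (intro continuous_intros continuous_on_compose2[OF chart_inv_cont[OF U(1)]]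
        continuous_on_compose2[OF chart_inv_cont[OF V(1)]]) auto
  then have "open ((\<phi> ` U \<times> \<psi> ` V) \<inter> (\<lambda>p. inv_into U \<phi> (fst p) + inv_into V \<psi> (snd p)) -` W)"
    by (rule continuous_open_preimage)
      (auto intro: open_Times chart_open_image[OF U(1)] chart_open_image[OF V(1)] chart_open[OF W(1)])
  also have "(\<phi> ` U \<times> \<psi> ` V) \<inter> (\<lambda>p. inv_into U \<phi> (fst p) + inv_into V \<psi> (snd p)) -` W = ?Q"
    by auto
  finally have Q: "open ?Q" .
  let ?T = "{z \<in> \<psi> ` V. - x + inv_into V \<psi> z \<in> W}"
  have T: "open ?T"
    by (rule chart_preimage_open[OF V(1)])
      (auto intro!: continuous_intros chart_inv_cont[OF V(1)] chart_open[OF W(1)])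
  \<comment> \<open>Smoothness of the group law is given in two variables. A translation is its
    restriction to the slice where the first variable is the coordinate of \<open>- x\<close>, and
    this affine map parametrizes the slice.\<close>
  have aff: "smooth_on (\<lambda>z::'e. (\<phi> (-x), 0::'e) + (0, z)) ?T"
    by (intro smooth_on_add smooth_on_const smooth_on_bounded_linear T bounded_linear_intros)
  have 1: "smooth_on (\<lambda>z. \<theta> (- x + inv_into V \<psi> z)) ?T"
    by (rule smooth_on_cong[OF T _ smooth_on_compose[OF T Q _ aff sm]])
      (auto simp: chart_inv[OF U(1)] U(2))
  have "smooth_on (\<lambda>z. (u \<circ> inv_into W \<theta>) (\<theta> (- x + inv_into V \<psi> z))) ?T"
    by (rule smooth_on_compose[OF T chart_open_image[OF W(1)] _ 1 smooth_funD[OF assms W(1)]]) auto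
  then have "smooth_on (ltrans x u \<circ> inv_into V \<psi>) ?T"
    by (rule smooth_on_cong[OF T, rotated]) (auto simp: chart_inv[OF W(1)] ltrans_def)
  then show "\<exists>(U, \<phi>)\<in>A. y \<in> U \<and> (\<exists>T. open T \<and> \<phi> y \<in> T \<and> T \<subseteq> \<phi> ` U \<and> smooth_on (ltrans x u \<circ> inv_into U \<phi>) T)"
    using V T W(2) chart_inv[OF V] by (intro bexI[of _ "(V, \<psi>)"]) (auto intro!: exI[of _ ?T])
qed

lemma Cc_infty_ltrans:
  assumes "u \<in> Cc_infty A \<Omega>" shows "ltrans x u \<in> Cc_infty A ((\<lambda>y. x + y) ` \<Omega>)"
  using assms
proof (rule Cc_inftyE)
  fix K assume K: "u \<in> smooth_fun A" "compact K" "K \<subseteq> \<Omega>" "\<And>y. y \<notin> K \<Longrightarrow> u y = 0"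
  show ?thesis
  proof (rule Cc_inftyI[of _ "(\<lambda>y. x + y) ` K"])
    show "ltrans x u y = 0" if "y \<notin> (\<lambda>y. x + y) ` K" for y
    proof -
      have "-x + y \<notin> K"
      proof
        assume "-x + y \<in> K"
        then have "x + (-x + y) \<in> (\<lambda>y. x + y) ` K" by blast
        then show False using that by (simp add: add.assoc[symmetric])
      qed
      then show ?thesis using K(4) by (simp add: ltrans_def)
    qed
  qed (use K in \<open>auto intro!: smooth_fun_ltrans compact_continuous_image continuous_translation\<close>)
qed

end

section \<open>Left-invariant fields as local derivations\<close>

locale lie_field = lie_grp A
  for A :: "('g::{topological_group_add, t2_space, second_countable_topology},
               'e::euclidean_space) atlas" +
  fixes Y :: "('g \<Rightarrow> real) \<Rightarrow> 'g \<Rightarrow> real"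
  assumes left_inv: "left_invariant_field A Y"
begin

lemma field_smooth: "u \<in> smooth_fun A \<Longrightarrow> Y u \<in> smooth_fun A"
  and field_add: "u \<in> smooth_fun A \<Longrightarrow> v \<in> smooth_fun A \<Longrightarrow> Y (\<lambda>y. u y + v y) = (\<lambda>y. Y u y + Y v y)"
  and field_cmult: "u \<in> smooth_fun A \<Longrightarrow> Y (\<lambda>y. c * u y) = (\<lambda>y. c * Y u y)"
  and field_mult: "u \<in> smooth_fun A \<Longrightarrow> v \<in> smooth_fun A \<Longrightarrow>
    Y (\<lambda>y. u y * v y) = (\<lambda>y. u y * Y v y + v y * Y u y)"
  and field_ltrans: "u \<in> smooth_fun A \<Longrightarrow> Y (ltrans x u) = ltrans x (Y u)"
  using left_inv unfolding left_invariant_field_def by blast+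

lemma field_diff:
  "u \<in> smooth_fun A \<Longrightarrow> v \<in> smooth_fun A \<Longrightarrow> Y (\<lambda>y. u y - v y) = (\<lambda>y. Y u y - Y v y)"
  using field_add[of u "\<lambda>y. (-1) * v y"] field_cmult[of v "-1"] smooth_fun_cmult[of v "-1"] by simp

lemma field_const: "Y (\<lambda>y. c) = (\<lambda>y. 0)"
proof -
  have "Y (\<lambda>y. 1) = (\<lambda>y. 0)"
    using field_mult[OF smooth_fun_const smooth_fun_const, of 1 1] by (simp add: fun_eq_iff)
  then show ?thesis using field_cmult[OF smooth_fun_const, of c 1] by simp
qed

lemma field_sum:
  "(\<And>i. i \<in> I \<Longrightarrow> u i \<in> smooth_fun A) \<Longrightarrow> Y (\<lambda>y. \<Sum>i\<in>I. u i y) = (\<lambda>y. \<Sum>i\<in>I. Y (u i) y)"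
  by (induction I rule: infinite_finite_induct)
    (auto simp: field_const field_add smooth_fun_sum)

text \<open>For a bump \<open>\<eta>\<close> supported where \<open>u\<close> and \<open>v\<close>
  agree, \<open>\<eta> * u\<close> and \<open>\<eta> * v\<close> are the same function. Comparing
  the two Leibniz expansions at \<open>q\<close>, where \<open>\<eta>\<close> is 1, leaves the
  claim.\<close>

lemma field_local:
  assumes "u \<in> smooth_fun A" "v \<in> smooth_fun A" "open W" "q \<in> W" "\<And>y. y \<in> W \<Longrightarrow> u y = v y"
  shows "Y u q = Y v q"
proof -
  obtain \<eta> N where \<eta>: "\<eta> \<in> Cc_infty A W" "q \<in> N" "\<And>x. x \<in> N \<Longrightarrow> \<eta> x = 1"
    using exists_bump[OF assms(3,4)] by metis
  obtain K where K: "\<eta> \<in> smooth_fun A" "K \<subseteq> W" "\<And>y. y \<notin> K \<Longrightarrow> \<eta> y = 0" using Cc_inftyE[OF \<eta>(1)] by metis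
  have "(\<lambda>y. \<eta> y * u y) = (\<lambda>y. \<eta> y * v y)"
    using K(2,3) assms(5) by (metis mult_eq_0_iff subsetD)
  then have "\<eta> q * Y u q + u q * Y \<eta> q = \<eta> q * Y v q + v q * Y \<eta> q"
    using fun_cong[OF field_mult[OF K(1) assms(1)], of q] fun_cong[OF field_mult[OF K(1) assms(2)], of q]
    by simp
  then show ?thesis using \<eta>(2,3) assms(4,5) by simp
qed

lemma field_Cc_infty:
  assumes "u \<in> Cc_infty A \<Omega>" shows "Y u \<in> Cc_infty A \<Omega>"
  using assms
proof (rule Cc_inftyE)
  fix K assume K: "u \<in> smooth_fun A" "compact K" "K \<subseteq> \<Omega>" "\<And>y. y \<notin> K \<Longrightarrow> u y = 0"
  have "Y u y = 0" if "y \<notin> K" for y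
    using field_local[OF K(1) smooth_fun_const[of 0], of "- K" y] K(4) that field_const[of 0]
      compact_imp_closed[OF K(2)] by (auto simp: open_Compl)
  then show ?thesis by (intro Cc_inftyI[of _ K] field_smooth K)
qed

end

section \<open>Integral curves of left-invariant fields\<close>

text \<open>Expanding directions in \<open>Basis\<close> bounds the operator norm of the derivative
  by the sum of the bounds for the partial derivatives, which are continuous on the compact
  ball.\<close>

lemma Ck_on_1_lipschitz:
  fixes V :: "'a::euclidean_space \<Rightarrow> 'b::real_normed_vector"
  assumes "Ck_on 1 V S" "cball z r \<subseteq> S"
  obtains L where "L \<ge> 0" "\<And>x y. x \<in> cball z r \<Longrightarrow> y \<in> cball z r \<Longrightarrow> norm (V x - V y) \<le> L * norm (x - y)"
proof -
  have V1: "Ck_on (Suc 0) V S" using assms(1) by simp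
  note V = Ck_on_SucE[OF V1]
  have "\<forall>b. \<exists>B. \<forall>x\<in>cball z r. norm (frechet_derivative V (at x) b) \<le> B"
  proof
    fix b
    have "continuous_on (cball z r) (\<lambda>x. frechet_derivative V (at x) b)"
      using V(2)[of b] assms(2) by (auto intro: continuous_on_subset)
    then have "bounded ((\<lambda>x. frechet_derivative V (at x) b) ` cball z r)"
      by (intro compact_imp_bounded compact_continuous_image compact_cball)
    then show "\<exists>B. \<forall>x\<in>cball z r. norm (frechet_derivative V (at x) b) \<le> B"
      by (auto simp: bounded_iff)
  qed
  from choice[OF this] obtain B
    where B: "\<forall>b. \<forall>x\<in>cball z r. norm (frechet_derivative V (at x) b) \<le> B b" ..
  let ?L = "\<Sum>b\<in>Basis. \<bar>B b\<bar>"
  have "norm (V x - V y) \<le> ?L * norm (x - y)" if xy: "x \<in> cball z r" "y \<in> cball z r" for x y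
  proof (rule differentiable_bound[OF convex_cball _ _ xy])
    fix w assume w: "w \<in> cball z r"
    show "(V has_derivative frechet_derivative V (at w)) (at w within cball z r)"
      using V(1)[OF subsetD[OF assms(2) w]] by (rule has_derivative_at_withinI)
    have l: "linear (frechet_derivative V (at w))"
      by (rule has_derivative_linear[OF V(1)[OF subsetD[OF assms(2) w]]])
    show "onorm (frechet_derivative V (at w)) \<le> ?L"
    proof (rule onorm_le)
      fix h
      have "frechet_derivative V (at w) h = (\<Sum>b\<in>Basis. (h \<bullet> b) *\<^sub>R frechet_derivative V (at w) b)"
        using linear_sum[OF l, of "\<lambda>b. (h \<bullet> b) *\<^sub>R b" Basis] linear_cmul[OF l]
        by (simp add: euclidean_representation)
      also have "norm \<dots> \<le> (\<Sum>b\<in>Basis. \<bar>B b\<bar> * norm h)"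
      proof (rule sum_norm_le)
        fix b :: 'a assume "b \<in> Basis"
        then show "norm ((h \<bullet> b) *\<^sub>R frechet_derivative V (at w) b) \<le> \<bar>B b\<bar> * norm h"
          using bspec[OF spec[OF B, of b] w] Basis_le_norm[of b h]
          by (simp add: mult.commute) (intro mult_mono, auto)
      qed
      finally show "norm (frechet_derivative V (at w) h) \<le> ?L * norm h"
        by (simp add: sum_distrib_right)
    qed
  qed
  then show ?thesis by (intro that[of ?L]) (auto intro: sum_nonneg)
qed

lemma Picard_Lindelof_Lipschitz:
  fixes F :: "'a::euclidean_space \<Rightarrow> 'a"
  assumes L: "L \<ge> 0" "\<And>x y. norm (F x - F y) \<le> L * norm (x - y)"
    and B: "\<And>x. norm (F x) \<le> B" and \<delta>: "\<delta> > 0" "\<delta> * L < 1"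
  obtains c where "continuous_on UNIV c" "\<And>t. t \<in> {0..\<delta>} \<Longrightarrow> c t = z + integral {0..t} (\<lambda>s. F (c s))"
proof -
  \<comment> \<open>Time is clamped to \<open>{0..\<delta>}\<close>, so that the Picard operator
    acts on the complete space of bounded continuous functions on the whole line and its values stay
    bounded.\<close>
  define cl where "cl t = max 0 (min \<delta> t)" for t :: real
  have cl: "cl t \<in> {0..\<delta>}" "t \<in> {0..\<delta>} \<Longrightarrow> cl t = t" for t using \<delta>(1) by (auto simp: cl_def)
  have contF: "continuous_on T F" for T
  proof (rule lipschitz_on_continuous_on)
    show "L-lipschitz_on T F" using L by (auto simp: lipschitz_on_def dist_norm)
  qed
  define T where "T f = (\<lambda>t. z + integral {0..cl t} (\<lambda>s. F (apply_bcontfun f s)))" for f :: "real \<Rightarrow>\<^sub>C 'a"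
  have int: "(\<lambda>s. F (apply_bcontfun f s)) integrable_on {a..b}"
    for f :: "real \<Rightarrow>\<^sub>C 'a" and a b
    by (intro integrable_continuous_interval continuous_on_compose2[OF contF]) auto
  have T: "T f \<in> bcontfun" for f
  proof (rule bcontfun_normI)
    have "continuous_on {0..\<delta>} (\<lambda>t. integral {0..t} (\<lambda>s. F (apply_bcontfun f s)))"
      by (rule indefinite_integral_continuous_1[OF int])
    then have "continuous_on UNIV (\<lambda>t. integral {0..cl t} (\<lambda>s. F (apply_bcontfun f s)))"
      by (rule continuous_on_compose2) (use \<delta>(1) in \<open>auto simp: cl_def intro!: continuous_intros\<close>)
    then show "continuous_on UNIV (T f)" unfolding T_def by (intro continuous_intros)
    show "norm (T f t) \<le> norm z + B * \<delta>" for t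
    proof -
      have "norm (integral {0..cl t} (\<lambda>s. F (apply_bcontfun f s))) \<le> B * (cl t - 0)"
        by (rule integral_bound) (use cl(1)[of t] B in \<open>auto intro: continuous_on_compose2[OF contF]\<close>)
      also have "\<dots> \<le> B * \<delta>" using cl(1)[of t] order_trans[OF norm_ge_zero B[of 0]]
        by (intro mult_left_mono) auto
      finally show ?thesis unfolding T_def by (intro order_trans[OF norm_triangle_ineq]) simp
    qed
  qed
  have "\<exists>!f. Bcontfun (T f) = f"
  proof (rule banach_fix_type)
    show "0 \<le> \<delta> * L" using \<delta> L by simp
    show "\<delta> * L < 1" by fact
    show "\<forall>f g. dist (Bcontfun (T f)) (Bcontfun (T g)) \<le> \<delta> * L * dist f g"
    proof (intro allI dist_bound)
      fix f g :: "real \<Rightarrow>\<^sub>C 'a" and t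
      have "T f t - T g t = integral {0..cl t} (\<lambda>s. F (apply_bcontfun f s) - F (apply_bcontfun g s))"
        unfolding T_def by (subst integral_diff[OF int int]) simp
      also have "norm \<dots> \<le> L * dist f g * (cl t - 0)"
      proof (rule integral_bound)
        show "continuous_on {0..cl t} (\<lambda>s. F (apply_bcontfun f s) - F (apply_bcontfun g s))"
          by (auto intro!: continuous_intros continuous_on_compose2[OF contF])
        fix s
        have "norm (F (apply_bcontfun f s) - F (apply_bcontfun g s)) \<le> L * dist (apply_bcontfun f s) (apply_bcontfun g s)"
          using L(2) by (simp add: dist_norm)
        also have "\<dots> \<le> L * dist f g" by (intro mult_left_mono dist_bounded L(1))
        finally show "norm (F (apply_bcontfun f s) - F (apply_bcontfun g s)) \<le> L * dist f g" .
      qed (use cl(1)[of t] in simp)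
      also have "\<dots> \<le> L * dist f g * \<delta>" using cl(1)[of t] L(1) by (intro mult_left_mono) auto
      finally show "dist (apply_bcontfun (Bcontfun (T f)) t) (apply_bcontfun (Bcontfun (T g)) t) \<le> \<delta> * L * dist f g"
        by (simp add: Bcontfun_inverse[OF T] dist_norm mult_ac)
    qed
  qed
  then obtain f where "Bcontfun (T f) = f" by blast
  then have f: "T f = apply_bcontfun f" by (metis Bcontfun_inverse[OF T])
  show ?thesis
  proof (rule that[of "apply_bcontfun f"])
    show "apply_bcontfun f t = z + integral {0..t} (\<lambda>s. F (apply_bcontfun f s))" if "t \<in> {0..\<delta>}" for t
      using fun_cong[OF f, of t] cl(2)[OF that] by (simp add: T_def)
  qed simp
qed

lemma integral_curve_exists:
  fixes V :: "'a::euclidean_space \<Rightarrow> 'a"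
  assumes "r > 0" "Ck_on 1 V S" "cball z r \<subseteq> S"
  obtains \<delta> c where "\<delta> > 0" "c 0 = z" "\<And>t. t \<in> {0..\<delta>} \<Longrightarrow> c t \<in> ball z r"
    "\<And>t. t \<in> {0..\<delta>} \<Longrightarrow> (c has_vector_derivative V (c t)) (at t within {0..\<delta>})"
proof -
  obtain L where L: "L \<ge> 0" "\<And>x y. x \<in> cball z r \<Longrightarrow> y \<in> cball z r \<Longrightarrow> norm (V x - V y) \<le> L * norm (x - y)"
    using Ck_on_1_lipschitz[OF assms(2,3)] by blast
  have "bounded (V ` cball z r)"
    using Ck_on_imp_continuous_on[OF assms(2)] assms(3)
    by (intro compact_imp_bounded compact_continuous_image compact_cball) (rule continuous_on_subset)
  then obtain B where "\<forall>v\<in>V ` cball z r. norm v \<le> B" unfolding bounded_iff by blast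
  then have B: "norm (V x) \<le> B" if "x \<in> cball z r" for x using that by blast
  have B0: "B \<ge> 0" using order_trans[OF norm_ge_zero B[of z]] assms(1) by simp
  \<comment> \<open>Precomposing with the projection onto the ball makes the field globally Lipschitz.\<close>
  define \<pi> where "\<pi> = closest_point (cball z r)"
  have \<pi>: "\<pi> x \<in> cball z r" for x
    unfolding \<pi>_def using assms(1) by (intro closest_point_in_set) auto
  have \<pi>_lip: "norm (\<pi> x - \<pi> y) \<le> norm (x - y)" for x y
    using closest_point_lipschitz[of "cball z r" x y] assms(1) by (auto simp: \<pi>_def dist_norm)
  \<comment> \<open>The first bound makes the Picard operator a contraction, the second keeps the
    curve inside the ball. The summands \<open>+ 1\<close> keep the denominators positive.\<close>
  define \<delta> where "\<delta> = min (1 / (2 * (L + 1))) (r / (2 * (B + 1)))"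
  have \<delta>: "\<delta> > 0" using L(1) B0 assms(1) by (auto simp: \<delta>_def)
  have "\<delta> * L \<le> 1 / (2 * (L + 1)) * L" using L(1) by (intro mult_right_mono) (auto simp: \<delta>_def)
  also have "\<dots> < 1" using L(1) by (simp add: field_simps)
  finally have \<delta>L: "\<delta> * L < 1" .
  have "\<delta> * B \<le> r / (2 * (B + 1)) * B" using B0 by (intro mult_right_mono) (auto simp: \<delta>_def)
  also have "\<dots> < r" using B0 assms(1) by (simp add: field_simps) (rule add_nonneg_pos; simp)
  finally have \<delta>B: "\<delta> * B < r" .
  have lip: "norm (V (\<pi> x) - V (\<pi> y)) \<le> L * norm (x - y)" for x y
    using L(2)[OF \<pi> \<pi>, of x y] mult_left_mono[OF \<pi>_lip L(1), of x y] by linarith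
  obtain c where c: "continuous_on UNIV c"
    "\<And>t. t \<in> {0..\<delta>} \<Longrightarrow> c t = z + integral {0..t} (\<lambda>s. V (\<pi> (c s)))"
    using Picard_Lindelof_Lipschitz[of L "\<lambda>x. V (\<pi> x)" B \<delta> z, OF L(1) lip B[OF \<pi>] \<delta> \<delta>L] by blast
  have "L-lipschitz_on UNIV (\<lambda>x. V (\<pi> x))" using lip L(1) by (auto simp: lipschitz_on_def dist_norm)
  then have Vc: "continuous_on T (\<lambda>s. V (\<pi> (c s)))" for T
    by (rule continuous_on_compose2[OF lipschitz_on_continuous_on])
      (auto intro: continuous_on_subset[OF c(1)])
  have ball: "c t \<in> ball z r" if t: "t \<in> {0..\<delta>}" for t
  proof -
    have "norm (integral {0..t} (\<lambda>s. V (\<pi> (c s)))) \<le> B * (t - 0)"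
      by (rule integral_bound) (use t B[OF \<pi>] Vc in auto)
    also have "\<dots> \<le> \<delta> * B" using t B0 using mult_right_mono[of t \<delta> B] by (simp add: mult.commute)
    finally show ?thesis using c(2)[OF t] \<delta>B by (simp add: dist_norm)
  qed
  show ?thesis
  proof (rule that[OF \<delta> _ ball])
    show "c 0 = z" using c(2)[of 0] \<delta> by simp
    fix t assume t: "t \<in> {0..\<delta>}"
    have "((\<lambda>t. integral {0..t} (\<lambda>s. V (\<pi> (c s)))) has_vector_derivative V (\<pi> (c t))) (at t within {0..\<delta>})"
      by (rule integral_has_vector_derivative[OF Vc t])
    then have "((\<lambda>t. z + integral {0..t} (\<lambda>s. V (\<pi> (c s)))) has_vector_derivative V (\<pi> (c t))) (at t within {0..\<delta>})"
      by (auto intro!: derivative_eq_intros)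
    then have "(c has_vector_derivative V (\<pi> (c t))) (at t within {0..\<delta>})"
      by (rule has_vector_derivative_transform[OF t, rotated]) (simp add: c(2))
    moreover have "\<pi> (c t) = c t"
      unfolding \<pi>_def using ball[OF t] by (intro closest_point_self) auto
    ultimately show "(c has_vector_derivative V (c t)) (at t within {0..\<delta>})" by simp
  qed
qed

lemma smooth_on_zero_extension:
  assumes "open T" "closed K" "K \<subseteq> T" "smooth_on f T" "\<And>z. z \<notin> K \<Longrightarrow> f z = 0"
    "open S"
  shows "smooth_on f S"
proof (rule smooth_on_local[OF assms(6)])
  fix x assume "x \<in> S"
  show "\<exists>T. open T \<and> x \<in> T \<and> smooth_on f (S \<inter> T)"
  proof (cases "x \<in> T")
    case True
    then show ?thesis using assms(1,4) smooth_on_subset[OF assms(4), of "S \<inter> T"] by blast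
  next
    case False
    have o: "open (S \<inter> - K)" using assms(2,6) by auto
    have "smooth_on f (S \<inter> - K)"
      by (rule smooth_on_cong[OF o _ smooth_on_const[of 0]]) (use assms(5) in auto)
    then show ?thesis using False assms(2,3) by (intro exI[of _ "- K"]) auto
  qed
qed

section \<open>Left-invariant fields in charts\<close>

context lie_field
begin

text \<open>A derivation of the algebra of smooth functions is a directional derivative. The
  components of \<open>V\<close> are the values of \<open>Y\<close> on the coordinate functions;
  since \<open>Y\<close> acts on globally defined functions, the coordinates are first cut off by
  \<open>\<rho>\<close>, which is why the formula is claimed only on the ball where
  \<open>\<rho>\<close> is 1.\<close>

lemma field_in_chart:
  assumes U: "(U, \<phi>) \<in> A" and y: "y0 \<in> U"
  obtains r V where "r > 0" "cball (\<phi> y0) r \<subseteq> \<phi> ` U" "smooth_on V (\<phi> ` U)"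
    "\<And>u z. u \<in> smooth_fun A \<Longrightarrow> z \<in> ball (\<phi> y0) r \<Longrightarrow>
      Y u (inv_into U \<phi> z) = frechet_derivative (u \<circ> inv_into U \<phi>) (at z) (V z)"
proof -
  let ?i = "inv_into U \<phi>" and ?z = "\<phi> y0"
  obtain R where R: "R > 0" "cball ?z R \<subseteq> \<phi> ` U" using chart_cball[OF U y open_UNIV] by auto
  define r where "r = R / 2"
  have r: "r > 0" "cball ?z (2 * r) \<subseteq> \<phi> ` U" using R by (auto simp: r_def)
  obtain \<rho> :: "'e \<Rightarrow> real" where \<rho>: "smooth_on \<rho> UNIV"
    "\<And>x. x \<in> cball ?z r \<Longrightarrow> \<rho> x = 1" "\<And>x. x \<notin> cball ?z (2 * r) \<Longrightarrow> \<rho> x = 0"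
    using exists_bump_Euclidean[OF r(1), of ?z] by metis
  define co where "co b y = (if y \<in> U then \<rho> (\<phi> y) * (\<phi> y \<bullet> b) else 0)" for b y
  have co: "co b \<in> smooth_fun A" for b
  proof -
    have "smooth_on (\<lambda>z. \<rho> z * (z \<bullet> b)) (\<phi> ` U)"
      by (intro smooth_on_mult smooth_on_bounded_linear bounded_linear_inner_left
        chart_open_image[OF U] smooth_on_subset[OF \<rho>(1)] subset_UNIV)
    then show ?thesis
      unfolding co_def
      by (rule Cc_infty_smooth[OF chart_supported_Cc_infty[OF U compact_cball r(2)]]) (simp add: \<rho>(3))
  qed
  define V where "V z = (\<Sum>b\<in>Basis. Y (co b) (?i z) *\<^sub>R b)" for z
  have smV: "smooth_on V (\<phi> ` U)"
    unfolding smooth_on_def V_def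
  proof
    fix k
    have "Ck_on k (\<lambda>z. Y (co b) (?i z)) (\<phi> ` U)" for b
      using smooth_funD[OF field_smooth[OF co] U] by (simp add: smooth_on_def o_def)
    then show "Ck_on k (\<lambda>z. \<Sum>b\<in>Basis. Y (co b) (?i z) *\<^sub>R b) (\<phi> ` U)"
      by (intro Ck_on_sum Ck_on_scaleR Ck_on_const chart_open_image[OF U])
  qed
  have main: "Y u (?i q) = frechet_derivative (u \<circ> ?i) (at q) (V q)"
    if u: "u \<in> smooth_fun A" and q: "q \<in> ball ?z r" for u q
  proof -
    let ?S = "ball ?z r" and ?f = "u \<circ> ?i"
    have SU: "?S \<subseteq> \<phi> ` U" using r(1) by (intro order_trans[OF _ r(2)]) (auto simp: subset_eq)
    have f: "smooth_on ?f ?S" using smooth_on_subset[OF smooth_funD[OF u U] SU] .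
    have "\<exists>g. (\<forall>b. smooth_on (g b) ?S) \<and>
      (\<forall>x\<in>?S. ?f x = ?f q + (\<Sum>b\<in>Basis. ((x - q) \<bullet> b) * g b x)) \<and>
      (\<forall>b. g b q = frechet_derivative ?f (at q) b)"
      by (rule Hadamard_lemma[OF open_ball convex_ball q f]) (intro exI conjI allI ballI; assumption)
    then obtain g where "(\<forall>b. smooth_on (g b) ?S) \<and>
      (\<forall>x\<in>?S. ?f x = ?f q + (\<Sum>b\<in>Basis. ((x - q) \<bullet> b) * g b x)) \<and>
      (\<forall>b. g b q = frechet_derivative ?f (at q) b)" ..
    then have g: "\<And>b. smooth_on (g b) ?S"
      "\<And>x. x \<in> ?S \<Longrightarrow> ?f x = ?f q + (\<Sum>b\<in>Basis. ((x - q) \<bullet> b) * g b x)"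
      "\<And>b. g b q = frechet_derivative ?f (at q) b" by simp_all
    obtain s' where s': "s' > 0" "cball q s' \<subseteq> ?S" using bspec[OF iffD1[OF open_contains_cball open_ball] q] by blast
    define s where "s = s' / 2"
    have s: "s > 0" "cball q (2 * s) \<subseteq> ?S" using s' by (auto simp: s_def)
    have cU: "cball q (2 * s) \<subseteq> \<phi> ` U" using s(2) SU by blast
    obtain \<sigma> :: "'e \<Rightarrow> real" where \<sigma>: "smooth_on \<sigma> UNIV"
      "\<And>x. x \<in> cball q s \<Longrightarrow> \<sigma> x = 1" "\<And>x. x \<notin> cball q (2 * s) \<Longrightarrow> \<sigma> x = 0"
      using exists_bump_Euclidean[OF s(1), of q] by metis
    define G where "G b y = (if y \<in> U then \<sigma> (\<phi> y) * g b (\<phi> y) else 0)" for b y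
    have sg: "smooth_on (\<lambda>z. \<sigma> z * g b z) (\<phi> ` U)" for b
    proof (rule smooth_on_zero_extension[OF open_ball closed_cball s(2)])
      show "smooth_on (\<lambda>z. \<sigma> z * g b z) ?S"
        by (rule smooth_on_mult[OF open_ball smooth_on_subset[OF \<sigma>(1) subset_UNIV] g(1)])
    qed (simp_all add: \<sigma>(3) chart_open_image[OF U])
    have G: "G b \<in> smooth_fun A" for b
      unfolding G_def
      by (rule Cc_infty_smooth[OF chart_supported_Cc_infty[OF U compact_cball cU sg]]) (simp add: \<sigma>(3))
    have W: "open (U \<inter> \<phi> -` ball q s)"
      using continuous_open_preimage[OF chart_cont[OF U] chart_open[OF U] open_ball] .
    have qU: "?i q \<in> U" "\<phi> (?i q) = q" using q SU chart_inv_into[OF U] chart_f_inv[OF U] by auto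
    have iq: "?i q \<in> U \<inter> \<phi> -` ball q s" using qU s(1) by simp
    \<comment> \<open>Hadamard's expansion of \<open>u\<close> around \<open>q\<close>, written with
      the cut-off globally smooth functions \<open>co\<close> and \<open>G\<close>. It agrees with
      \<open>u\<close> only near the point, which locality permits. The factor
      \<open>co b y - q \<bullet> b\<close> vanishes at the point, so one Leibniz term survives for
      each \<open>b\<close>.\<close>
    let ?v = "\<lambda>y. u (?i q) + (\<Sum>b\<in>Basis. (co b y - q \<bullet> b) * G b y)"
    have vs: "(\<lambda>y. co b y - q \<bullet> b) \<in> smooth_fun A" for b
      by (intro smooth_fun_diff co smooth_fun_const)
    have "Y u (?i q) = Y ?v (?i q)"
    proof (rule field_local[OF u _ W iq])
      show "?v \<in> smooth_fun A"
        by (intro smooth_fun_add smooth_fun_const smooth_fun_sum smooth_fun_mult vs G)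
      fix y assume y: "y \<in> U \<inter> \<phi> -` ball q s"
      have 1: "\<phi> y \<in> cball q s" using y by auto
      then have 2: "\<phi> y \<in> ?S" using s(1) by (intro subsetD[OF s(2)]) auto
      then have 3: "\<phi> y \<in> cball ?z r" by auto
      have "u y = ?f (\<phi> y)" using y chart_inv[OF U] by simp
      also have "\<dots> = u (?i q) + (\<Sum>b\<in>Basis. ((\<phi> y - q) \<bullet> b) * g b (\<phi> y))"
        using g(2)[OF 2] by simp
      also have "\<dots> = ?v y"
        using y 1 3 by (simp add: co_def G_def \<sigma>(2) \<rho>(2) inner_diff_left)
      finally show "u y = ?v y" .
    qed
    also have "\<dots> = (\<Sum>b\<in>Basis. Y (\<lambda>y. (co b y - q \<bullet> b) * G b y) (?i q))"
      by (simp add: field_add field_sum field_const smooth_fun_const smooth_fun_sum smooth_fun_mult vs G)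
    also have "\<dots> = (\<Sum>b\<in>Basis. Y (co b) (?i q) * frechet_derivative ?f (at q) b)"
    proof (rule sum.cong[OF refl])
      fix b :: 'e
      have "co b (?i q) = q \<bullet> b" using qU q \<rho>(2)[of q] by (simp add: co_def)
      moreover have "G b (?i q) = g b q" using qU \<sigma>(2)[of q] s(1) by (simp add: G_def)
      ultimately show "Y (\<lambda>y. (co b y - q \<bullet> b) * G b y) (?i q) = Y (co b) (?i q) * frechet_derivative ?f (at q) b"
        by (simp add: field_mult[OF vs G] field_diff[OF co smooth_fun_const] field_const g(3))
    qed
    also have "\<dots> = frechet_derivative ?f (at q) (V q)"
    proof -
      have "Ck_on (Suc 0) ?f ?S" using f unfolding smooth_on_def by blast
      from Ck_on_SucE(1)[OF this q] have l: "linear (frechet_derivative ?f (at q))"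
        by (rule has_derivative_linear)
      show ?thesis unfolding V_def by (simp add: linear_sum[OF l] linear_cmul[OF l])
    qed
    finally show ?thesis .
  qed
  show ?thesis
  proof (rule that[OF r(1) _ smV main])
    show "cball ?z r \<subseteq> \<phi> ` U" using r(1) by (intro order_trans[OF _ r(2)]) (auto simp: subset_eq)
  qed
qed

lemma integral_curve:
  obtains \<delta> \<gamma> where "\<delta> > 0" "\<gamma> 0 = 0" "continuous_on {0..\<delta>} \<gamma>"
    "\<And>u y t. u \<in> smooth_fun A \<Longrightarrow> t \<in> {0..\<delta>} \<Longrightarrow>
      ((\<lambda>t. u (y + \<gamma> t)) has_vector_derivative Y u (y + \<gamma> t)) (at t within {0..\<delta>})"
proof -
  obtain U \<phi> where U: "(U, \<phi>) \<in> A" "0 \<in> U" by (rule ex_chart)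
  let ?i = "inv_into U \<phi>"
  obtain r V where r: "r > 0" "cball (\<phi> 0) r \<subseteq> \<phi> ` U" "smooth_on V (\<phi> ` U)"
    and V: "\<And>u z. u \<in> smooth_fun A \<Longrightarrow> z \<in> ball (\<phi> 0) r \<Longrightarrow>
      Y u (?i z) = frechet_derivative (u \<circ> ?i) (at z) (V z)"
    using field_in_chart[OF U] by blast
  have "Ck_on 1 V (\<phi> ` U)" using r(3) unfolding smooth_on_def by blast
  then obtain \<delta> c where c: "\<delta> > 0" "c 0 = \<phi> 0" "\<And>t. t \<in> {0..\<delta>} \<Longrightarrow> c t \<in> ball (\<phi> 0) r"
    "\<And>t. t \<in> {0..\<delta>} \<Longrightarrow> (c has_vector_derivative V (c t)) (at t within {0..\<delta>})"
    using integral_curve_exists[OF r(1) _ r(2)] by blast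
  define \<gamma> where "\<gamma> t = ?i (c t)" for t
  have cU: "c t \<in> \<phi> ` U" if "t \<in> {0..\<delta>}" for t using c(3)[OF that] r(2) by auto
  have cc: "continuous_on {0..\<delta>} c"
    using c(4) by (meson continuous_on_eq_continuous_within has_vector_derivative_continuous)
  have der: "((\<lambda>t. u (\<gamma> t)) has_vector_derivative Y u (\<gamma> t)) (at t within {0..\<delta>})"
    if u: "u \<in> smooth_fun A" and t: "t \<in> {0..\<delta>}" for u t
  proof -
    have "Ck_on (Suc 0) (u \<circ> ?i) (\<phi> ` U)" using smooth_funD[OF u U(1)] unfolding smooth_on_def by blast
    from Ck_on_SucE(1)[OF this cU[OF t]]
    have d: "((u \<circ> ?i) has_derivative frechet_derivative (u \<circ> ?i) (at (c t))) (at (c t))" .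
    have "(((u \<circ> ?i) \<circ> c) has_derivative
        frechet_derivative (u \<circ> ?i) (at (c t)) \<circ> (\<lambda>s. s *\<^sub>R V (c t))) (at t within {0..\<delta>})"
      using c(4)[OF t] unfolding has_vector_derivative_def
      by (rule diff_chain_within) (rule has_derivative_at_withinI[OF d])
    moreover have "frechet_derivative (u \<circ> ?i) (at (c t)) \<circ> (\<lambda>s. s *\<^sub>R V (c t)) = (\<lambda>s. s *\<^sub>R Y u (\<gamma> t))"
      using V[OF u c(3)[OF t]] linear_cmul[OF has_derivative_linear[OF d]]
      by (auto simp: fun_eq_iff \<gamma>_def)
    ultimately show ?thesis unfolding has_vector_derivative_def by (simp add: o_def \<gamma>_def)
  qed
  show ?thesis
  proof (rule that[OF c(1)])
    show "\<gamma> 0 = 0" by (simp add: \<gamma>_def c(2) chart_inv[OF U(1) U(2)])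
    show "continuous_on {0..\<delta>} \<gamma>" unfolding \<gamma>_def
      by (rule continuous_on_compose2[OF chart_inv_cont[OF U(1)] cc]) (use cU in auto)
    fix u y t assume u: "u \<in> smooth_fun A" and t: "t \<in> {0..\<delta>}"
    show "((\<lambda>t. u (y + \<gamma> t)) has_vector_derivative Y u (y + \<gamma> t)) (at t within {0..\<delta>})"
      using der[OF smooth_fun_ltrans[OF u, of "-y"] t] unfolding field_ltrans[OF u] by (simp add: ltrans_def)
  qed
qed

end

section \<open>Haar measure\<close>

lemma measurable_group_ops [measurable]:
  fixes f g :: "'a \<Rightarrow> 'g::{topological_group_add, second_countable_topology}"
  assumes "f \<in> borel_measurable M" "g \<in> borel_measurable M"
  shows borel_measurable_group_add: "(\<lambda>x. f x + g x) \<in> borel_measurable M"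
    and borel_measurable_group_uminus: "(\<lambda>x. - f x) \<in> borel_measurable M"
proof -
  have "(\<lambda>p::'g \<times> 'g. fst p + snd p) \<in> borel_measurable borel"
    by (intro borel_measurable_continuous_onI continuous_intros)
  from measurable_compose[OF borel_measurable_Pair[OF assms] this]
  show "(\<lambda>x. f x + g x) \<in> borel_measurable M" by simp
  have "(\<lambda>y::'g. - y) \<in> borel_measurable borel"
    by (intro borel_measurable_continuous_onI continuous_intros)
  from measurable_compose[OF assms(1) this] show "(\<lambda>x. - f x) \<in> borel_measurable M" .
qed

context lie_grp
begin

text \<open>Second countability and local compactness give sigma-compactness. It makes a left Haar
  measure sigma-finite, hence Fubini's theorem available.\<close>

lemma countable_compact_cover:
  obtains \<K> :: "'g set set" where "countable \<K>" "\<And>K. K \<in> \<K> \<Longrightarrow> compact K" "\<Union>\<K> = UNIV"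
proof -
  have "\<forall>y::'g. \<exists>p. open (fst p) \<and> y \<in> fst p \<and> fst p \<subseteq> snd p \<and> compact (snd p)"
  proof
    fix y :: 'g
    obtain N K where "open N" "y \<in> N" "N \<subseteq> K" "compact K" using exists_compact_nbhd[of UNIV y] by auto
    then show "\<exists>p. open (fst p) \<and> y \<in> fst p \<and> fst p \<subseteq> snd p \<and> compact (snd p)"
      by (intro exI[of _ "(N, K)"]) simp
  qed
  from choice[OF this] obtain p where p: "\<forall>y::'g. open (fst (p y)) \<and> y \<in> fst (p y) \<and>
    fst (p y) \<subseteq> snd (p y) \<and> compact (snd (p y))" ..
  obtain F where F: "F \<subseteq> range (\<lambda>y. fst (p y))" "countable F" "\<Union>F = \<Union>(range (\<lambda>y. fst (p y)))"
    using Lindelof[of "range (\<lambda>y. fst (p y))"] p by auto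
  obtain Y where Y: "countable Y" "F = (\<lambda>y. fst (p y)) ` Y"
    using countable_subset_image[of F "\<lambda>y. fst (p y)" UNIV] F(1,2) by auto
  have "(\<Union>y\<in>Y. fst (p y)) = UNIV" using F(3) p Y(2) by auto
  then have "(\<Union>y\<in>Y. snd (p y)) = UNIV" using p by blast
  then show ?thesis
    using p Y(1) by (intro that[of "(\<lambda>y. snd (p y)) ` Y"]) auto
qed

lemma compact_translates:
  fixes K :: "'g set"
  assumes "compact K" shows "compact {y. y + x \<in> K}" "compact {y. x + y \<in> K}"
proof -
  have "{y. y + x \<in> K} = (\<lambda>y. y + - x) ` K"
    by (auto simp: image_iff add.assoc intro!: bexI[of _ "_ + x"] simp del: add_uminus_conv_diff)
  then show "compact {y. y + x \<in> K}"
    using assms by (auto intro!: compact_continuous_image continuous_intros)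
  have "{y. x + y \<in> K} = (\<lambda>y. - x + y) ` K"
    by (auto simp: image_iff add.assoc[symmetric] intro!: bexI[of _ "x + _"])
  then show "compact {y. x + y \<in> K}"
    using assms by (auto intro!: compact_continuous_image continuous_intros)
qed

end

locale left_haar = lie_grp A
  for A :: "('g::{topological_group_add, t2_space, second_countable_topology},
               'e::euclidean_space) atlas" +
  fixes lam :: "'g measure"
  assumes haar: "left_haar_measure lam"
begin

lemma sets_lam [simp, measurable_cong]: "sets lam = sets borel"
  and emeasure_lam_UNIV: "emeasure lam UNIV \<noteq> 0"
  and emeasure_compact: "compact K \<Longrightarrow> emeasure lam K < \<infinity>"
  and distr_translate: "distr lam lam (\<lambda>y. x + y) = lam"
  using haar by (auto simp: left_haar_measure_def)

lemma space_lam [simp]: "space lam = UNIV"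
  using sets_eq_imp_space_eq[OF sets_lam] by simp

sublocale sigma_finite_measure lam
proof
  obtain \<K> :: "'g set set" where "countable \<K>" "\<And>K. K \<in> \<K> \<Longrightarrow> compact K" "\<Union>\<K> = UNIV"
    using countable_compact_cover by metis
  then show "\<exists>A. countable A \<and> A \<subseteq> sets lam \<and> \<Union>A = space lam \<and> (\<forall>a\<in>A. emeasure lam a \<noteq> \<infinity>)"
    using emeasure_compact by (intro exI[of _ \<K>]) (auto simp: compact_imp_closed order_less_le)
qed

lemma nn_integral_translate:
  assumes "f \<in> borel_measurable borel"
  shows "(\<integral>\<^sup>+ y. f (x + y) \<partial>lam) = (\<integral>\<^sup>+ y. f y \<partial>lam)"
proof -
  have "(\<integral>\<^sup>+ y. f y \<partial>lam) = (\<integral>\<^sup>+ y. f y \<partial>distr lam lam (\<lambda>y. x + y))"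
    by (simp add: distr_translate)
  also have "\<dots> = (\<integral>\<^sup>+ y. f (x + y) \<partial>lam)"
    by (rule nn_integral_distr) (use assms in measurable)
  finally show ?thesis by simp
qed

lemma nn_integral_indicator_translate:
  assumes "N \<in> sets borel"
  shows "(\<integral>\<^sup>+ y. indicator N (y + x) \<partial>lam) = emeasure lam {y. y + x \<in> N}"
proof -
  have "(\<lambda>y. y + x) -` N \<inter> space lam \<in> sets lam"
    by (rule measurable_sets[of _ lam borel]) (use assms in measurable)
  then have "{y. y + x \<in> N} \<in> sets lam" by (simp add: vimage_def)
  from nn_integral_indicator[OF this] show ?thesis by (simp add: indicator_def)
qed

lemma AE_translate:
  assumes "AE y in lam. P y" shows "AE y in lam. P (x + y)"
proof -
  have "AE y in distr lam lam (\<lambda>y. x + y). P y" using assms by (subst distr_translate)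
  then show ?thesis by (rule AE_distrD[rotated]) measurable
qed

text \<open>Countably many left translates of \<open>W\<close> cover the group by the Lindelof
  property. If \<open>W\<close> were a null set, so would be all of them and hence the
  group.\<close>

lemma emeasure_open_pos:
  assumes "open W" "W \<noteq> {}" shows "emeasure lam W > 0"
proof (rule ccontr)
  assume "\<not> ?thesis"
  then have W0: "emeasure lam W = 0" by (simp add: zero_less_iff_neq_zero)
  have tr: "emeasure lam {y. x + y \<in> W} = 0" for x
  proof -
    have "emeasure lam W = emeasure (distr lam lam (\<lambda>y. x + y)) W" by (simp add: distr_translate)
    also have "\<dots> = emeasure lam {y. x + y \<in> W}"
      by (subst emeasure_distr) (use assms(1) in \<open>auto simp: vimage_def\<close>)
    finally show ?thesis using W0 by simp
  qed
  have op: "open {y. x + y \<in> W}" for x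
    using open_vimage[OF assms(1), of "\<lambda>y. x + y"] by (simp add: vimage_def continuous_translation)
  obtain w where w: "w \<in> W" using assms(2) by blast
  obtain F where F: "F \<subseteq> range (\<lambda>x. {y. x + y \<in> W})" "countable F"
    "\<Union>F = \<Union>(range (\<lambda>x. {y. x + y \<in> W}))"
    using Lindelof[of "range (\<lambda>x. {y. x + y \<in> W})"] op by auto
  have "y \<in> \<Union>(range (\<lambda>x. {y. x + y \<in> W}))" for y
    using w by (auto intro!: exI[of _ "w + - y"] simp: add.assoc simp del: add_uminus_conv_diff)
  then have "\<Union>F = UNIV" using F(3) by auto
  moreover have "\<Union>F \<in> null_sets lam"
  proof -
    have "B \<in> null_sets lam" if "B \<in> F" for B
      using that F(1) tr op by (auto intro!: null_setsI)
    then show ?thesis using null_sets_UN'[OF F(2), of "\<lambda>x. x"] by simp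
  qed
  ultimately show False using emeasure_lam_UNIV by auto
qed

end

text \<open>The substitution \<open>(x, y) \<mapsto> (y + x, - x)\<close> preserves the product of
  two left Haar measures, being made of left translations in one variable at a time with Fubini's
  theorem in between. This is how inversion, under which a left Haar measure is not invariant,
  becomes accessible.\<close>

lemma (in lie_grp) haar_swap:
  fixes \<mu> \<nu> :: "'g measure"
  assumes "left_haar_measure \<mu>" "left_haar_measure \<nu>"
    and [measurable]: "(\<lambda>(x, y). F x y) \<in> borel_measurable (borel \<Otimes>\<^sub>M borel)"
  shows "(\<integral>\<^sup>+ x. \<integral>\<^sup>+ y. F x y \<partial>\<nu> \<partial>\<mu>) = (\<integral>\<^sup>+ x. \<integral>\<^sup>+ y. F (y + x) (- x) \<partial>\<nu> \<partial>\<mu>)"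
proof -
  interpret m: left_haar A \<mu> by unfold_locales fact
  interpret n: left_haar A \<nu> by unfold_locales fact
  interpret pair_sigma_finite \<mu> \<nu> ..
  have "(\<integral>\<^sup>+ x. \<integral>\<^sup>+ y. F x y \<partial>\<nu> \<partial>\<mu>) = (\<integral>\<^sup>+ x. \<integral>\<^sup>+ y. F x (- x + y) \<partial>\<nu> \<partial>\<mu>)"
    by (intro nn_integral_cong n.nn_integral_translate[symmetric]) measurable
  also have "\<dots> = (\<integral>\<^sup>+ y. \<integral>\<^sup>+ x. F x (- x + y) \<partial>\<mu> \<partial>\<nu>)"
    by (rule Fubini'[symmetric]) measurable
  also have "\<dots> = (\<integral>\<^sup>+ y. \<integral>\<^sup>+ x. F (y + x) (- (y + x) + y) \<partial>\<mu> \<partial>\<nu>)"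
    by (intro nn_integral_cong m.nn_integral_translate[symmetric]) measurable
  also have "\<dots> = (\<integral>\<^sup>+ y. \<integral>\<^sup>+ x. F (y + x) (- x) \<partial>\<mu> \<partial>\<nu>)"
    by (simp add: minus_add add.assoc del: add_uminus_conv_diff)
  also have "\<dots> = (\<integral>\<^sup>+ x. \<integral>\<^sup>+ y. F (y + x) (- x) \<partial>\<nu> \<partial>\<mu>)"
    by (rule Fubini') measurable
  finally show ?thesis .
qed

section \<open>Uniqueness of Haar measure and the modular function\<close>

context left_haar
begin

text \<open>\<open>N\<close> is a relatively compact open neighbourhood of the identity. The
  measures of its right translates are the raw form of the modular function; for \<open>x\<close> in
  a compact \<open>C\<close> these translates lie in one compact difference set, whence the local
  bound.\<close>

lemma exists_reference_set:
  obtains N where "open N" "\<forall>x. 0 < emeasure lam {y. y + x \<in> N}" "\<forall>x. emeasure lam {y. y + x \<in> N} < \<infinity>"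
    "\<forall>C. compact C \<longrightarrow> (\<exists>B<\<infinity>. \<forall>x\<in>C. emeasure lam {y. y + x \<in> N} \<le> B)"
proof -
  obtain N K :: "'g set" where NK: "open N" "0 \<in> N" "N \<subseteq> K" "compact K"
    using exists_compact_nbhd[of UNIV "0::'g"] by auto
  have op: "open {y. y + x \<in> N}" for x
    using open_vimage[OF NK(1), of "\<lambda>y. y + x"] by (simp add: vimage_def continuous_translation)
  show ?thesis
  proof (rule that[OF NK(1)]; intro allI impI)
    show "0 < emeasure lam {y. y + x \<in> N}" for x
      by (rule emeasure_open_pos[OF op]) (use NK(2) in \<open>auto intro!: exI[of _ "- x"]\<close>)
    show "emeasure lam {y. y + x \<in> N} < \<infinity>" for x
      by (rule le_less_trans[OF emeasure_mono emeasure_compact[OF compact_translates(1)[OF NK(4)]]])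
        (use NK(3) compact_imp_closed[OF compact_translates(1)[OF NK(4)]] in auto)
    fix C :: "'g set" assume C: "compact C"
    let ?D = "(\<lambda>p. fst p + - snd p) ` (K \<times> C)"
    have D: "compact ?D"
      by (intro compact_continuous_image compact_Times NK(4) C continuous_intros)
    have "emeasure lam {y. y + x \<in> N} \<le> emeasure lam ?D" if "x \<in> C" for x
    proof (rule emeasure_mono)
      show "{y. y + x \<in> N} \<subseteq> ?D"
      proof
        fix y assume "y \<in> {y. y + x \<in> N}"
        then have "(y + x, x) \<in> K \<times> C" using that NK(3) by auto
        then have "fst (y + x, x) + - snd (y + x, x) \<in> ?D" by (rule imageI)
        then show "y \<in> ?D" by (simp add: add.assoc del: add_uminus_conv_diff)
      qed
      show "?D \<in> sets lam" using compact_imp_closed[OF D] by simp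
    qed
    then show "\<exists>B<\<infinity>. \<forall>x\<in>C. emeasure lam {y. y + x \<in> N} \<le> B"
      using emeasure_compact[OF D] by blast
  qed
qed

text \<open>\<open>haar_swap\<close> turns the product of \<open>emeasure M N\<close> with an
  integral over \<open>lam\<close> into one where the inner integral over \<open>lam\<close> is
  exactly \<open>h x\<close>. The denominator \<open>h\<close> is inserted to cancel it, which is
  legitimate because \<open>h\<close> is positive and finite everywhere.\<close>

lemma haar_unique:
  assumes \<mu>: "left_haar_measure \<mu>" and [measurable]: "f \<in> borel_measurable borel"
    and N: "open N" "\<And>x. 0 < emeasure lam {y. y + x \<in> N}" "\<And>x. emeasure lam {y. y + x \<in> N} < \<infinity>"
  shows "emeasure lam N * (\<integral>\<^sup>+ x. f x \<partial>\<mu>) = emeasure \<mu> N * (\<integral>\<^sup>+ x. f x \<partial>lam)"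
proof -
  have [measurable]: "N \<in> sets borel" using N(1) by simp
  define h where "h x = (\<integral>\<^sup>+ y. indicator N (y + x) \<partial>lam)" for x
  have [measurable]: "h \<in> borel_measurable borel" unfolding h_def by measurable
  have h: "h x = emeasure lam {y. y + x \<in> N}" for x
    unfolding h_def by (rule nn_integral_indicator_translate) simp
  have h0: "h x \<noteq> 0" "h x \<noteq> top" for x using N(2,3)[of x] by (auto simp: h)
  \<comment> \<open>The same value of \<open>J\<close> serves both measures, since only \<open>lam\<close> enters its definition.\<close>
  define J where "J = (\<integral>\<^sup>+ y. f (- y) / h (- y) \<partial>lam)"
  have J: "emeasure M N * J = (\<integral>\<^sup>+ x. f x \<partial>M)" if M: "left_haar_measure M" for M
  proof -
    interpret m: left_haar A M by unfold_locales fact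
    have "emeasure M N * J = (\<integral>\<^sup>+ x. \<integral>\<^sup>+ y. indicator N x * (f (- y) / h (- y)) \<partial>lam \<partial>M)"
      by (simp add: nn_integral_cmult nn_integral_multc J_def)
    also have "\<dots> = (\<integral>\<^sup>+ x. \<integral>\<^sup>+ y. indicator N (y + x) * (f (- (- x)) / h (- (- x))) \<partial>lam \<partial>M)"
      by (rule haar_swap[OF M haar, of "\<lambda>x y. indicator N x * (f (- y) / h (- y))"]) measurable
    also have "\<dots> = (\<integral>\<^sup>+ x. h x * (f x / h x) \<partial>M)"
      by (simp add: nn_integral_multc h_def)
    also have "\<dots> = (\<integral>\<^sup>+ x. f x \<partial>M)"
      using h0 by (simp add: ennreal_times_divide mult.commute[of "h _"] ennreal_mult_divide_eq)
    finally show ?thesis .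
  qed
  show ?thesis using J[OF \<mu>] J[OF haar] by (metis mult.assoc mult.commute)
qed

lemma right_translate_haar: "left_haar_measure (distr lam lam (\<lambda>y. y + g))"
proof -
  let ?M = "distr lam lam (\<lambda>y. y + g)"
  have em: "emeasure ?M B = emeasure lam {y. y + g \<in> B}" if "B \<in> sets borel" for B
    by (subst emeasure_distr) (use that in \<open>auto simp: vimage_def\<close>)
  have "emeasure ?M UNIV \<noteq> 0" using emeasure_lam_UNIV by (simp add: em)
  moreover have "emeasure ?M K < \<infinity>" if "compact K" for K
    using emeasure_compact[OF compact_translates(1)[OF that]] compact_imp_closed[OF that] by (simp add: em)
  moreover have "distr ?M ?M (\<lambda>y. x + y) = ?M" for x
  proof -
    have "distr ?M ?M (\<lambda>y. x + y) = distr lam ?M ((\<lambda>y. x + y) \<circ> (\<lambda>y. y + g))"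
      by (rule distr_distr) measurable
    also have "\<dots> = distr (distr lam lam (\<lambda>y. x + y)) lam (\<lambda>y. y + g)"
      by (subst distr_distr) (auto simp: o_def add.assoc intro!: distr_cong)
    finally show ?thesis by (simp add: distr_translate)
  qed
  ultimately show ?thesis unfolding left_haar_measure_def by simp
qed

text \<open>Right translations commute with left ones, so the image of \<open>lam\<close> under a
  right translation is again a left Haar measure and therefore a multiple of \<open>lam\<close>. The
  multiple \<open>d g\<close> is read off on the reference set \<open>N\<close>, which also yields
  boundedness on compact sets.\<close>

lemma modular_function:
  obtains d :: "'g \<Rightarrow> real" where "\<And>g. distr lam lam (\<lambda>y. y + g) = density lam (\<lambda>_. ennreal (d g))"
    "\<And>g. d g > 0" "\<And>C. compact C \<Longrightarrow> \<exists>B\<ge>0. \<forall>g\<in>C. d g \<le> B"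
proof -
  obtain N where N: "open N" "\<forall>x. 0 < emeasure lam {y. y + x \<in> N}" "\<forall>x. emeasure lam {y. y + x \<in> N} < \<infinity>"
    "\<forall>C. compact C \<longrightarrow> (\<exists>B<\<infinity>. \<forall>x\<in>C. emeasure lam {y. y + x \<in> N} \<le> B)"
    by (rule exists_reference_set)
  note N = N(1) N(2,3)[rule_format] N(4)[rule_format]
  define c where "c = measure lam N"
  define d where "d g = measure lam {y. y + g \<in> N} / c" for g
  have fin: "emeasure lam N < \<infinity>" "emeasure lam N > 0" using N(2,3)[of 0] by simp_all
  have pos_measure: "measure lam S > 0" "emeasure lam S = ennreal (measure lam S)"
    if "emeasure lam S < \<infinity>" "emeasure lam S > 0" for S
    using that unfolding measure_def by (simp_all add: enn2real_positive_iff)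
  have c: "c > 0" "emeasure lam N = ennreal c"
    using pos_measure[of N] fin by (simp_all add: c_def)
  have em: "emeasure lam {y. y + g \<in> N} = ennreal (measure lam {y. y + g \<in> N})"
    "measure lam {y. y + g \<in> N} > 0" for g
    using pos_measure N(2,3)[of g] by simp_all
  show ?thesis
  proof (rule that)
    show "d g > 0" for g using em(2) c by (simp add: d_def)
    show "distr lam lam (\<lambda>y. y + g) = density lam (\<lambda>_. ennreal (d g))" for g
    proof (rule measure_eqI)
      fix B assume "B \<in> sets (distr lam lam (\<lambda>y. y + g))"
      then have B [measurable]: "B \<in> sets borel" by simp
      have N' [measurable]: "N \<in> sets borel" using N(1) by simp
      let ?M = "distr lam lam (\<lambda>y. y + g)"
      have "ennreal c * emeasure ?M B = emeasure ?M N * emeasure lam B"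
        using haar_unique[OF right_translate_haar, of "indicator B" N g] N(1-3) by (simp add: c(2))
      also have "emeasure ?M N = emeasure lam {y. y + g \<in> N}"
        by (subst emeasure_distr) (auto simp: vimage_def)
      also have "\<dots> = ennreal c * ennreal (d g)"
        using c(1) em(2)[of g] by (simp add: em(1) d_def ennreal_mult[symmetric])
      finally have "ennreal c * emeasure ?M B = ennreal c * (ennreal (d g) * emeasure lam B)"
        by (simp add: mult.assoc)
      then have "emeasure ?M B = ennreal (d g) * emeasure lam B"
        using c(1) by (simp add: ennreal_mult_cancel_left)
      also have "\<dots> = emeasure (density lam (\<lambda>_. ennreal (d g))) B"
        by (subst emeasure_density) (auto simp: nn_integral_cmult)
      finally show "emeasure ?M B = emeasure (density lam (\<lambda>_. ennreal (d g))) B" .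
    qed simp
    fix C :: "'g set" assume "compact C"
    then obtain B where B: "B < \<infinity>" "\<And>x. x \<in> C \<Longrightarrow> emeasure lam {y. y + x \<in> N} \<le> B" using N(4) by blast
    have "measure lam {y. y + x \<in> N} \<le> enn2real B" if "x \<in> C" for x
      using enn2real_mono[OF B(2)[OF that]] B(1) by (simp add: measure_def)
    then show "\<exists>B\<ge>0. \<forall>g\<in>C. d g \<le> B"
      using c(1) by (intro exI[of _ "enn2real B / c"]) (auto simp: d_def divide_right_mono)
  qed
qed

text \<open>Inversion may change the measure but preserves null sets. \<open>haar_swap\<close>
  transforms the vanishing integral of \<open>indicator N x * indicator Z y\<close> into one whose
  inner integral of \<open>indicator N (y + x)\<close> is positive for every \<open>x\<close>; hence
  \<open>- x\<close> avoids \<open>Z\<close> almost everywhere.\<close>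

lemma AE_uminus:
  assumes "AE y in lam. P y" shows "AE y in lam. P (- y)"
proof -
  obtain Z where Z: "Z \<in> null_sets lam" "{y. \<not> P y} \<subseteq> Z"
    using assms by (auto elim: AE_E simp: null_sets_def)
  have [measurable]: "Z \<in> sets borel" using Z(1) by (auto simp: null_sets_def)
  obtain N where N: "open N" "\<forall>x. 0 < emeasure lam {y. y + x \<in> N}"
    by (rule exists_reference_set)
  note N = N(1) N(2)[rule_format]
  have [measurable]: "N \<in> sets borel" using N(1) by simp
  have h: "(\<integral>\<^sup>+ y. indicator N (y + x) \<partial>lam) = emeasure lam {y. y + x \<in> N}" for x
    by (rule nn_integral_indicator_translate) simp
  have "0 = (\<integral>\<^sup>+ x. \<integral>\<^sup>+ y. indicator N x * indicator Z y \<partial>lam \<partial>lam)"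
    using Z(1) by (simp add: nn_integral_cmult null_sets_def)
  also have "\<dots> = (\<integral>\<^sup>+ x. \<integral>\<^sup>+ y. indicator N (y + x) * indicator Z (- x) \<partial>lam \<partial>lam)"
    by (rule haar_swap[OF haar haar, of "\<lambda>x y. indicator N x * indicator Z y"]) measurable
  also have "\<dots> = (\<integral>\<^sup>+ x. (\<integral>\<^sup>+ y. indicator N (y + x) \<partial>lam) * indicator Z (- x) \<partial>lam)"
    by (simp add: nn_integral_multc)
  finally have "AE x in lam. (\<integral>\<^sup>+ y. indicator N (y + x) \<partial>lam) * indicator Z (- x) = (0::ennreal)"
    by (subst (asm) eq_commute, subst (asm) nn_integral_0_iff_AE) auto
  then show ?thesis
  proof eventually_elim
    case (elim x)
    then have "- x \<notin> Z" using N(2)[of x] unfolding h by (auto split: split_indicator)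
    then show ?case using Z(2) by blast
  qed
qed

lemma integrable_continuous_compact:
  fixes f :: "'g \<Rightarrow> real"
  assumes "continuous_on UNIV f" "compact K" "\<And>y. y \<notin> K \<Longrightarrow> f y = 0"
  shows "integrable lam f"
proof -
  have "compact (f ` K)" using assms(1,2) by (meson compact_continuous_image continuous_on_subset subset_UNIV)
  then obtain B where B: "\<forall>v\<in>f ` K. norm v \<le> B" using compact_imp_bounded bounded_iff by metis
  have [measurable]: "f \<in> borel_measurable lam"
    using borel_measurable_continuous_onI[OF assms(1)] by simp
  have [measurable]: "K \<in> sets lam" using compact_imp_closed[OF assms(2)] by simp
  show ?thesis
  proof (rule Bochner_Integration.integrable_bound)
    show "integrable lam (\<lambda>y. indicator K y * B)"
      using emeasure_compact[OF assms(2)] \<open>K \<in> sets lam\<close>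
      by (intro integrable_mult_left integrable_real_indicator)
    show "AE y in lam. norm (f y) \<le> norm (indicator K y * B)"
      using B assms(3) by (intro AE_I2) (force split: split_indicator)
  qed measurable
qed

end

section \<open>Integration by parts and weak derivatives\<close>

context left_haar
begin

lemma smooth_fun_measurable [measurable_dest]: "u \<in> smooth_fun A \<Longrightarrow> u \<in> borel_measurable lam"
  using borel_measurable_continuous_onI[OF smooth_fun_continuous] by simp

lemma Cc_infty_integrable: "u \<in> Cc_infty A \<Omega> \<Longrightarrow> integrable lam u"
  by (elim Cc_inftyE) (rule integrable_continuous_compact[OF smooth_fun_continuous])

lemma open_AE_notin:
  assumes "open W" "AE y in lam. y \<notin> W" shows "W = {}"
proof (rule ccontr)
  assume "W \<noteq> {}"
  moreover have "W \<in> null_sets lam"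
    using assms by (subst AE_iff_null_sets) auto
  ultimately show False using emeasure_open_pos[OF assms(1)] by (auto simp: null_sets_def)
qed

lemma Cc_infty_bounded:
  assumes "u \<in> Cc_infty A \<Omega>" obtains B where "B \<ge> 0" "\<forall>y. \<bar>u y\<bar> \<le> B"
  using assms
proof (rule Cc_inftyE)
  fix K assume K: "u \<in> smooth_fun A" "compact K" "\<And>y. y \<notin> K \<Longrightarrow> u y = 0"
  have "compact (u ` K)" using smooth_fun_continuous[OF K(1)] K(2) by (rule compact_continuous_image)
  then obtain B where B: "\<forall>v\<in>u ` K. norm v \<le> B" using compact_imp_bounded bounded_iff by metis
  have "\<bar>u y\<bar> \<le> max 0 B" for y using B K(3)[of y] by (cases "y \<in> K") auto
  then show ?thesis by (intro that[of "max 0 B"]) auto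
qed

end

section \<open>The adjoint of a left-invariant field\<close>

locale haar_field = left_haar A lam + lie_field A Y
  for A :: "('g::{topological_group_add, t2_space, second_countable_topology},
               'e::euclidean_space) atlas" and lam and Y
begin

text \<open>The integral of \<open>f (y + \<gamma> t)\<close> is \<open>d (\<gamma> t)\<close> times
  that of \<open>f\<close>, and both sides are differentiated at \<open>t = 0\<close>. The constant
  \<open>c\<close> is thus the derivative of the modular function along \<open>Y\<close>. That the
  quotients \<open>q n\<close> converge is not shown from \<open>d\<close> directly: it follows from
  the convergence for a single test function with nonzero integral.\<close>

lemma integral_field:
  obtains c :: real where "\<forall>f\<in>Cc_infty A UNIV. (\<integral>y. Y f y \<partial>lam) = c * (\<integral>y. f y \<partial>lam)"
proof -
  obtain \<delta> \<gamma> where \<delta>: "\<delta> > 0" and \<gamma>: "\<gamma> 0 = 0" "continuous_on {0..\<delta>} \<gamma>"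
    and der: "\<And>u y t. u \<in> smooth_fun A \<Longrightarrow> t \<in> {0..\<delta>} \<Longrightarrow>
      ((\<lambda>t. u (y + \<gamma> t)) has_vector_derivative Y u (y + \<gamma> t)) (at t within {0..\<delta>})"
    using integral_curve by metis
  obtain d :: "'g \<Rightarrow> real" where d: "\<And>g. distr lam lam (\<lambda>y. y + g) = density lam (\<lambda>_. ennreal (d g))" "\<And>g. d g > 0"
    using modular_function by metis
  have transl: "(\<integral>y. f (y + g) \<partial>lam) = d g * (\<integral>y. f y \<partial>lam)" if "f \<in> Cc_infty A UNIV" for f g
  proof -
    have [measurable]: "f \<in> borel_measurable lam" using smooth_fun_measurable Cc_infty_smooth that by blast
    have "(\<integral>y. f (y + g) \<partial>lam) = (\<integral>y. f y \<partial>distr lam lam (\<lambda>y. y + g))"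
      by (subst integral_distr) auto
    also have "\<dots> = (\<integral>y. d g *\<^sub>R f y \<partial>lam)"
      unfolding d(1) by (rule integral_density) (use d(2)[of g] in auto)
    finally show ?thesis by simp
  qed
  define s where "s n = \<delta> / real (Suc n)" for n
  have s: "s n \<in> {0..\<delta>}" "s n > 0" for n using \<delta> by (auto simp: s_def field_simps)
  have s0: "s \<longlonglongrightarrow> 0" unfolding s_def by (rule LIMSEQ_Suc[OF lim_const_over_n])
  define q where "q n = (d (\<gamma> (s n)) - 1) / s n" for n
  have main: "(\<lambda>n. q n * (\<integral>y. f y \<partial>lam)) \<longlonglongrightarrow> (\<integral>y. Y f y \<partial>lam)" if f: "f \<in> Cc_infty A UNIV" for f
  proof -
    obtain K where K: "f \<in> smooth_fun A" "compact K" "\<And>y. y \<notin> K \<Longrightarrow> f y = 0"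
      using Cc_inftyE[OF f] by metis
    obtain B where B: "B \<ge> 0" "\<forall>y. \<bar>Y f y\<bar> \<le> B" by (rule Cc_infty_bounded[OF field_Cc_infty[OF f]])
    \<comment> \<open>One compact set contains the supports of all functions
      \<open>f (y + \<gamma> t)\<close>, so a multiple of its indicator dominates every difference
      quotient.\<close>
    let ?D = "(\<lambda>p. fst p + - \<gamma> (snd p)) ` (K \<times> {0..\<delta>})"
    have D: "compact ?D"
      by (intro compact_continuous_image compact_Times K(2) compact_Icc continuous_intros
          continuous_on_compose2[OF \<gamma>(2)]) auto
    have Dout: "f (y + \<gamma> t) = 0" if "y \<notin> ?D" "t \<in> {0..\<delta>}" for y t
    proof (rule K(3), rule notI)
      assume "y + \<gamma> t \<in> K"
      then have "(y + \<gamma> t, t) \<in> K \<times> {0..\<delta>}" using that(2) by simp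
      then have "fst (y + \<gamma> t, t) + - \<gamma> (snd (y + \<gamma> t, t)) \<in> ?D" by (rule imageI)
      then show False using that(1) by (simp add: add.assoc del: add_uminus_conv_diff)
    qed
    have [measurable]: "f \<in> borel_measurable lam" "Y f \<in> borel_measurable lam"
      using K(1) field_smooth smooth_fun_measurable by blast+
    have [measurable]: "?D \<in> sets lam" using compact_imp_closed[OF D] by simp
    have "(\<lambda>n. \<integral>y. (f (y + \<gamma> (s n)) - f y) / s n \<partial>lam) \<longlonglongrightarrow> (\<integral>y. Y f y \<partial>lam)"
    proof (rule integral_dominated_convergence)
      show "integrable lam (\<lambda>y. indicator ?D y * B)"
        using emeasure_compact[OF D] \<open>?D \<in> sets lam\<close>
        by (intro integrable_mult_left integrable_real_indicator)
      show "AE y in lam. (\<lambda>n. (f (y + \<gamma> (s n)) - f y) / s n) \<longlonglongrightarrow> Y f y"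
      proof (rule AE_I2)
        fix y
        have "((\<lambda>t. f (y + \<gamma> t)) has_real_derivative Y f y) (at 0 within {0..\<delta>})"
          using der[OF K(1), of 0 y] \<delta> \<gamma>(1) by (simp add: has_real_derivative_iff_has_vector_derivative)
        then have "((\<lambda>t. (f (y + \<gamma> t) - f y) / t) \<longlongrightarrow> Y f y) (at 0 within {0..\<delta>})"
          by (simp add: has_field_derivative_iff \<gamma>(1))
        moreover have "filterlim s (at 0 within {0..\<delta>}) sequentially"
          unfolding filterlim_at using s s0 by (auto simp: less_imp_neq[symmetric])
        ultimately show "(\<lambda>n. (f (y + \<gamma> (s n)) - f y) / s n) \<longlonglongrightarrow> Y f y"
          by (rule filterlim_compose)
      qed
      show "AE y in lam. norm ((f (y + \<gamma> (s n)) - f y) / s n) \<le> indicator ?D y * B" for n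
      proof (rule AE_I2)
        fix y
        show "norm ((f (y + \<gamma> (s n)) - f y) / s n) \<le> indicator ?D y * B"
        proof (cases "y \<in> ?D")
          case True
          have "norm (f (y + \<gamma> (s n)) - f (y + \<gamma> 0)) \<le> B * norm (s n - 0)"
          proof (rule field_differentiable_bound[where S="{0..\<delta>}" and f'="\<lambda>t. Y f (y + \<gamma> t)"])
            show "((\<lambda>t. f (y + \<gamma> t)) has_real_derivative Y f (y + \<gamma> t)) (at t within {0..\<delta>})"
              if "t \<in> {0..\<delta>}" for t
              using der[OF K(1) that] by (simp add: has_real_derivative_iff_has_vector_derivative)
          qed (use B s \<delta> in auto)
          then show ?thesis using True s(2)[of n] by (simp add: \<gamma>(1) field_simps)
        next
          case False
          then show ?thesis using Dout[OF False s(1)[of n]] Dout[OF False, of 0] \<delta> \<gamma>(1) by simp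
        qed
      qed
    qed measurable
    moreover have "(\<integral>y. (f (y + \<gamma> (s n)) - f y) / s n \<partial>lam) = q n * (\<integral>y. f y \<partial>lam)" for n
    proof -
      have i: "integrable lam (\<lambda>y. f (y + \<gamma> (s n)))"
      proof (rule integrable_continuous_compact[OF _ compact_translates(1)[OF K(2), of "\<gamma> (s n)"]])
        show "continuous_on UNIV (\<lambda>y. f (y + \<gamma> (s n)))"
          by (rule continuous_on_compose2[OF smooth_fun_continuous[OF K(1), of UNIV] continuous_translation(2)]) simp
      qed (use K(3) in auto)
      have "(\<integral>y. (f (y + \<gamma> (s n)) - f y) / s n \<partial>lam) = ((\<integral>y. f (y + \<gamma> (s n)) \<partial>lam) - (\<integral>y. f y \<partial>lam)) / s n"
        by (simp add: Bochner_Integration.integral_diff[OF i Cc_infty_integrable[OF f]])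
      then show ?thesis by (simp add: transl[OF f] q_def algebra_simps)
    qed
    ultimately show ?thesis by simp
  qed
  obtain \<eta> N where \<eta>: "\<eta> \<in> Cc_infty A UNIV" "\<And>x. 0 \<le> \<eta> x" "open N" "0 \<in> N" "\<And>x. x \<in> N \<Longrightarrow> \<eta> x = 1"
    using exists_bump[of UNIV "0::'g"] by auto
  have "(\<integral>y. \<eta> y \<partial>lam) \<noteq> 0"
  proof
    assume "(\<integral>y. \<eta> y \<partial>lam) = 0"
    then have "AE y in lam. \<eta> y = 0"
      using integral_nonneg_eq_0_iff_AE[OF Cc_infty_integrable[OF \<eta>(1)]] \<eta>(2) by auto
    then have "AE y in lam. y \<notin> N" by eventually_elim (use \<eta>(5) in force)
    then show False using open_AE_notin[OF \<eta>(3)] \<eta>(4) by blast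
  qed
  define c where "c = (\<integral>y. Y \<eta> y \<partial>lam) / (\<integral>y. \<eta> y \<partial>lam)"
  have "(\<lambda>n. q n * (\<integral>y. \<eta> y \<partial>lam) / (\<integral>y. \<eta> y \<partial>lam)) \<longlonglongrightarrow> c"
    unfolding c_def by (intro tendsto_divide main \<eta>(1) tendsto_const) fact
  then have q: "q \<longlonglongrightarrow> c" using \<open>(\<integral>y. \<eta> y \<partial>lam) \<noteq> 0\<close> by simp
  show ?thesis
  proof (rule that, rule ballI)
    fix f assume f: "f \<in> Cc_infty A UNIV"
    show "(\<integral>y. Y f y \<partial>lam) = c * (\<integral>y. f y \<partial>lam)"
      by (rule LIMSEQ_unique[OF main[OF f] tendsto_mult[OF q tendsto_const]])
  qed
qed

lemma field_adjoint:
  assumes "\<phi> \<in> Cc_infty A UNIV"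
  obtains \<psi> where "\<psi> \<in> Cc_infty A UNIV" "\<forall>w\<in>Cc_infty A UNIV. (\<integral>y. Y w y * \<phi> y \<partial>lam) = (\<integral>y. w y * \<psi> y \<partial>lam)"
proof -
  obtain c where c: "\<forall>f\<in>Cc_infty A UNIV. (\<integral>y. Y f y \<partial>lam) = c * (\<integral>y. f y \<partial>lam)"
    by (rule integral_field)
  \<comment> \<open>The Leibniz rule for \<open>w * \<phi>\<close> together with
    \<open>integral_field\<close> shows that the adjoint of \<open>Y\<close> is
    \<open>c - Y\<close>; the extra \<open>c\<close> accounts for a possibly non-unimodular
    group.\<close>
  let ?\<psi> = "\<lambda>y. c * \<phi> y - Y \<phi> y"
  have \<psi>: "?\<psi> \<in> Cc_infty A UNIV"
    by (intro Cc_infty_diff Cc_infty_cmult field_Cc_infty assms)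
  show ?thesis
  proof (rule that[OF \<psi>], rule ballI)
    fix w assume w: "w \<in> Cc_infty A UNIV"
    note sm = Cc_infty_smooth[OF w] Cc_infty_smooth[OF assms]
    have wp: "(\<lambda>y. w y * \<phi> y) \<in> Cc_infty A UNIV" by (rule Cc_infty_mult[OF w sm(2)])
    have i1: "integrable lam (\<lambda>y. w y * Y \<phi> y)" "integrable lam (\<lambda>y. \<phi> y * Y w y)"
      using Cc_infty_integrable Cc_infty_mult[OF w field_smooth[OF sm(2)]]
        Cc_infty_mult[OF assms field_smooth[OF sm(1)]] by blast+
    have i2: "integrable lam (\<lambda>y. w y * \<phi> y)" by (rule Cc_infty_integrable[OF wp])
    have "(\<integral>y. w y * Y \<phi> y \<partial>lam) + (\<integral>y. \<phi> y * Y w y \<partial>lam) = c * (\<integral>y. w y * \<phi> y \<partial>lam)"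
      using bspec[OF c wp] by (simp add: field_mult[OF sm] Bochner_Integration.integral_add[OF i1])
    moreover have "(\<integral>y. w y * ?\<psi> y \<partial>lam) = c * (\<integral>y. w y * \<phi> y \<partial>lam) - (\<integral>y. w y * Y \<phi> y \<partial>lam)"
    proof -
      have "(\<integral>y. w y * ?\<psi> y \<partial>lam) = (\<integral>y. c * (w y * \<phi> y) - w y * Y \<phi> y \<partial>lam)"
        by (intro Bochner_Integration.integral_cong) (auto simp: algebra_simps)
      also have "\<dots> = c * (\<integral>y. w y * \<phi> y \<partial>lam) - (\<integral>y. w y * Y \<phi> y \<partial>lam)"
        by (subst Bochner_Integration.integral_diff[OF integrable_mult_right[OF i2] i1(1)]) simp
      finally show ?thesis .
    qed
    ultimately show "(\<integral>y. Y w y * \<phi> y \<partial>lam) = (\<integral>y. w y * ?\<psi> y \<partial>lam)"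
      by (simp add: mult.commute)
  qed
qed

end

section \<open>Test functions separate locally integrable functions\<close>

context left_haar
begin

lemma Cc_infty_compose:
  assumes "u \<in> Cc_infty A \<Omega>" "smooth_on h UNIV" "h 0 = 0"
  shows "(\<lambda>y. h (u y)) \<in> Cc_infty A \<Omega>"
  using assms(1)
proof (rule Cc_inftyE)
  fix K assume K: "u \<in> smooth_fun A" "compact K" "K \<subseteq> \<Omega>" "\<And>y. y \<notin> K \<Longrightarrow> u y = 0"
  show ?thesis
    by (rule Cc_inftyI[OF smooth_fun_compose[OF K(1) assms(2)] K(2,3)]) (simp add: K(4) assms(3))
qed

lemma continuous_AE_0:
  fixes f :: "'g \<Rightarrow> real"
  assumes "continuous_on UNIV f" "AE y in lam. f y = 0" shows "f y = 0"
proof (rule ccontr)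
  assume "f y \<noteq> 0"
  let ?W = "{x. f x \<noteq> 0}"
  have W: "open ?W"
    using open_Collect_neq[OF assms(1) continuous_on_const] .
  have "AE x in lam. x \<notin> ?W" using assms(2) by eventually_elim simp
  then have "?W = {}" by (rule open_AE_notin[OF W])
  then show False using \<open>f y \<noteq> 0\<close> by blast
qed

text \<open>Countably many bumps equal to 1 on the members of a cover of \<open>U\<close> are added
  up, and each partial sum is passed through \<open>smooth_step\<close>. The sum reaches 1 after
  finitely many terms at every point of \<open>U\<close> and stays 0 outside, while
  \<open>smooth_step\<close> caps the values at 1.\<close>

lemma open_indicator_approx:
  fixes U :: "'g set"
  assumes "open U"
  obtains \<psi> where "\<forall>n. \<psi> n \<in> Cc_infty A U" "\<forall>n x. 0 \<le> \<psi> n x \<and> \<psi> n x \<le> 1"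
    "\<forall>x. (\<lambda>n. \<psi> n x) \<longlonglongrightarrow> (indicator U x :: real)"
proof (cases "U = {}")
  case True
  then show ?thesis by (intro that[of "\<lambda>n x. 0"]) (auto intro: Cc_infty_zero)
next
  case False
  have "\<forall>y\<in>U. \<exists>p. fst p \<in> Cc_infty A U \<and> (\<forall>x. 0 \<le> fst p x) \<and> open (snd p) \<and> y \<in> snd p \<and> snd p \<subseteq> U
    \<and> (\<forall>x\<in>snd p. fst p x = 1)"
  proof
    fix y assume "y \<in> U"
    obtain \<eta> N where "\<eta> \<in> Cc_infty A U" "\<And>x. 0 \<le> \<eta> x" "open N" "y \<in> N" "N \<subseteq> U" "\<And>x. x \<in> N \<Longrightarrow> \<eta> x = 1"
      using exists_bump[OF assms \<open>y \<in> U\<close>] by metis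
    then show "\<exists>p. fst p \<in> Cc_infty A U \<and> (\<forall>x. 0 \<le> fst p x) \<and> open (snd p) \<and> y \<in> snd p \<and> snd p \<subseteq> U
      \<and> (\<forall>x\<in>snd p. fst p x = 1)"
      by (intro exI[of _ "(\<eta>, N)"]) simp
  qed
  from bchoice[OF this] obtain p where p: "\<forall>y\<in>U. fst (p y) \<in> Cc_infty A U \<and> (\<forall>x. 0 \<le> fst (p y) x) \<and>
    open (snd (p y)) \<and> y \<in> snd (p y) \<and> snd (p y) \<subseteq> U \<and> (\<forall>x\<in>snd (p y). fst (p y) x = 1)" ..
  have pD: "fst (p y) \<in> Cc_infty A U" "0 \<le> fst (p y) x" "x \<in> snd (p y) \<Longrightarrow> fst (p y) x = 1"
    if "y \<in> U" for x y using bspec[OF p that] by simp_all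
  obtain F where F: "F \<subseteq> (\<lambda>y. snd (p y)) ` U" "countable F" "\<Union>F = \<Union>((\<lambda>y. snd (p y)) ` U)"
    using Lindelof[of "(\<lambda>y. snd (p y)) ` U"] p by auto
  obtain Y where Y: "countable Y" "Y \<subseteq> U" "F = (\<lambda>y. snd (p y)) ` Y"
    using countable_subset_image[of F "\<lambda>y. snd (p y)" U] F(1,2) by auto
  have "(\<Union>y\<in>Y. snd (p y)) = (\<Union>y\<in>U. snd (p y))" using F(3) Y(3) by simp
  also have "\<dots> = U"
  proof (intro equalityI subsetI)
    show "x \<in> U" if "x \<in> (\<Union>y\<in>U. snd (p y))" for x using that p by blast
    show "x \<in> (\<Union>y\<in>U. snd (p y))" if "x \<in> U" for x using that bspec[OF p that] by blast
  qed
  finally have cov: "(\<Union>y\<in>Y. snd (p y)) = U" .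
  then have "Y \<noteq> {}" using False by auto
  let ?y = "from_nat_into Y"
  have yU: "?y n \<in> U" for n using from_nat_into[OF \<open>Y \<noteq> {}\<close>] Y(2) by blast
  define \<psi> where "\<psi> n x = smooth_step (\<Sum>i\<le>n. fst (p (?y i)) x)" for n x
  show ?thesis
  proof (rule that[of \<psi>]; intro allI)
    show "\<psi> n \<in> Cc_infty A U" for n
      unfolding \<psi>_def
      by (intro Cc_infty_compose[OF _ smooth_on_smooth_step smooth_step_eq_0[OF order_refl]]
          Cc_infty_sum pD(1) yU)
    show "0 \<le> \<psi> n x \<and> \<psi> n x \<le> 1" for n x by (simp add: \<psi>_def smooth_step_nonneg smooth_step_le_1)
    show "(\<lambda>n. \<psi> n x) \<longlonglongrightarrow> (indicator U x :: real)" for x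
    proof (cases "x \<in> U")
      case True
      then obtain y where y: "y \<in> Y" "x \<in> snd (p y)" using cov by blast
      obtain k where k: "?y k = y" using y(1) Y(1) from_nat_into_surj by metis
      have "\<psi> n x = 1" if "n \<ge> k" for n
      proof -
        have "1 = fst (p (?y k)) x" using pD(3)[OF yU, of x k] y(2) k by simp
        also have "\<dots> \<le> (\<Sum>i\<le>n. fst (p (?y i)) x)"
          by (rule member_le_sum) (use that pD(2)[OF yU] in auto)
        finally show ?thesis unfolding \<psi>_def by (rule smooth_step_eq_1)
      qed
      then show ?thesis using True
        by (intro tendsto_eventually) (auto simp: eventually_sequentially intro!: exI[of _ k])
    next
      case False
      have "fst (p (?y i)) x = 0" for i
      proof -
        have "fst (p (?y i)) \<in> Cc_infty A U" using pD(1)[OF yU] .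
        then show ?thesis by (rule Cc_inftyE) (use False in blast)
      qed
      then show ?thesis using False by (simp add: \<psi>_def smooth_step_eq_0)
    qed
  qed
qed

lemma locally_integrableD:
  assumes "locally_integrable lam f"
  shows "f \<in> borel_measurable lam" "compact K \<Longrightarrow> integrable lam (\<lambda>y. indicator K y * f y)"
  using assms by (auto simp: locally_integrable_def set_integrable_def)

text \<open>Test functions approximate the indicator of \<open>U\<close>, and
  \<open>\<bar>f\<bar>\<close> restricted to the compact set \<open>K\<close> dominates the
  products.\<close>

lemma fundamental_lemma_open:
  assumes f: "locally_integrable lam f" and z: "\<forall>\<phi>\<in>Cc_infty A UNIV. (\<integral>y. f y * \<phi> y \<partial>lam) = 0"
    and U: "open U" "U \<subseteq> K" "compact K"
  shows "(\<integral>y. indicator U y * f y \<partial>lam) = 0"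
proof -
  note [measurable] = locally_integrableD(1)[OF f]
  have [measurable]: "U \<in> sets lam" using U(1) by simp
  obtain \<psi> where \<psi>: "\<forall>n. \<psi> n \<in> Cc_infty A U" "\<forall>n x. 0 \<le> \<psi> n x \<and> \<psi> n x \<le> 1"
    "\<forall>x. (\<lambda>n. \<psi> n x) \<longlonglongrightarrow> (indicator U x :: real)" by (rule open_indicator_approx[OF U(1)])
  have [measurable]: "\<psi> n \<in> borel_measurable lam" for n
    using \<psi>(1) smooth_fun_measurable Cc_infty_smooth by blast
  have "(\<lambda>n. \<integral>y. f y * \<psi> n y \<partial>lam) \<longlonglongrightarrow> (\<integral>y. f y * indicator U y \<partial>lam)"
  proof (rule integral_dominated_convergence)
    show "integrable lam (\<lambda>y. \<bar>indicator K y * f y\<bar>)"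
      using locally_integrableD(2)[OF f U(3)] by (rule integrable_abs)
    show "AE y in lam. (\<lambda>n. f y * \<psi> n y) \<longlonglongrightarrow> f y * indicator U y"
      using \<psi>(3) by (intro AE_I2 tendsto_mult tendsto_const) blast
    show "AE y in lam. norm (f y * \<psi> n y) \<le> \<bar>indicator K y * f y\<bar>" for n
    proof (rule AE_I2)
      fix y
      have "\<psi> n y = 0" if "y \<notin> K"
        using spec[OF \<psi>(1), of n] by (rule Cc_inftyE) (use that U(2) in blast)
      moreover have "\<bar>\<psi> n y\<bar> \<le> 1" using \<psi>(2) by simp
      ultimately show "norm (f y * \<psi> n y) \<le> \<bar>indicator K y * f y\<bar>"
        by (auto simp: abs_mult split: split_indicator intro: mult_left_le)
    qed
  qed measurable
  moreover have "(\<integral>y. f y * \<psi> n y \<partial>lam) = 0" for n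
    using z \<psi>(1) Cc_infty_mono[of "\<psi> n" U UNIV] by simp
  ultimately have "(\<integral>y. f y * indicator U y \<partial>lam) = 0" by (simp add: LIMSEQ_const_iff)
  then show ?thesis by (simp add: mult.commute)
qed

text \<open>The positive and the negative part of \<open>f\<close> are densities of two measures
  that agree on the relatively compact open sets. These form an intersection-stable generator of the
  Borel sets, and countably many of them, of finite measure, cover the group; so the two measures
  coincide.\<close>

lemma fundamental_lemma:
  assumes f: "locally_integrable lam f" and z: "\<forall>\<phi>\<in>Cc_infty A UNIV. (\<integral>y. f y * \<phi> y \<partial>lam) = 0"
  shows "AE y in lam. f y = 0"
proof -
  note [measurable] = locally_integrableD(1)[OF f]
  let ?E = "{U::'g set. open U \<and> (\<exists>K. compact K \<and> U \<subseteq> K)}"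
  have cover: "\<exists>F\<subseteq>?E. countable F \<and> \<Union>F = W" if oW: "open W" for W :: "'g set"
  proof -
    have "\<forall>y\<in>W. \<exists>N\<in>?E. y \<in> N \<and> N \<subseteq> W"
    proof
      fix y assume "y \<in> W"
      obtain N K where "open N" "y \<in> N" "N \<subseteq> K" "compact K" "K \<subseteq> W"
        using exists_compact_nbhd[OF oW \<open>y \<in> W\<close>] by metis
      then show "\<exists>N\<in>?E. y \<in> N \<and> N \<subseteq> W" by blast
    qed
    note ex = this
    define \<G> where "\<G> = {N \<in> ?E. N \<subseteq> W}"
    have un: "\<Union>\<G> = W"
    proof (intro equalityI subsetI)
      show "y \<in> \<Union>\<G>" if "y \<in> W" for y
        using bspec[OF ex that] unfolding \<G>_def by (elim bexE) (intro UnionI, auto)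
    qed (auto simp: \<G>_def)
    have "open N" if "N \<in> \<G>" for N using that by (simp add: \<G>_def)
    then obtain F where F: "F \<subseteq> \<G>" "countable F" "\<Union>F = \<Union>\<G>" by (rule Lindelof)
    have "\<G> \<subseteq> ?E" by (auto simp: \<G>_def)
    then show ?thesis using F un by (intro exI[of _ F]) simp
  qed
  have sig: "sets borel = sigma_sets UNIV ?E"
  proof -
    have "sigma_sets UNIV {S::'g set. open S} = sigma_sets UNIV ?E"
    proof (rule sigma_sets_eqI)
      fix W :: "'g set" assume "W \<in> {S. open S}"
      then obtain F where F: "F \<subseteq> ?E" "countable F" "\<Union>F = W" using cover by auto
      interpret sigma_algebra UNIV "sigma_sets UNIV ?E" by (rule sigma_algebra_sigma_sets) auto
      have "\<Union>F \<in> sigma_sets UNIV ?E"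
        using F(1,2) by (intro countable_Union) auto
      then show "W \<in> sigma_sets UNIV ?E" using F(3) by simp
    qed auto
    then show ?thesis by (simp add: borel_def)
  qed
  let ?P = "density lam (\<lambda>y. ennreal (f y))" and ?N = "density lam (\<lambda>y. ennreal (- f y))"
  have int: "(\<integral>\<^sup>+ y. ennreal (f y) * indicator U y \<partial>lam) < \<infinity>"
    "(\<integral>\<^sup>+ y. ennreal (f y) * indicator U y \<partial>lam) = (\<integral>\<^sup>+ y. ennreal (- f y) * indicator U y \<partial>lam)"
    if U: "U \<in> ?E" for U
  proof -
    obtain K where K: "compact K" "U \<subseteq> K" and oU: "open U" using U by blast
    have [measurable]: "U \<in> sets lam" using oU by simp
    have i: "integrable lam (\<lambda>y. indicator U y * f y)"
      by (rule Bochner_Integration.integrable_bound[OF locally_integrableD(2)[OF f K(1)]])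
        (use K(2) in \<open>auto split: split_indicator\<close>)
    have e: "ennreal (f y) * indicator U y = ennreal (indicator U y * f y)"
      "ennreal (- f y) * indicator U y = ennreal (- (indicator U y * f y))" for y
      by (auto split: split_indicator)
    have 0: "(\<integral>y. indicator U y * f y \<partial>lam) = 0" by (rule fundamental_lemma_open[OF f z oU K(2,1)])
    have fin: "(\<integral>\<^sup>+ y. ennreal (indicator U y * f y) \<partial>lam) < \<infinity>" "(\<integral>\<^sup>+ y. ennreal (- (indicator U y * f y)) \<partial>lam) < \<infinity>"
      using i by (simp_all add: real_integrable_def less_top)
    show "(\<integral>\<^sup>+ y. ennreal (f y) * indicator U y \<partial>lam) < \<infinity>" using fin(1) by (simp only: e)
    have "enn2real (\<integral>\<^sup>+ y. ennreal (indicator U y * f y) \<partial>lam) = enn2real (\<integral>\<^sup>+ y. ennreal (- (indicator U y * f y)) \<partial>lam)"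
      using 0 real_lebesgue_integral_def[OF i] by simp
    then have "(\<integral>\<^sup>+ y. ennreal (indicator U y * f y) \<partial>lam) = (\<integral>\<^sup>+ y. ennreal (- (indicator U y * f y)) \<partial>lam)"
      using fin by (metis ennreal_enn2real infinity_ennreal_def)
    then show "(\<integral>\<^sup>+ y. ennreal (f y) * indicator U y \<partial>lam) = (\<integral>\<^sup>+ y. ennreal (- f y) * indicator U y \<partial>lam)"
      by (simp only: e)
  qed
  obtain F where F: "F \<subseteq> ?E" "countable F" "\<Union>F = UNIV" using cover[OF open_UNIV] by auto
  then have "F \<noteq> {}" by auto
  have "?P = ?N"
  proof (rule measure_eqI_generator_eq[where \<Omega>=UNIV and E="?E" and A="from_nat_into F"])
    show "Int_stable ?E" by (auto simp: Int_stable_def)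
    show "sets ?P = sigma_sets UNIV ?E" "sets ?N = sigma_sets UNIV ?E" by (simp_all add: sig)
    show "emeasure ?P U = emeasure ?N U" if "U \<in> ?E" for U
      using int(2)[OF that] that by (subst (1 2) emeasure_density) auto
    show "range (from_nat_into F) \<subseteq> ?E" using from_nat_into[OF \<open>F \<noteq> {}\<close>] F(1) by blast
    show "(\<Union>i. from_nat_into F i) = UNIV"
      using range_from_nat_into[OF \<open>F \<noteq> {}\<close> F(2)] F(3) by simp
    show "emeasure ?P (from_nat_into F i) \<noteq> \<infinity>" for i
    proof -
      have E: "from_nat_into F i \<in> ?E" using from_nat_into[OF \<open>F \<noteq> {}\<close>] F(1) by blast
      then have "from_nat_into F i \<in> sets lam" by auto
      then show ?thesis using int(1)[OF E] by (subst emeasure_density) auto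
    qed
  qed simp
  \<comment> \<open>Since \<open>ennreal\<close> truncates negative numbers to 0, at least one side
    is 0, and equality forces \<open>f y = 0\<close>.\<close>
  then have "AE y in lam. ennreal (f y) = ennreal (- f y)"
    by (subst (asm) density_unique_iff) auto
  then show ?thesis
  proof eventually_elim
    case (elim y)
    then show ?case by (cases "f y \<ge> 0") (auto simp: ennreal_neg)
  qed
qed

end

section \<open>Iterated derivatives, formal adjoints and weak derivatives\<close>

locale haar_fields = left_haar A lam
  for A :: "('g::{topological_group_add, t2_space, second_countable_topology},
               'e::euclidean_space) atlas" and lam +
  fixes X :: "'k \<Rightarrow> ('g \<Rightarrow> real) \<Rightarrow> 'g \<Rightarrow> real"
  assumes fields: "left_invariant_field A (X i)"
begin

lemma haar_field: "haar_field A lam (X i)"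
  using fields by unfold_locales

sublocale X: haar_field A lam "X i" for i by (rule haar_field)

lemma iter_smooth: "u \<in> smooth_fun A \<Longrightarrow> foldr X I u \<in> smooth_fun A"
  by (induction I) (auto intro: X.field_smooth)

lemma iter_Cc_infty: "u \<in> Cc_infty A \<Omega> \<Longrightarrow> foldr X I u \<in> Cc_infty A \<Omega>"
  by (induction I) (auto intro: X.field_Cc_infty)

lemma iter_diff:
  "u \<in> smooth_fun A \<Longrightarrow> v \<in> smooth_fun A \<Longrightarrow> foldr X I (\<lambda>y. u y - v y) = (\<lambda>y. foldr X I u y - foldr X I v y)"
  by (induction I) (auto simp: X.field_diff iter_smooth)

lemma iter_ltrans: "u \<in> smooth_fun A \<Longrightarrow> foldr X I (ltrans x u) = ltrans x (foldr X I u)"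
  by (induction I) (auto simp: X.field_ltrans iter_smooth)

lemma iter_adjoint:
  assumes "\<phi> \<in> Cc_infty A UNIV"
  shows "\<exists>\<psi>. \<psi> \<in> Cc_infty A UNIV \<and>
    (\<forall>w\<in>Cc_infty A UNIV. (\<integral>y. foldr X I w y * \<phi> y \<partial>lam) = (\<integral>y. w y * \<psi> y \<partial>lam))"
  using assms
proof (induction I arbitrary: \<phi>)
  case (Cons i I)
  obtain \<psi> where \<psi>: "\<psi> \<in> Cc_infty A UNIV"
    "\<forall>w\<in>Cc_infty A UNIV. (\<integral>y. X i w y * \<phi> y \<partial>lam) = (\<integral>y. w y * \<psi> y \<partial>lam)"
    by (rule X.field_adjoint[OF Cons.prems])
  from Cons.IH[OF \<psi>(1)] obtain \<psi>' where \<psi>': "\<psi>' \<in> Cc_infty A UNIV \<and>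
    (\<forall>w\<in>Cc_infty A UNIV. (\<integral>y. foldr X I w y * \<psi> y \<partial>lam) = (\<integral>y. w y * \<psi>' y \<partial>lam))" ..
  then show ?case using \<psi>(2) iter_Cc_infty by (intro exI[of _ \<psi>']) simp
qed auto

text \<open>\<open>formal_adjoint\<close> is a definite description, which has its meaning only if
  the adjoint function is unique. Testing two candidates against their difference makes the integral
  of its square vanish, and continuity does the rest.\<close>

lemma iter_adjoint_unique:
  assumes "\<phi> \<in> Cc_infty A UNIV"
  shows "\<exists>!\<psi>. \<psi> \<in> Cc_infty A UNIV \<and>
     (\<forall>w\<in>Cc_infty A UNIV. (\<integral>y. foldr X I w y * \<phi> y \<partial>lam) = (\<integral>y. w y * \<psi> y \<partial>lam))"
proof -
  let ?Q = "\<lambda>\<psi>. \<psi> \<in> Cc_infty A UNIV \<and>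
     (\<forall>w\<in>Cc_infty A UNIV. (\<integral>y. foldr X I w y * \<phi> y \<partial>lam) = (\<integral>y. w y * \<psi> y \<partial>lam))"
  show "\<exists>!\<psi>. ?Q \<psi>"
  proof (rule ex_ex1I)
    show "\<exists>\<psi>. ?Q \<psi>" by (rule iter_adjoint[OF assms])
    fix \<psi> \<psi>' assume \<psi>: "?Q \<psi>" and \<psi>': "?Q \<psi>'"
    let ?w = "\<lambda>y. \<psi> y - \<psi>' y"
    have w: "?w \<in> Cc_infty A UNIV" using \<psi> \<psi>' by (intro Cc_infty_diff) auto
    have i: "integrable lam (\<lambda>y. ?w y * \<psi> y)" "integrable lam (\<lambda>y. ?w y * \<psi>' y)" "integrable lam (\<lambda>y. ?w y * ?w y)"
      using \<psi> \<psi>' w by (auto intro!: Cc_infty_integrable[of _ UNIV] Cc_infty_mult Cc_infty_smooth)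
    have "(\<integral>y. ?w y * ?w y \<partial>lam) = (\<integral>y. ?w y * \<psi> y \<partial>lam) - (\<integral>y. ?w y * \<psi>' y \<partial>lam)"
      using Bochner_Integration.integral_diff[OF i(1,2)] by (simp add: right_diff_distrib)
    also have "\<dots> = 0" using \<psi> \<psi>' w by fastforce
    finally have "AE y in lam. ?w y * ?w y = 0"
      using integral_nonneg_eq_0_iff_AE[OF i(3)] by auto
    then have "AE y in lam. ?w y = 0" by eventually_elim simp
    then have "?w y = 0" for y
      by (rule continuous_AE_0[OF smooth_fun_continuous[OF Cc_infty_smooth[OF w]]])
    then show "\<psi> = \<psi>'" by (auto simp: fun_eq_iff)
  qed
qed

lemma formal_adjoint_props:
  assumes "\<phi> \<in> Cc_infty A UNIV"
  shows "formal_adjoint A lam (foldr X I) \<phi> \<in> Cc_infty A UNIV \<and>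
    (\<forall>w\<in>Cc_infty A UNIV. (\<integral>y. foldr X I w y * \<phi> y \<partial>lam) = (\<integral>y. w y * formal_adjoint A lam (foldr X I) \<phi> y \<partial>lam))"
  using theI'[OF iter_adjoint_unique[OF assms]] unfolding formal_adjoint_def .

lemma formal_adjoint_Nil: "\<phi> \<in> Cc_infty A UNIV \<Longrightarrow> formal_adjoint A lam (foldr X []) \<phi> = \<phi>"
  unfolding formal_adjoint_def by (rule the1_equality[OF iter_adjoint_unique]) auto

lemma continuous_locally_integrable:
  fixes f :: "'g \<Rightarrow> real"
  assumes "continuous_on UNIV f" shows "locally_integrable lam f"
proof -
  have m: "f \<in> borel_measurable lam" using borel_measurable_continuous_onI[OF assms] by simp
  have "integrable lam (\<lambda>y. indicator K y * f y)" if K: "compact K" for K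
  proof -
    have "compact (f ` K)" using assms K by (meson compact_continuous_image continuous_on_subset subset_UNIV)
    then obtain B where B: "\<forall>v\<in>f ` K. norm v \<le> B" using compact_imp_bounded bounded_iff by metis
    have [measurable]: "K \<in> sets lam" using compact_imp_closed[OF K] by simp
    show ?thesis
    proof (rule Bochner_Integration.integrable_bound)
      show "integrable lam (\<lambda>y. indicator K y * B)"
        using emeasure_compact[OF K] \<open>K \<in> sets lam\<close>
        by (intro integrable_mult_left integrable_real_indicator)
      show "AE y in lam. norm (indicator K y * f y) \<le> norm (indicator K y * B)"
        using B by (intro AE_I2) (force split: split_indicator)
    qed (use m in measurable)
  qed
  then show ?thesis using m by (simp add: locally_integrable_def set_integrable_def)
qed

lemma is_weak_deriv_Cc_infty:
  assumes "u \<in> Cc_infty A UNIV" shows "is_weak_deriv A lam X I u (foldr X I u)"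
  unfolding is_weak_deriv_def
  using formal_adjoint_props assms
  by (auto intro!: continuous_locally_integrable smooth_fun_continuous iter_smooth Cc_infty_smooth[OF assms])

lemma locally_integrable_diff:
  assumes "locally_integrable lam f" "locally_integrable lam g"
  shows "locally_integrable lam (\<lambda>y. f y - g y)"
  using assms unfolding locally_integrable_def by (auto intro: set_integral_diff)

lemma locally_integrable_times_Cc_infty:
  assumes f: "locally_integrable lam f" and \<phi>: "\<phi> \<in> Cc_infty A UNIV"
  shows "integrable lam (\<lambda>y. f y * \<phi> y)"
proof -
  obtain K where K: "\<phi> \<in> smooth_fun A" "compact K" "\<And>y. y \<notin> K \<Longrightarrow> \<phi> y = 0"
    using Cc_inftyE[OF \<phi>] by metis
  obtain B where B: "B \<ge> 0" "\<forall>y. \<bar>\<phi> y\<bar> \<le> B" by (rule Cc_infty_bounded[OF \<phi>])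
  have [measurable]: "f \<in> borel_measurable lam" "\<phi> \<in> borel_measurable lam"
    using locally_integrableD(1)[OF f] smooth_fun_measurable[OF K(1)] by auto
  show ?thesis
  proof (rule Bochner_Integration.integrable_bound)
    show "integrable lam (\<lambda>y. (indicator K y * f y) * B)"
      by (intro integrable_mult_left locally_integrableD(2)[OF f K(2)])
    show "AE y in lam. norm (f y * \<phi> y) \<le> norm ((indicator K y * f y) * B)"
    proof (rule AE_I2)
      fix y
      show "norm (f y * \<phi> y) \<le> norm ((indicator K y * f y) * B)"
        using B K(3)[of y] by (cases "y \<in> K") (auto simp: abs_mult intro!: mult_left_mono)
    qed
  qed measurable
qed

lemma is_weak_deriv_diff:
  assumes "is_weak_deriv A lam X I u f" "is_weak_deriv A lam X I v g"
  shows "is_weak_deriv A lam X I (\<lambda>y. u y - v y) (\<lambda>y. f y - g y)"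
  unfolding is_weak_deriv_def
proof (intro conjI ballI)
  note u = assms(1)[unfolded is_weak_deriv_def] and v = assms(2)[unfolded is_weak_deriv_def]
  show "locally_integrable lam (\<lambda>y. u y - v y)" "locally_integrable lam (\<lambda>y. f y - g y)"
    using u v by (auto intro: locally_integrable_diff)
  fix \<phi> assume \<phi>: "\<phi> \<in> Cc_infty A UNIV"
  note a = conjunct1[OF formal_adjoint_props[OF \<phi>, of I]]
  have "(\<integral>y. (f y - g y) * \<phi> y \<partial>lam) = (\<integral>y. f y * \<phi> y \<partial>lam) - (\<integral>y. g y * \<phi> y \<partial>lam)"
    using u v \<phi> by (subst Bochner_Integration.integral_diff[symmetric])
      (auto intro: locally_integrable_times_Cc_infty simp: left_diff_distrib)
  also have "\<dots> = (\<integral>y. u y * formal_adjoint A lam (foldr X I) \<phi> y \<partial>lam) - (\<integral>y. v y * formal_adjoint A lam (foldr X I) \<phi> y \<partial>lam)"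
    using u v \<phi> by simp
  also have "\<dots> = (\<integral>y. (u y - v y) * formal_adjoint A lam (foldr X I) \<phi> y \<partial>lam)"
    using u v a by (subst Bochner_Integration.integral_diff[symmetric])
      (auto intro: locally_integrable_times_Cc_infty simp: left_diff_distrib)
  finally show "(\<integral>y. (f y - g y) * \<phi> y \<partial>lam) = (\<integral>y. (u y - v y) * formal_adjoint A lam (foldr X I) \<phi> y \<partial>lam)" .
qed

lemma is_weak_deriv_unique:
  assumes "is_weak_deriv A lam X I u f" "is_weak_deriv A lam X I u g"
  shows "AE y in lam. f y = g y"
proof -
  note d = is_weak_deriv_diff[OF assms, unfolded is_weak_deriv_def]
  have "AE y in lam. f y - g y = 0"
    by (rule fundamental_lemma) (use d in auto)
  then show ?thesis by eventually_elim simp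
qed

lemma weak_deriv_AE:
  assumes "is_weak_deriv A lam X I u f"
  shows "AE y in lam. weak_deriv A lam X I u y = f y"
  using is_weak_deriv_unique[OF someI[of "is_weak_deriv A lam X I u", OF assms] assms]
  by (simp add: weak_deriv_def)

end

section \<open>The spaces \<open>L\<^sup>p\<close>\<close>

text \<open>The \<open>p\<close>-th power of the norm, with value infinity outside
  \<open>L\<^sup>p\<close>. Tonelli's theorem then applies to it without any integrability
  condition.\<close>

definition powint :: "'a measure \<Rightarrow> real \<Rightarrow> ('a \<Rightarrow> real) \<Rightarrow> ennreal" where
  "powint M p f = (\<integral>\<^sup>+ y. ennreal (\<bar>f y\<bar> powr p) \<partial>M)"

lemma powint_cong_AE: "AE y in M. f y = g y \<Longrightarrow> powint M p f = powint M p g"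
  unfolding powint_def by (intro nn_integral_cong_AE) auto

lemma powint_minus_commute: "powint M p (\<lambda>y. f y - g y) = powint M p (\<lambda>y. g y - f y)"
  by (simp add: powint_def abs_minus_commute)

text \<open>Each summand is at most the largest one. The resulting constant is far from sharp, but
  only its finiteness matters.\<close>

lemma sum_powr_le:
  fixes a :: "'k \<Rightarrow> real"
  assumes "finite F" "\<And>k. k \<in> F \<Longrightarrow> 0 \<le> a k" "p \<ge> 0"
  shows "(\<Sum>k\<in>F. a k) powr p \<le> real (card F) powr p * (\<Sum>k\<in>F. a k powr p)"
proof (cases "F = {}")
  case False
  let ?m = "Max (a ` F)"
  have m: "?m \<in> a ` F" using assms(1) False by (intro Max_in) auto
  then obtain k where k: "k \<in> F" "?m = a k" by blast
  have "(\<Sum>k\<in>F. a k) \<le> real (card F) * ?m"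
    by (rule sum_bounded_above) (use assms(1) in auto)
  then have "(\<Sum>k\<in>F. a k) powr p \<le> (real (card F) * ?m) powr p"
    by (intro powr_mono2 sum_nonneg assms) auto
  also have "\<dots> = real (card F) powr p * a k powr p"
    using assms(2)[OF k(1)] by (simp add: k(2) powr_mult)
  also have "a k powr p \<le> (\<Sum>k\<in>F. a k powr p)"
    by (rule member_le_sum[OF k(1)]) (use assms(1) in auto)
  finally show ?thesis by (simp add: mult_left_mono)
qed simp

text \<open>Plays the part of Minkowski's inequality: pointwise domination by a finite sum becomes,
  up to a constant, domination of \<open>p\<close>-th powers.\<close>

lemma powint_le_sum:
  assumes "finite F" "p \<ge> 0" "c \<ge> 0" "\<And>k. k \<in> F \<Longrightarrow> f k \<in> borel_measurable M"
    and le: "AE y in M. \<bar>g y\<bar> \<le> c * (\<Sum>k\<in>F. \<bar>f k y\<bar>)"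
  shows "powint M p g \<le> ennreal ((c * real (card F)) powr p) * (\<Sum>k\<in>F. powint M p (f k))"
proof -
  have "powint M p g \<le> (\<integral>\<^sup>+ y. (\<Sum>k\<in>F. ennreal ((c * real (card F)) powr p) * ennreal (\<bar>f k y\<bar> powr p)) \<partial>M)"
    unfolding powint_def
  proof (rule nn_integral_mono_AE)
    show "AE y in M. ennreal (\<bar>g y\<bar> powr p) \<le> (\<Sum>k\<in>F. ennreal ((c * real (card F)) powr p) * ennreal (\<bar>f k y\<bar> powr p))"
      using le
    proof eventually_elim
      case (elim y)
      have "\<bar>g y\<bar> powr p \<le> (c * (\<Sum>k\<in>F. \<bar>f k y\<bar>)) powr p"
        by (rule powr_mono2) (use elim assms in auto)
      also have "\<dots> = c powr p * (\<Sum>k\<in>F. \<bar>f k y\<bar>) powr p"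
        using assms(3) by (simp add: powr_mult sum_nonneg)
      also have "\<dots> \<le> c powr p * (real (card F) powr p * (\<Sum>k\<in>F. \<bar>f k y\<bar> powr p))"
        by (intro mult_left_mono sum_powr_le assms) auto
      also have "\<dots> = (\<Sum>k\<in>F. (c * real (card F)) powr p * \<bar>f k y\<bar> powr p)"
        using assms(3) by (simp add: powr_mult sum_distrib_left mult.assoc)
      finally have "ennreal (\<bar>g y\<bar> powr p) \<le> ennreal (\<Sum>k\<in>F. (c * real (card F)) powr p * \<bar>f k y\<bar> powr p)"
        by (rule ennreal_leI)
      also have "\<dots> = (\<Sum>k\<in>F. ennreal ((c * real (card F)) powr p * \<bar>f k y\<bar> powr p))"
        by (rule sum_ennreal[symmetric]) simp
      also have "\<dots> = (\<Sum>k\<in>F. ennreal ((c * real (card F)) powr p) * ennreal (\<bar>f k y\<bar> powr p))"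
        by (simp add: ennreal_mult)
      finally show ?case .
    qed
  qed
  also have "\<dots> = (\<Sum>k\<in>F. ennreal ((c * real (card F)) powr p) * powint M p (f k))"
    unfolding powint_def using assms(4)
    by (subst nn_integral_sum) (auto intro!: sum.cong nn_integral_cmult)
  finally show ?thesis by (simp add: sum_distrib_left)
qed

lemma powint_le_add:
  assumes "p \<ge> 0" and [measurable]: "f \<in> borel_measurable M" "g \<in> borel_measurable M"
    and le: "AE y in M. \<bar>h y\<bar> \<le> \<bar>f y\<bar> + \<bar>g y\<bar>"
  shows "powint M p h \<le> ennreal (2 powr p) * (powint M p f + powint M p g)"
  using powint_le_sum[of "{0, 1::nat}" p 1 "\<lambda>k. if k = 0 then f else g" M h] assms
  by simp

lemma powint_triangle:
  assumes "p \<ge> 0" "f \<in> borel_measurable M" "g \<in> borel_measurable M" "h \<in> borel_measurable M"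
  shows "powint M p (\<lambda>y. f y - h y) \<le> ennreal (2 powr p) * (powint M p (\<lambda>y. f y - g y) + powint M p (\<lambda>y. g y - h y))"
  by (rule powint_le_add) (use assms in auto)

lemma Lp_iff:
  "f \<in> Lp M p \<longleftrightarrow> f \<in> borel_measurable M \<and> powint M p f < \<infinity>"
  unfolding Lp_def powint_def by (auto simp: integrable_iff_bounded)

lemma Lp_norm_eq:
  assumes "f \<in> Lp M p"
  shows "Lp_norm M p f = ennreal (enn2real (powint M p f) powr (1 / p))"
proof -
  have "(\<integral>y. \<bar>f y\<bar> powr p \<partial>M) = enn2real (powint M p f)"
    unfolding powint_def using assms by (intro integral_eq_nn_integral) (auto simp: Lp_def)
  then show ?thesis using assms by (simp add: Lp_norm_def)
qed

lemma Lp_norm_cong_AE: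
  assumes "f \<in> borel_measurable M" "g \<in> borel_measurable M" "AE y in M. f y = g y"
  shows "Lp_norm M p f = Lp_norm M p g"
proof (cases "f \<in> Lp M p")
  case True
  then have "g \<in> Lp M p" using assms powint_cong_AE[OF assms(3)] by (simp add: Lp_iff)
  then show ?thesis using True powint_cong_AE[OF assms(3), of p] by (simp add: Lp_norm_eq)
next
  case False
  then have "g \<notin> Lp M p" using assms powint_cong_AE[OF assms(3), of p] by (simp add: Lp_iff)
  then show ?thesis using False by (simp add: Lp_norm_def)
qed

lemma Lp_norm_less_iff:
  assumes "p > 0" "e > 0" "f \<in> borel_measurable M"
  shows "Lp_norm M p f < ennreal e \<longleftrightarrow> powint M p f < ennreal (e powr p)"
proof (cases "f \<in> Lp M p")
  case True
  then obtain a where a: "powint M p f = ennreal a" "a \<ge> 0"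
    by (cases "powint M p f") (auto simp: Lp_iff)
  have "a powr (1 / p) < e \<longleftrightarrow> a < e powr p"
  proof
    assume "a powr (1 / p) < e"
    then have "(a powr (1 / p)) powr p < e powr p" using assms(1) by (intro powr_less_mono2) auto
    then show "a < e powr p" using a(2) assms(1) by (simp add: powr_powr)
  next
    assume "a < e powr p"
    then have "a powr (1 / p) < (e powr p) powr (1 / p)" using assms(1) a(2) by (intro powr_less_mono2) auto
    then show "a powr (1 / p) < e" using assms(1,2) by (simp add: powr_powr)
  qed
  then show ?thesis using True a assms(2) by (simp add: Lp_norm_eq ennreal_less_iff)
next
  case False
  then have "powint M p f = \<infinity>" using assms(3) by (simp add: Lp_iff not_less top_unique)
  then show ?thesis using False by (simp add: Lp_norm_def)
qed

lemma Lp_norm_powr: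
  assumes "p > 0" "f \<in> Lp M p" "Lp_norm M p f = ennreal x" "x \<ge> 0"
  shows "powint M p f = ennreal (x powr p)"
proof -
  obtain a where a: "powint M p f = ennreal a" "a \<ge> 0"
    using assms(2) by (cases "powint M p f") (auto simp: Lp_iff)
  have "a powr (1 / p) = x" using assms Lp_norm_eq[OF assms(2)] a by simp
  then show ?thesis using a assms(1) by (auto simp: powr_powr)
qed

text \<open>Converts an estimate between norms, as in maximal hypoellipticity, into one between
  \<open>p\<close>-th powers. The \<open>1 +\<close> keeps the constant positive, so that the
  right-hand side is infinite as soon as one of the \<open>h k\<close> lies outside
  \<open>L\<^sup>p\<close>, even when \<open>C = 0\<close>.\<close>

lemma Lp_norm_sum_transfer:
  assumes p: "p > 0" and C: "C \<ge> 0" and F: "finite F"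
    and fm: "f \<in> borel_measurable M" and hm: "\<And>k. k \<in> F \<Longrightarrow> h k \<in> borel_measurable M"
    and le: "Lp_norm M p f \<le> ennreal C * (\<Sum>k\<in>F. Lp_norm M p (h k))"
  shows "powint M p f \<le> ennreal ((1 + C * real (card F)) powr p) * (\<Sum>k\<in>F. powint M p (h k))"
proof (cases "\<forall>k\<in>F. h k \<in> Lp M p")
  case True
  have "\<forall>k\<in>F. \<exists>x. Lp_norm M p (h k) = ennreal x \<and> x \<ge> 0"
    using True by (auto simp: Lp_norm_eq)
  from bchoice[OF this] obtain x where x: "\<forall>k\<in>F. Lp_norm M p (h k) = ennreal (x k) \<and> x k \<ge> 0" ..
  have "(\<Sum>k\<in>F. Lp_norm M p (h k)) = ennreal (\<Sum>k\<in>F. x k)"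
    using x by (simp add: sum_ennreal)
  then have le': "Lp_norm M p f \<le> ennreal (C * (\<Sum>k\<in>F. x k))"
    using le x C by (simp add: ennreal_mult sum_nonneg)
  then have f: "f \<in> Lp M p" using neq_top_trans[of "ennreal (C * (\<Sum>k\<in>F. x k))"]
    by (auto simp: Lp_norm_def split: if_splits)
  obtain z where z: "Lp_norm M p f = ennreal z" "z \<ge> 0" using f by (auto simp: Lp_norm_eq)
  have "z \<le> C * (\<Sum>k\<in>F. x k)"
    using le' z x C by (simp add: ennreal_le_iff sum_nonneg)
  then have "z powr p \<le> (C * (\<Sum>k\<in>F. x k)) powr p" using p z(2) by (intro powr_mono2) auto
  also have "\<dots> \<le> C powr p * (real (card F) powr p * (\<Sum>k\<in>F. x k powr p))"
    using C x p sum_powr_le[OF F, of x p]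
    by (subst powr_mult) (auto intro!: sum_nonneg mult_left_mono)
  also have "\<dots> = (C * real (card F)) powr p * (\<Sum>k\<in>F. x k powr p)"
    using C by (simp add: powr_mult mult.assoc)
  also have "\<dots> \<le> (1 + C * real (card F)) powr p * (\<Sum>k\<in>F. x k powr p)"
    using C p by (intro mult_right_mono powr_mono2 sum_nonneg) auto
  finally have "ennreal (z powr p) \<le> ennreal ((1 + C * real (card F)) powr p) * ennreal (\<Sum>k\<in>F. x k powr p)"
    by (simp add: ennreal_mult[symmetric] sum_nonneg)
  moreover have "(\<Sum>k\<in>F. powint M p (h k)) = ennreal (\<Sum>k\<in>F. x k powr p)"
  proof -
    have "(\<Sum>k\<in>F. powint M p (h k)) = (\<Sum>k\<in>F. ennreal (x k powr p))"
      using True x Lp_norm_powr[OF p] by (intro sum.cong refl) blast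
    then show ?thesis by (simp add: sum_ennreal)
  qed
  ultimately show ?thesis using Lp_norm_powr[OF p f z] by simp
next
  case False
  then obtain k where k: "k \<in> F" "powint M p (h k) = \<infinity>" using hm by (auto simp: Lp_iff not_less top_unique)
  have "(\<Sum>k\<in>F. powint M p (h k)) = \<infinity>"
    using member_le_sum[OF k(1), of "\<lambda>k. powint M p (h k)"] F k(2) by (simp add: top_unique)
  moreover have "(1 + C * real (card F)) powr p > 0" using C add_pos_nonneg[of 1 "C * real (card F)"] by simp
  ultimately show ?thesis by (simp add: ennreal_mult_top)
qed

lemma powint_finite_diff:
  assumes "p \<ge> 0" "f \<in> Lp M p" "g \<in> Lp M p" shows "(\<lambda>y. f y - g y) \<in> Lp M p"
proof -
  have "powint M p (\<lambda>y. f y - g y) \<le> ennreal (2 powr p) * (powint M p f + powint M p g)"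
    by (rule powint_le_add) (use assms in \<open>auto simp: Lp_iff\<close>)
  also have "\<dots> < \<infinity>" using assms by (auto simp: Lp_iff ennreal_mult_less_top)
  finally show ?thesis using assms by (simp add: Lp_iff borel_measurable_diff)
qed

section \<open>Completeness of \<open>L\<^sup>p\<close>\<close>

lemma ennreal_le_suminf: "(F :: nat \<Rightarrow> ennreal) k \<le> (\<Sum>k. F k)"
  using sum_le_suminf[OF summableI, of "{k}" F] by simp

lemma Lp_complete:
  fixes f :: "nat \<Rightarrow> 'a \<Rightarrow> real"
  assumes p: "p > 0" and meas [measurable]: "\<And>n. f n \<in> borel_measurable M"
    and cauchy: "\<And>e. e > 0 \<Longrightarrow> \<exists>N. \<forall>m\<ge>N. \<forall>n\<ge>N. powint M p (\<lambda>y. f m y - f n y) \<le> ennreal e"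
  obtains g where "g \<in> borel_measurable M" "\<forall>e>0. \<exists>N. \<forall>n\<ge>N. powint M p (\<lambda>y. f n y - g y) \<le> ennreal e"
proof -
  \<comment> \<open>Chosen so that the \<open>p\<close>-th powers of
    \<open>2 ^ k * \<bar>g k y\<bar>\<close> have integrals bounded by \<open>(1/2) ^ k\<close>.
    Their sum is then finite almost everywhere, and the increments \<open>g k y\<close> are
    dominated by a geometric series.\<close>
  define e where "e k = (1/2::real) ^ k * (2 ^ k) powr (- p)" for k :: nat
  have e: "e k > 0" for k by (simp add: e_def)
  have "\<forall>k. \<exists>N. \<forall>m\<ge>N. \<forall>n\<ge>N. powint M p (\<lambda>y. f m y - f n y) \<le> ennreal (e k)" using cauchy e by blast
  from choice[OF this] obtain N
    where N: "\<forall>k. \<forall>m\<ge>N k. \<forall>n\<ge>N k. powint M p (\<lambda>y. f m y - f n y) \<le> ennreal (e k)" ..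
  define r where "r k = (\<Sum>i\<le>k. N i) + k" for k
  have r: "r k \<ge> N k" "r k \<ge> k" "r (Suc k) \<ge> r k" for k
    using member_le_sum[of k "{..k}" N] by (auto simp: r_def)
  define g where "g k y = f (r (Suc k)) y - f (r k) y" for k y
  have [measurable]: "g k \<in> borel_measurable M" for k unfolding g_def by measurable
  have pg: "powint M p (g k) \<le> ennreal (e k)" for k
    unfolding g_def using N r(1)[of k] r(3)[of k] by (meson order_trans)
  have "AE y in M. (\<Sum>k. ennreal ((2 ^ k * \<bar>g k y\<bar>) powr p)) \<noteq> \<infinity>"
  proof (rule nn_integral_PInf_AE)
    have "(\<integral>\<^sup>+ y. (\<Sum>k. ennreal ((2 ^ k * \<bar>g k y\<bar>) powr p)) \<partial>M) = (\<Sum>k. \<integral>\<^sup>+ y. ennreal ((2 ^ k * \<bar>g k y\<bar>) powr p) \<partial>M)"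
      by (rule nn_integral_suminf) measurable
    also have "\<dots> = (\<Sum>k. ennreal ((2 ^ k) powr p) * powint M p (g k))"
      unfolding powint_def
      by (subst nn_integral_cmult[symmetric]) (auto simp: powr_mult ennreal_mult)
    also have "\<dots> \<le> (\<Sum>k. ennreal ((1/2) ^ k))"
    proof (rule suminf_le)
      fix k
      have "ennreal ((2 ^ k) powr p) * powint M p (g k) \<le> ennreal ((2 ^ k) powr p) * ennreal (e k)"
        by (rule mult_left_mono[OF pg]) simp
      also have "\<dots> = ennreal ((1/2) ^ k)"
        by (simp add: e_def ennreal_mult[symmetric] powr_minus field_simps)
      finally show "ennreal ((2 ^ k) powr p) * powint M p (g k) \<le> ennreal ((1/2) ^ k)" .
    qed (rule summableI)+
    also have "\<dots> = ennreal (\<Sum>k. (1/2) ^ k)"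
      by (rule suminf_ennreal2) (simp_all add: summable_geometric)
    finally show "(\<integral>\<^sup>+ y. (\<Sum>k. ennreal ((2 ^ k * \<bar>g k y\<bar>) powr p)) \<partial>M) \<noteq> \<infinity>"
      unfolding infinity_ennreal_def by (rule neq_top_trans[OF ennreal_neq_top])
  qed measurable
  then have conv: "AE y in M. convergent (\<lambda>k. f (r k) y)"
  proof eventually_elim
    case (elim y)
    define H where "H = enn2real (\<Sum>k. ennreal ((2 ^ k * \<bar>g k y\<bar>) powr p))"
    have H: "(\<Sum>k. ennreal ((2 ^ k * \<bar>g k y\<bar>) powr p)) = ennreal H" "H \<ge> 0"
      using elim unfolding H_def by (simp_all only: infinity_ennreal_def less_top[symmetric] ennreal_enn2real_if enn2real_nonneg if_False)
    have bound: "norm (g k y) \<le> H powr (1 / p) * (1/2) ^ k" for k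
    proof -
      have "ennreal ((2 ^ k * \<bar>g k y\<bar>) powr p) \<le> ennreal H"
        unfolding H(1)[symmetric] by (rule ennreal_le_suminf)
      then have "(2 ^ k * \<bar>g k y\<bar>) powr p \<le> H" using H(2) by (simp add: ennreal_le_iff)
      then have "((2 ^ k * \<bar>g k y\<bar>) powr p) powr (1 / p) \<le> H powr (1 / p)"
        using p by (intro powr_mono2) auto
      then have "2 ^ k * \<bar>g k y\<bar> \<le> H powr (1 / p)" using p by (simp add: powr_powr)
      then show ?thesis by (simp add: field_simps)
    qed
    have "summable (\<lambda>k. g k y)"
      by (rule summable_comparison_test'[OF _ bound])
        (intro summable_mult summable_geometric, simp)
    then have "convergent (\<lambda>n. \<Sum>k<n. g k y)" by (simp add: summable_iff_convergent)
    then have "convergent (\<lambda>n. (\<Sum>k<n. g k y) + f (r 0) y)"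
      by (rule convergent_add[OF _ convergent_const])
    moreover have "(\<Sum>k<n. g k y) + f (r 0) y = f (r n) y" for n
      by (induction n) (auto simp: g_def)
    ultimately show ?case by simp
  qed
  define h where "h y = lim (\<lambda>k. f (r k) y)" for y
  have hm [measurable]: "h \<in> borel_measurable M"
    unfolding h_def by (rule borel_measurable_lim_metric) measurable
  have "\<exists>N. \<forall>n\<ge>N. powint M p (\<lambda>y. f n y - h y) \<le> ennreal \<epsilon>" if \<epsilon>: "\<epsilon> > 0" for \<epsilon>
  proof -
    obtain N' where N': "\<forall>m\<ge>N'. \<forall>n\<ge>N'. powint M p (\<lambda>y. f m y - f n y) \<le> ennreal \<epsilon>"
      using cauchy[OF \<epsilon>] ..
    have "powint M p (\<lambda>y. f n y - h y) \<le> ennreal \<epsilon>" if n: "n \<ge> N'" for n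
    proof -
      \<comment> \<open>Fatou's lemma along the subsequence \<open>r\<close> transfers the Cauchy
        estimate to the pointwise limit.\<close>
      have "powint M p (\<lambda>y. f n y - h y) = (\<integral>\<^sup>+ y. liminf (\<lambda>k. ennreal (\<bar>f n y - f (r k) y\<bar> powr p)) \<partial>M)"
        unfolding powint_def
      proof (rule nn_integral_cong_AE)
        show "AE y in M. ennreal (\<bar>f n y - h y\<bar> powr p) = liminf (\<lambda>k. ennreal (\<bar>f n y - f (r k) y\<bar> powr p))"
          using conv
        proof eventually_elim
          case (elim y)
          then have "(\<lambda>k. f (r k) y) \<longlonglongrightarrow> h y" by (simp add: h_def convergent_LIMSEQ_iff)
          then have "(\<lambda>k. ennreal (\<bar>f n y - f (r k) y\<bar> powr p)) \<longlonglongrightarrow> ennreal (\<bar>f n y - h y\<bar> powr p)"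
            using p by (intro tendsto_ennrealI tendsto_powr' tendsto_intros) auto
          then show ?case by (rule lim_imp_Liminf[OF sequentially_bot, symmetric])
        qed
      qed
      also have "\<dots> \<le> liminf (\<lambda>k. \<integral>\<^sup>+ y. ennreal (\<bar>f n y - f (r k) y\<bar> powr p) \<partial>M)"
        by (rule nn_integral_liminf) measurable
      also have "\<dots> \<le> liminf (\<lambda>k. ennreal \<epsilon>)"
      proof (rule Liminf_mono)
        show "\<forall>\<^sub>F k in sequentially. (\<integral>\<^sup>+ y. ennreal (\<bar>f n y - f (r k) y\<bar> powr p) \<partial>M) \<le> ennreal \<epsilon>"
          unfolding eventually_sequentially powint_def[symmetric]
          using N' n r(2) by (meson order_trans)
      qed
      also have "\<dots> = ennreal \<epsilon>" by (simp add: Liminf_const)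
      finally show ?thesis .
    qed
    then show ?thesis by blast
  qed
  then show ?thesis using hm that by blast
qed

section \<open>Interpolation inequalities\<close>

text \<open>A Young inequality with free parameter \<open>e\<close>: where
  \<open>\<bar>a\<bar>\<close> exceeds \<open>e\<close>, the factor
  \<open>\<bar>a\<bar> powr (1 - p)\<close> is at most \<open>e powr (1 - p)\<close>. Integrating it
  and then choosing \<open>e\<close> gives what Hoelder's inequality would, up to constants.\<close>

lemma le_add_powr:
  fixes a e p :: real
  assumes "p \<ge> 1" "e > 0"
  shows "\<bar>a\<bar> \<le> e + e powr (1 - p) * \<bar>a\<bar> powr p"
proof (cases "\<bar>a\<bar> \<le> e")
  case False
  then have a: "\<bar>a\<bar> > 0" "e < \<bar>a\<bar>" using assms(2) by auto
  have "\<bar>a\<bar> = \<bar>a\<bar> powr (1 - p) * \<bar>a\<bar> powr p" using a by (simp add: powr_add[symmetric])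
  also have "\<dots> \<le> e powr (1 - p) * \<bar>a\<bar> powr p"
    using a assms by (intro mult_right_mono powr_mono2') auto
  finally show ?thesis using assms(2) by simp
qed (use assms in \<open>simp add: add_increasing2\<close>)

lemma integral_powr_le:
  fixes a :: "real \<Rightarrow> real"
  assumes p: "p \<ge> 1" and t: "t > 0" and a: "continuous_on {0..t} a"
  shows "(integral {0..t} (\<lambda>r. \<bar>a r\<bar>)) powr p \<le> 2 powr p * t powr (p - 1) * integral {0..t} (\<lambda>r. \<bar>a r\<bar> powr p)"
proof -
  let ?J = "integral {0..t} (\<lambda>r. \<bar>a r\<bar>)" and ?I = "integral {0..t} (\<lambda>r. \<bar>a r\<bar> powr p)"
  have i1: "(\<lambda>r. \<bar>a r\<bar>) integrable_on {0..t}"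
    by (intro integrable_continuous_interval continuous_intros a)
  have i2: "(\<lambda>r. \<bar>a r\<bar> powr p) integrable_on {0..t}"
    using p by (intro integrable_continuous_interval continuous_on_powr' continuous_intros a) auto
  have J0: "?J \<ge> 0" and I0: "?I \<ge> 0" by (intro integral_nonneg i1 i2; simp)+
  have key: "?J \<le> t * e + e powr (1 - p) * ?I" if "e > 0" for e
  proof -
    have "?J \<le> integral {0..t} (\<lambda>r. e + e powr (1 - p) * \<bar>a r\<bar> powr p)"
      by (intro integral_le i1 integrable_add integrable_on_mult_right i2 le_add_powr p that) auto
    also have "\<dots> = t * e + e powr (1 - p) * ?I"
      using t by (subst Henstock_Kurzweil_Integration.integral_add) (auto intro: integrable_on_mult_right i2)
    finally show ?thesis .
  qed
  show ?thesis
  proof (cases "?I = 0")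
    case True
    have "?J \<le> 0"
    proof (rule field_le_epsilon)
      fix e :: real assume "e > 0"
      then show "?J \<le> 0 + e" using key[of "e / t"] t True by simp
    qed
    then show ?thesis using J0 I0 by simp
  next
    case False
    then have I: "?I > 0" using I0 by linarith
    \<comment> \<open>This value balances the two summands of \<open>key\<close>: both become
      \<open>t * e\<close>, whence the factor 2.\<close>
    define e where "e = (?I / t) powr (1 / p)"
    have e: "e > 0" using I t by (simp add: e_def)
    have ep: "e powr p = ?I / t" using I t p by (simp add: e_def powr_powr)
    have "e powr (1 - p) * ?I = e * (e powr (- p) * ?I)"
      using e by (simp add: powr_diff powr_minus divide_inverse)
    also have "e powr (- p) * ?I = t" using I t by (simp add: powr_minus ep)
    finally have "?J \<le> 2 * t * e" using key[OF e] by (simp add: algebra_simps)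
    then have "?J powr p \<le> (2 * t * e) powr p" using J0 p by (intro powr_mono2) auto
    also have "\<dots> = 2 powr p * t powr p * (?I / t)" using t e by (simp add: powr_mult ep)
    also have "\<dots> = 2 powr p * t powr (p - 1) * ?I" using t by (simp add: powr_diff)
    finally show ?thesis .
  qed
qed

lemma ennreal_integral_eq_nn_integral:
  fixes a :: "real \<Rightarrow> real"
  assumes "continuous_on {0..t} a" "\<And>r. a r \<ge> 0"
  shows "ennreal (integral {0..t} a) = (\<integral>\<^sup>+ r. ennreal (a r) * indicator {0..t} r \<partial>lborel)"
proof -
  have i: "set_integrable lborel {0..t} a" by (rule borel_integrable_atLeastAtMost'[OF assms(1)])
  have "(\<integral>\<^sup>+ r. ennreal (a r) * indicator {0..t} r \<partial>lborel) = (\<integral>\<^sup>+ r. ennreal (indicator {0..t} r *\<^sub>R a r) \<partial>lborel)"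
    by (intro nn_integral_cong) (auto split: split_indicator)
  also have "\<dots> = ennreal (\<integral>r. indicator {0..t} r *\<^sub>R a r \<partial>lborel)"
    using i assms(2) by (intro nn_integral_eq_integral) (auto simp: set_integrable_def)
  also have "(\<integral>r. indicator {0..t} r *\<^sub>R a r \<partial>lborel) = integral {0..t} a"
    using set_borel_integral_eq_integral(2)[OF i] by (simp add: set_lebesgue_integral_def)
  finally show ?thesis by simp
qed

lemma nn_integral_lincomb:
  fixes a b c :: ennreal
  assumes [measurable]: "F \<in> borel_measurable M" "G \<in> borel_measurable M" "H \<in> borel_measurable M"
  shows "(\<integral>\<^sup>+ y. (a * F y + b * G y) + c * H y \<partial>M) =
    (a * (\<integral>\<^sup>+ y. F y \<partial>M) + b * (\<integral>\<^sup>+ y. G y \<partial>M)) + c * (\<integral>\<^sup>+ y. H y \<partial>M)"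
  by (simp add: nn_integral_add nn_integral_cmult)

lemma add3_powr_le:
  fixes a b c :: real
  assumes "a \<ge> 0" "b \<ge> 0" "c \<ge> 0" "p \<ge> 0"
  shows "(a + b + c) powr p \<le> 3 powr p * (a powr p + b powr p + c powr p)"
  using sum_powr_le[of "{..<3::nat}" "\<lambda>k. if k = 0 then a else if k = 1 then b else c" p] assms
  by (simp add: eval_nat_numeral)

context left_haar
begin

lemma powint_Cc_infty_finite:
  assumes "u \<in> Cc_infty A \<Omega>" "p \<ge> 0" shows "powint lam p u < \<infinity>"
  using assms(1)
proof (rule Cc_inftyE)
  fix K assume K: "u \<in> smooth_fun A" "compact K" "\<And>y. y \<notin> K \<Longrightarrow> u y = 0"
  obtain B where B: "B \<ge> 0" "\<forall>y. \<bar>u y\<bar> \<le> B" by (rule Cc_infty_bounded[OF assms(1)])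
  have [measurable]: "K \<in> sets lam" using compact_imp_closed[OF K(2)] by simp
  have "powint lam p u \<le> (\<integral>\<^sup>+ y. ennreal (B powr p) * indicator K y \<partial>lam)"
    unfolding powint_def
  proof (rule nn_integral_mono)
    fix y
    show "ennreal (\<bar>u y\<bar> powr p) \<le> ennreal (B powr p) * indicator K y"
      using B K(3)[of y] assms(2) by (cases "y \<in> K") (auto intro!: ennreal_leI powr_mono2)
  qed
  also have "\<dots> = ennreal (B powr p) * emeasure lam K" by (rule nn_integral_cmult_indicator) fact
  also have "\<dots> < \<infinity>" using emeasure_compact[OF K(2)] by (simp add: ennreal_mult_less_top)
  finally show ?thesis .
qed

lemma powint_ltrans:
  assumes "u \<in> borel_measurable lam" shows "powint lam p (ltrans x u) = powint lam p u"
  unfolding powint_def ltrans_def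
  by (rule nn_integral_translate) (use assms in measurable)

end

context haar_field
begin

lemma field_pointwise_interpolation:
  assumes t: "0 < t" "t \<le> \<delta>" and \<gamma>: "\<gamma> 0 = 0" "continuous_on {0..\<delta>} \<gamma>"
    and der: "\<And>u y s. u \<in> smooth_fun A \<Longrightarrow> s \<in> {0..\<delta>} \<Longrightarrow>
      ((\<lambda>s. u (y + \<gamma> s)) has_vector_derivative Y u (y + \<gamma> s)) (at s within {0..\<delta>})"
    and f: "f \<in> smooth_fun A"
  shows "t * \<bar>Y f y\<bar> \<le> \<bar>f (y + \<gamma> t)\<bar> + \<bar>f y\<bar> + t * integral {0..t} (\<lambda>r. \<bar>Y (Y f) (y + \<gamma> r)\<bar>)"
proof -
  let ?J = "integral {0..t} (\<lambda>r. \<bar>Y (Y f) (y + \<gamma> r)\<bar>)"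
  have der': "((\<lambda>s. u (y + \<gamma> s)) has_vector_derivative Y u (y + \<gamma> s)) (at s within {0..s'})"
    if "u \<in> smooth_fun A" "s \<in> {0..s'}" "s' \<le> t" for u s s'
    by (rule has_vector_derivative_within_subset[OF der]) (use that t in auto)
  have c: "continuous_on {0..s} (\<lambda>r. Y (Y f) (y + \<gamma> r))" if "s \<le> t" for s
    by (intro continuous_on_compose2[OF smooth_fun_continuous[OF field_smooth[OF field_smooth[OF f]], of UNIV]]
        continuous_intros continuous_on_subset[OF \<gamma>(2)]) (use that t in auto)
  have bound: "\<bar>Y f (y + \<gamma> s) - Y f y\<bar> \<le> ?J" if s: "s \<in> {0..t}" for s
  proof -
    have "((\<lambda>r. Y (Y f) (y + \<gamma> r)) has_integral Y f (y + \<gamma> s) - Y f (y + \<gamma> 0)) {0..s}"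
      using s by (intro fundamental_theorem_of_calculus der'[OF field_smooth[OF f]]) auto
    then have "Y f (y + \<gamma> s) - Y f y = integral {0..s} (\<lambda>r. Y (Y f) (y + \<gamma> r))"
      by (simp add: \<gamma>(1) integral_unique)
    also have "\<bar>\<dots>\<bar> \<le> integral {0..s} (\<lambda>r. \<bar>Y (Y f) (y + \<gamma> r)\<bar>)"
      unfolding real_norm_def[symmetric]
      by (rule integral_norm_bound_integral) (use s in \<open>auto intro!: integrable_continuous_interval continuous_on_norm continuous_on_rabs c\<close>)
    also have "\<dots> \<le> ?J"
      using s by (intro integral_subset_le integrable_continuous_interval continuous_on_rabs c) auto
    finally show ?thesis .
  qed
  \<comment> \<open>The mean value inequality for
    \<open>s \<mapsto> f (y + \<gamma> s) - s * Y f y\<close>, whose derivative is the increment of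
    \<open>Y f\<close> along the curve.\<close>
  have "norm ((f (y + \<gamma> t) - t * Y f y) - (f (y + \<gamma> 0) - 0 * Y f y)) \<le> ?J * norm (t - 0)"
  proof (rule field_differentiable_bound[where S="{0..t}" and f="\<lambda>s. f (y + \<gamma> s) - s * Y f y"
        and f'="\<lambda>s. Y f (y + \<gamma> s) - Y f y"])
    fix s assume s: "s \<in> {0..t}"
    have "((\<lambda>s. f (y + \<gamma> s)) has_real_derivative Y f (y + \<gamma> s)) (at s within {0..t})"
      using der'[OF f s] by (simp add: has_real_derivative_iff_has_vector_derivative)
    then show "((\<lambda>s. f (y + \<gamma> s) - s * Y f y) has_real_derivative Y f (y + \<gamma> s) - Y f y) (at s within {0..t})"
      by (auto intro!: derivative_eq_intros)
    show "norm (Y f (y + \<gamma> s) - Y f y) \<le> ?J" using bound[OF s] by simp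
  qed (use t in auto)
  then have "\<bar>f (y + \<gamma> t) - t * Y f y - f y\<bar> \<le> t * ?J"
    using t by (simp add: \<gamma>(1) mult.commute)
  moreover have "t * \<bar>Y f y\<bar> = \<bar>t * Y f y\<bar>" using t by (simp add: abs_mult)
  ultimately show ?thesis by linarith
qed

lemma field_interpolation_powint:
  assumes p: "p \<ge> 1"
  obtains C \<delta> where "C \<ge> 0" "\<delta> > 0" "\<forall>t\<in>{0<..\<delta>}. \<forall>f\<in>Cc_infty A UNIV. powint lam p (Y f) \<le>
    ennreal (C * t powr (- p)) * powint lam p f + ennreal (C * t powr p) * powint lam p (Y (Y f))"
proof -
  obtain \<delta> \<gamma> where \<delta>: "\<delta> > 0" and \<gamma>: "\<gamma> 0 = 0" "continuous_on {0..\<delta>} \<gamma>"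
    and der: "\<And>u y t. u \<in> smooth_fun A \<Longrightarrow> t \<in> {0..\<delta>} \<Longrightarrow>
      ((\<lambda>t. u (y + \<gamma> t)) has_vector_derivative Y u (y + \<gamma> t)) (at t within {0..\<delta>})"
    using integral_curve by metis
  obtain d :: "'g \<Rightarrow> real" where d: "\<And>g. distr lam lam (\<lambda>y. y + g) = density lam (\<lambda>_. ennreal (d g))"
    "\<And>g. d g > 0" "\<And>C. compact C \<Longrightarrow> \<exists>B\<ge>0. \<forall>g\<in>C. d g \<le> B"
    using modular_function by metis
  have "compact (\<gamma> ` {0..\<delta>})" by (rule compact_continuous_image[OF \<gamma>(2) compact_Icc])
  from d(3)[OF this] obtain B where B: "B \<ge> 0" "\<forall>g\<in>\<gamma> ` {0..\<delta>}. d g \<le> B" by blast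
  have transl: "powint lam p (\<lambda>y. f (y + \<gamma> t)) \<le> ennreal B * powint lam p f"
    if [measurable]: "f \<in> borel_measurable lam" and t: "t \<in> {0..\<delta>}" for f t
  proof -
    have "powint lam p (\<lambda>y. f (y + \<gamma> t)) = (\<integral>\<^sup>+ y. ennreal (\<bar>f y\<bar> powr p) \<partial>distr lam lam (\<lambda>y. y + \<gamma> t))"
      unfolding powint_def by (subst nn_integral_distr) auto
    also have "\<dots> = ennreal (d (\<gamma> t)) * powint lam p f"
      unfolding d(1) powint_def by (subst nn_integral_density) (auto simp: nn_integral_cmult)
    also have "\<dots> \<le> ennreal B * powint lam p f"
      using B(2) t by (intro mult_right_mono ennreal_leI) auto
    finally show ?thesis .
  qed
  \<comment> \<open>The curve is controlled only on \<open>{0..\<delta>}\<close>. Clamping the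
    parameter gives a function continuous in both variables on the whole product, hence measurable
    as Tonelli's theorem requires.\<close>
  define cl where "cl r = max 0 (min \<delta> r)" for r
  have cl: "cl r \<in> {0..\<delta>}" "r \<in> {0..\<delta>} \<Longrightarrow> cl r = r" for r using \<delta> by (auto simp: cl_def)
  have \<gamma>cl: "continuous_on UNIV (\<lambda>r. \<gamma> (cl r))"
    by (rule continuous_on_compose2[OF \<gamma>(2)]) (use \<delta> in \<open>auto simp: cl_def intro!: continuous_intros\<close>)
  interpret PS: pair_sigma_finite lborel lam ..
  have avg: "(\<integral>\<^sup>+ y. ennreal (integral {0..t} (\<lambda>r. \<bar>h (y + \<gamma> r)\<bar> powr p)) \<partial>lam) \<le> ennreal (B * t) * powint lam p h"
    if h: "h \<in> smooth_fun A" and t: "0 < t" "t \<le> \<delta>" for h t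
  proof -
    have "continuous_on UNIV (\<lambda>z. h (snd z + \<gamma> (cl (fst z))))"
      by (intro continuous_on_compose2[OF smooth_fun_continuous[OF h, of UNIV]] continuous_intros
          continuous_on_compose2[OF \<gamma>cl]) auto
    from borel_measurable_continuous_onI[OF this]
    have m: "(\<lambda>(r, y). h (y + \<gamma> (cl r))) \<in> borel_measurable (lborel \<Otimes>\<^sub>M lam)"
      by (subst measurable_cong_sets[where M'="borel" and N'=borel])
        (auto simp: borel_prod[symmetric] case_prod_beta' intro!: sets_pair_measure_cong)
    note [measurable] = m
    have c: "continuous_on {0..t} (\<lambda>r. \<bar>h (y + \<gamma> r)\<bar> powr p)" for y
      using p t by (intro continuous_on_powr' continuous_intros continuous_on_subset[OF \<gamma>(2)]
          continuous_on_compose2[OF smooth_fun_continuous[OF h, of UNIV]]) auto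
    have "(\<integral>\<^sup>+ y. ennreal (integral {0..t} (\<lambda>r. \<bar>h (y + \<gamma> r)\<bar> powr p)) \<partial>lam) =
        (\<integral>\<^sup>+ y. \<integral>\<^sup>+ r. ennreal (\<bar>h (y + \<gamma> (cl r))\<bar> powr p) * indicator {0..t} r \<partial>lborel \<partial>lam)"
    proof (rule nn_integral_cong)
      fix y
      show "ennreal (integral {0..t} (\<lambda>r. \<bar>h (y + \<gamma> r)\<bar> powr p)) =
        (\<integral>\<^sup>+ r. ennreal (\<bar>h (y + \<gamma> (cl r))\<bar> powr p) * indicator {0..t} r \<partial>lborel)"
        by (subst ennreal_integral_eq_nn_integral[OF c])
          (use t cl(2) in \<open>auto intro!: nn_integral_cong split: split_indicator\<close>)
    qed
    also have "\<dots> = (\<integral>\<^sup>+ r. \<integral>\<^sup>+ y. ennreal (\<bar>h (y + \<gamma> (cl r))\<bar> powr p) * indicator {0..t} r \<partial>lam \<partial>lborel)"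
      by (rule PS.Fubini') measurable
    also have "\<dots> \<le> (\<integral>\<^sup>+ r. ennreal B * powint lam p h * indicator {0..t} r \<partial>lborel)"
    proof (rule nn_integral_mono)
      fix r
      have [measurable]: "h \<in> borel_measurable lam" by (rule smooth_fun_measurable[OF h])
      have "(\<integral>\<^sup>+ y. ennreal (\<bar>h (y + \<gamma> (cl r))\<bar> powr p) * indicator {0..t} r \<partial>lam) = powint lam p (\<lambda>y. h (y + \<gamma> (cl r))) * indicator {0..t} r"
        unfolding powint_def by (rule nn_integral_multc) measurable
      also have "\<dots> \<le> ennreal B * powint lam p h * indicator {0..t} r"
        by (rule mult_right_mono[OF transl[OF smooth_fun_measurable[OF h] cl(1)]]) simp
      finally show "(\<integral>\<^sup>+ y. ennreal (\<bar>h (y + \<gamma> (cl r))\<bar> powr p) * indicator {0..t} r \<partial>lam) \<le> \<dots>" .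
    qed
    also have "\<dots> = ennreal B * powint lam p h * ennreal t"
      using t by (subst nn_integral_cmult_indicator) auto
    also have "\<dots> = ennreal (B * t) * powint lam p h"
      using B(1) t by (simp add: ennreal_mult mult_ac)
    finally show ?thesis .
  qed
  \<comment> \<open>A common bound for the coefficients of the three terms: the translated function,
    which costs the bound \<open>B\<close> of the modular function, the function itself, and the
    averaged second derivative.\<close>
  define C where "C = 3 powr p * (B + 1) * 2 powr p"
  have C: "C \<ge> 3 powr p * B" "C \<ge> 3 powr p" "C \<ge> 3 powr p * (2 powr p * B)" "C \<ge> 0"
  proof -
    have "1 \<le> 2 powr p" using p by (intro ge_one_powr_ge_zero) auto
    then have "(B + 1) * 1 \<le> (B + 1) * 2 powr p" using B(1) by (intro mult_left_mono) auto
    then have "B \<le> (B + 1) * 2 powr p \<and> 1 \<le> (B + 1) * 2 powr p" using B(1) by (simp only: mult_1_right) linarith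
    then show "C \<ge> 3 powr p * B" "C \<ge> 3 powr p"
      unfolding C_def mult.assoc by (auto intro: mult_left_mono)
    show "C \<ge> 3 powr p * (2 powr p * B)" "C \<ge> 0" using B(1) by (auto simp: C_def algebra_simps)
  qed
  have main: "powint lam p (Y f) \<le>
    ennreal (2 * C * t powr (- p)) * powint lam p f + ennreal (2 * C * t powr p) * powint lam p (Y (Y f))"
    if f: "f \<in> Cc_infty A UNIV" and t: "0 < t" "t \<le> \<delta>" for f t
  proof -
    note fs = Cc_infty_smooth[OF f]
    note [measurable] = smooth_fun_measurable[OF fs]
    let ?I = "\<lambda>y. integral {0..t} (\<lambda>r. \<bar>Y (Y f) (y + \<gamma> r)\<bar> powr p)"
    have c: "continuous_on {0..t} (\<lambda>r. Y (Y f) (y + \<gamma> r))" for y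
      using t by (intro continuous_on_compose2[OF smooth_fun_continuous[OF field_smooth[OF field_smooth[OF fs]], of UNIV]]
        continuous_intros continuous_on_subset[OF \<gamma>(2)]) auto
    have ci: "(\<lambda>r. \<bar>Y (Y f) (y + \<gamma> r)\<bar> powr p) integrable_on {0..t}" for y
      using p by (intro integrable_continuous_interval continuous_on_powr' continuous_intros c) auto
    have I0: "?I y \<ge> 0" for y by (rule integral_nonneg[OF ci]) simp
    have pt: "\<bar>Y f y\<bar> powr p \<le> 3 powr p * (t powr (- p) * \<bar>f (y + \<gamma> t)\<bar> powr p + t powr (- p) * \<bar>f y\<bar> powr p
        + 2 powr p * t powr (p - 1) * ?I y)" for y
    proof -
      let ?J = "integral {0..t} (\<lambda>r. \<bar>Y (Y f) (y + \<gamma> r)\<bar>)"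
      have J0: "?J \<ge> 0" by (intro integral_nonneg integrable_continuous_interval continuous_on_rabs c) simp
      have "\<bar>Y f y\<bar> \<le> \<bar>f (y + \<gamma> t)\<bar> / t + \<bar>f y\<bar> / t + ?J"
        using field_pointwise_interpolation[OF t \<gamma> der fs, of y] t(1) by (simp add: field_simps)
      then have "\<bar>Y f y\<bar> powr p \<le> (\<bar>f (y + \<gamma> t)\<bar> / t + \<bar>f y\<bar> / t + ?J) powr p"
        using p by (intro powr_mono2) auto
      also have "\<dots> \<le> 3 powr p * ((\<bar>f (y + \<gamma> t)\<bar> / t) powr p + (\<bar>f y\<bar> / t) powr p + ?J powr p)"
        using t p J0 by (intro add3_powr_le) auto
      also have "\<dots> \<le> 3 powr p * (t powr (- p) * \<bar>f (y + \<gamma> t)\<bar> powr p + t powr (- p) * \<bar>f y\<bar> powr p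
        + 2 powr p * t powr (p - 1) * ?I y)"
      proof -
        have "(\<bar>x\<bar> / t) powr p = t powr (- p) * \<bar>x\<bar> powr p" for x :: real
          using t(1) by (simp add: powr_divide powr_minus field_simps)
        then show ?thesis
          using integral_powr_le[OF p t(1) c, of y] by (intro mult_left_mono add_mono) auto
      qed
      finally show ?thesis .
    qed
    let ?a = "ennreal (3 powr p * t powr (- p))" and ?b = "ennreal (3 powr p * (2 powr p * t powr (p - 1)))"
    have "continuous_on UNIV (\<lambda>y. f (y + \<gamma> t))"
      by (rule continuous_on_compose2[OF smooth_fun_continuous[OF fs, of UNIV] continuous_translation(2)]) simp
    from borel_measurable_continuous_onI[OF this]
    have [measurable]: "(\<lambda>y. f (y + \<gamma> t)) \<in> borel_measurable lam" by simp
    have "powint lam p (Y f) \<le> (\<integral>\<^sup>+ y. (?a * ennreal (\<bar>f (y + \<gamma> t)\<bar> powr p) + ?a * ennreal (\<bar>f y\<bar> powr p)) + ?b * ennreal (?I y) \<partial>lam)"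
      unfolding powint_def
    proof (rule nn_integral_mono)
      fix y
      have "ennreal (\<bar>Y f y\<bar> powr p) \<le> ennreal ((3 powr p * t powr (- p) * \<bar>f (y + \<gamma> t)\<bar> powr p +
        3 powr p * t powr (- p) * \<bar>f y\<bar> powr p) + 3 powr p * (2 powr p * t powr (p - 1)) * ?I y)"
        using pt[of y] by (intro ennreal_leI) (simp add: algebra_simps)
      also have "\<dots> = (?a * ennreal (\<bar>f (y + \<gamma> t)\<bar> powr p) + ?a * ennreal (\<bar>f y\<bar> powr p)) + ?b * ennreal (?I y)"
        using I0[of y] by (simp add: ennreal_mult ennreal_plus)
      finally show "ennreal (\<bar>Y f y\<bar> powr p) \<le> \<dots>" .
    qed
    also have "\<dots> \<le> (?a * powint lam p (\<lambda>y. f (y + \<gamma> t)) + ?a * powint lam p f) + ?b * (\<integral>\<^sup>+ y. ennreal (?I y) \<partial>lam)"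
    proof -
      have meas: "(\<lambda>y. ennreal (?I y)) \<in> borel_measurable lam"
      proof -
        have "continuous_on (UNIV \<times> {0..t}) (\<lambda>(y, r). \<bar>Y (Y f) (y + \<gamma> r)\<bar> powr p)"
          unfolding case_prod_beta using p t
          by (intro continuous_on_powr' continuous_intros
              continuous_on_compose2[OF smooth_fun_continuous[OF field_smooth[OF field_smooth[OF fs]], of UNIV]]
              continuous_on_compose2[OF \<gamma>(2)]) auto
        then have "continuous_on UNIV (\<lambda>y. integral (cbox 0 t) (\<lambda>r. \<bar>Y (Y f) (y + \<gamma> r)\<bar> powr p))"
          by (intro integral_continuous_on_param) simp
        from borel_measurable_continuous_onI[OF this] have "?I \<in> borel_measurable lam" by simp
        then show ?thesis by measurable
      qed
      show ?thesis unfolding powint_def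
        by (rule eq_refl, rule nn_integral_lincomb) (use meas in measurable)
    qed
    also have "\<dots> \<le> (?a * (ennreal B * powint lam p f) + ?a * powint lam p f) + ?b * (ennreal (B * t) * powint lam p (Y (Y f)))"
      using t by (intro add_mono mult_left_mono transl avg field_smooth fs smooth_fun_measurable) auto
    also have "\<dots> \<le> (ennreal (C * t powr (- p)) * powint lam p f + ennreal (C * t powr (- p)) * powint lam p f)
      + ennreal (2 * C * t powr p) * powint lam p (Y (Y f))"
    proof (intro add_mono)
      have "?a * (ennreal B * powint lam p f) = ennreal (3 powr p * B * t powr (- p)) * powint lam p f"
        using B(1) by (simp add: ennreal_mult mult_ac)
      also have "\<dots> \<le> ennreal (C * t powr (- p)) * powint lam p f"
        using C(1) by (intro mult_right_mono ennreal_leI) auto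
      finally show "?a * (ennreal B * powint lam p f) \<le> ennreal (C * t powr (- p)) * powint lam p f" .
      show "?a * powint lam p f \<le> ennreal (C * t powr (- p)) * powint lam p f"
        using C(2) by (intro mult_right_mono ennreal_leI) auto
      have tp: "t powr (p - 1) * t = t powr p" using t by (simp add: powr_diff)
      have "?b * (ennreal (B * t) * powint lam p (Y (Y f))) = ennreal (3 powr p * (2 powr p * B) * (t powr (p - 1) * t)) * powint lam p (Y (Y f))"
        using B(1) t by (simp add: ennreal_mult mult_ac)
      also have "\<dots> = ennreal (3 powr p * (2 powr p * B) * t powr p) * powint lam p (Y (Y f))" by (simp only: tp)
      also have "\<dots> \<le> ennreal (2 * C * t powr p) * powint lam p (Y (Y f))"
        using C(3,4) by (intro mult_right_mono ennreal_leI) auto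
      finally show "?b * (ennreal (B * t) * powint lam p (Y (Y f))) \<le> ennreal (2 * C * t powr p) * powint lam p (Y (Y f))" .
    qed
    also have "\<dots> = ennreal (2 * C * t powr (- p)) * powint lam p f + ennreal (2 * C * t powr p) * powint lam p (Y (Y f))"
      using C(4) by (simp add: distrib_right[symmetric] ennreal_plus[symmetric] del: ennreal_plus)
    finally show ?thesis .
  qed
  show ?thesis
    by (rule that[of "2 * C" \<delta>]) (use C \<delta> main in auto)
qed

end

text \<open>The scheme for passing from neighbouring orders to arbitrary ones, with
  \<open>S l\<close> standing for the sum over all derivatives of order \<open>l\<close>. First
  \<open>S l\<close> is compared with \<open>S (Suc l)\<close> and \<open>S 0\<close>, by absorbing
  the intermediate term; then the order on the right is raised up to \<open>m\<close>.\<close>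

lemma interpolation_sequence:
  fixes S :: "nat \<Rightarrow> 'u \<Rightarrow> real"
  assumes nn: "\<And>l u. u \<in> D \<Longrightarrow> 0 \<le> S l u"
    and step: "\<And>l e. e > 0 \<Longrightarrow> \<exists>C\<ge>0. \<forall>u\<in>D. S (Suc l) u \<le> e * S (Suc (Suc l)) u + C * S l u"
    and e: "e > 0" and k: "k < m"
  shows "\<exists>C\<ge>0. \<forall>u\<in>D. S k u \<le> e * S m u + C * S 0 u"
proof -
  have one: "\<exists>C\<ge>0. \<forall>u\<in>D. S l u \<le> e * S (Suc l) u + C * S 0 u" if "e > 0" for l e
    using that
  proof (induction l arbitrary: e)
    case 0
    then show ?case by (intro exI[of _ 1]) (auto simp: nn)
  next
    case (Suc l)
    from step[of "e / 2" l] Suc.prems obtain C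
      where C: "C \<ge> 0" "\<forall>u\<in>D. S (Suc l) u \<le> e / 2 * S (Suc (Suc l)) u + C * S l u" by auto
    \<comment> \<open>With this parameter, \<open>C * S l u\<close> contributes at most half of
      \<open>S (Suc l) u\<close>, which moves to the left-hand side. The resulting factor 2 is the
      reason for starting from \<open>e / 2\<close>.\<close>
    from Suc.IH[of "1 / (2 * (C + 1))"] C(1) obtain C'
      where C': "C' \<ge> 0" "\<forall>u\<in>D. S l u \<le> 1 / (2 * (C + 1)) * S (Suc l) u + C' * S 0 u" by auto
    have "S (Suc l) u \<le> e * S (Suc (Suc l)) u + (2 * C * C') * S 0 u" if u: "u \<in> D" for u
    proof -
      have "C * (1 / (2 * (C + 1))) \<le> 1 / 2" using C(1) by (simp add: field_simps)
      then have h: "C * (1 / (2 * (C + 1))) * S (Suc l) u \<le> 1 / 2 * S (Suc l) u"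
        by (rule mult_right_mono) (rule nn[OF u])
      have "C * S l u \<le> C * (1 / (2 * (C + 1)) * S (Suc l) u + C' * S 0 u)"
        using C(1) bspec[OF C'(2) u] by (rule mult_left_mono[rotated])
      also have "\<dots> = C * (1 / (2 * (C + 1))) * S (Suc l) u + C * C' * S 0 u" by (simp only: distrib_left mult.assoc)
      finally have "S (Suc l) u \<le> e / 2 * S (Suc (Suc l)) u + (1 / 2 * S (Suc l) u + C * C' * S 0 u)"
        using bspec[OF C(2) u] h by linarith
      then show ?thesis by simp
    qed
    then show ?case using C(1) C'(1) by (intro exI[of _ "2 * C * C'"]) auto
  qed
  have "\<exists>C\<ge>0. \<forall>u\<in>D. S k u \<le> e * S (Suc k + j) u + C * S 0 u" for j
  proof (induction j)
    case 0
    then show ?case using one[OF e, of k] by simp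
  next
    case (Suc j)
    then obtain C where C: "C \<ge> 0" "\<forall>u\<in>D. S k u \<le> e * S (Suc k + j) u + C * S 0 u" by blast
    \<comment> \<open>The parameter 1 leaves the small factor \<open>e\<close> unchanged when the
      order is raised; only the constant of \<open>S 0\<close> grows.\<close>
    from one[OF zero_less_one, of "Suc k + j"] obtain C'
      where C': "C' \<ge> 0" "\<forall>u\<in>D. S (Suc k + j) u \<le> 1 * S (Suc (Suc k + j)) u + C' * S 0 u" by blast
    have "S k u \<le> e * S (Suc k + Suc j) u + (e * C' + C) * S 0 u" if u: "u \<in> D" for u
    proof -
      have "e * S (Suc k + j) u \<le> e * (1 * S (Suc (Suc k + j)) u + C' * S 0 u)"
        using e by (intro mult_left_mono bspec[OF C'(2) u]) simp
      then show ?thesis using bspec[OF C(2) u] by (simp add: algebra_simps)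
    qed
    then show ?case using C(1) C'(1) e by (intro exI[of _ "e * C' + C"]) auto
  qed
  from this[of "m - Suc k"] k show ?thesis by simp
qed

section \<open>Interpolation between orders of differentiation\<close>

locale haar_finite_fields = haar_fields A lam X
  for A :: "('g::{topological_group_add, t2_space, second_countable_topology},
               'e::euclidean_space) atlas" and lam
    and X :: "'k::finite \<Rightarrow> ('g \<Rightarrow> real) \<Rightarrow> 'g \<Rightarrow> real" +
  fixes p :: real
  assumes p_ge_1: "p \<ge> 1"
begin

text \<open>The real-valued form of \<open>powint\<close>, faithful on test functions, where
  \<open>powint\<close> is finite. Absorbing a term into the left-hand side needs subtraction, hence
  real numbers.\<close>

definition energy :: "('g \<Rightarrow> real) \<Rightarrow> real" where
  "energy f = enn2real (powint lam p f)"

lemma energy_nonneg [simp]: "energy f \<ge> 0"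
  by (simp add: energy_def)

lemma powint_eq_energy: "u \<in> Cc_infty A UNIV \<Longrightarrow> powint lam p u = ennreal (energy u)"
  unfolding energy_def using powint_Cc_infty_finite[of u UNIV p] p_ge_1 by simp

lemma finite_words [simp]: "finite {I :: 'k list. length I = l}"
  using finite_lists_length_eq[of "UNIV :: 'k set" l] by simp

lemma finite_words_le [simp]: "finite {I :: 'k list. length I \<le> l}"
  using finite_lists_length_le[of "UNIV :: 'k set" l] by simp

lemma finite_words_less [simp]: "finite {I :: 'k list. length I < l}"
  by (rule finite_subset[OF _ finite_words_le[of l]]) auto

lemma field_interpolation:
  assumes e: "e > 0"
  shows "\<exists>C\<ge>0. \<forall>f\<in>Cc_infty A UNIV. energy (X i f) \<le> e * energy (X i (X i f)) + C * energy f"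
proof -
  obtain C \<delta> where C: "C \<ge> 0" "\<delta> > 0" "\<forall>t\<in>{0<..\<delta>}. \<forall>f\<in>Cc_infty A UNIV. powint lam p (X i f) \<le>
    ennreal (C * t powr (- p)) * powint lam p f + ennreal (C * t powr p) * powint lam p (X i (X i f))"
    by (rule X.field_interpolation_powint[OF p_ge_1])
  \<comment> \<open>Small enough to make the coefficient \<open>C * t powr p\<close> of the second
    derivative at most \<open>e\<close>.\<close>
  define t where "t = min \<delta> ((e / (C + 1)) powr (1 / p))"
  have t: "t \<in> {0<..\<delta>}" using C(1,2) e by (auto simp: t_def)
  have "t powr p \<le> ((e / (C + 1)) powr (1 / p)) powr p"
    using t p_ge_1 by (intro powr_mono2) (auto simp: t_def)
  also have "\<dots> = e / (C + 1)" using e C(1) p_ge_1 by (simp add: powr_powr)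
  finally have "C * t powr p \<le> C * (e / (C + 1))" using C(1) by (rule mult_left_mono)
  also have "\<dots> \<le> e" using C(1) e by (simp add: field_simps)
  finally have Ct: "C * t powr p \<le> e" .
  have "energy (X i f) \<le> e * energy (X i (X i f)) + (C * t powr (- p)) * energy f" if f: "f \<in> Cc_infty A UNIV" for f
  proof -
    note fin = powint_eq_energy[OF f] powint_eq_energy[OF X.field_Cc_infty[OF f]]
      powint_eq_energy[OF X.field_Cc_infty[OF X.field_Cc_infty[OF f]]]
    have "ennreal (energy (X i f)) \<le> ennreal (C * t powr (- p)) * ennreal (energy f) + ennreal (C * t powr p) * ennreal (energy (X i (X i f)))"
      using bspec[OF bspec[OF C(3) t] f] by (simp only: fin)
    also have "\<dots> = ennreal (C * t powr (- p) * energy f + C * t powr p * energy (X i (X i f)))"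
      using C(1) by (simp add: ennreal_mult ennreal_plus)
    finally have "energy (X i f) \<le> C * t powr (- p) * energy f + C * t powr p * energy (X i (X i f))"
      using C(1) by (subst (asm) ennreal_le_iff) auto
    also have "C * t powr p * energy (X i (X i f)) \<le> e * energy (X i (X i f))"
      by (rule mult_right_mono[OF Ct]) simp
    finally show ?thesis by linarith
  qed
  then show ?thesis using C(1) by (intro exI[of _ "C * t powr (- p)"]) auto
qed

lemma words_Suc: "{I. length I = Suc l} = (\<lambda>(i, J). i # J) ` (UNIV \<times> {J. length J = l})"
  by (auto simp: length_Suc_conv image_iff)

lemma interpolation:
  assumes e: "e > 0" and k: "k < m"
  shows "\<exists>C\<ge>0. \<forall>u\<in>Cc_infty A UNIV. (\<Sum>I\<in>{I. length I = k}. energy (foldr X I u))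
    \<le> e * (\<Sum>I\<in>{I. length I = m}. energy (foldr X I u)) + C * energy u"
proof -
  let ?S = "\<lambda>l u. \<Sum>I\<in>{I. length I = l}. energy (foldr X I u)"
  have "\<exists>C\<ge>0. \<forall>u\<in>Cc_infty A UNIV. ?S k u \<le> e * ?S m u + C * ?S 0 u"
  proof (rule interpolation_sequence[OF _ _ e k])
    show "0 \<le> ?S l u" for l u by (intro sum_nonneg) simp
    fix l :: nat and e :: real assume "e > 0"
    have "\<forall>i. \<exists>C. C \<ge> 0 \<and> (\<forall>f\<in>Cc_infty A UNIV. energy (X i f) \<le> e * energy (X i (X i f)) + C * energy f)"
      using field_interpolation[OF \<open>e > 0\<close>] by blast
    from choice[OF this] obtain C where C: "\<forall>i. C i \<ge> 0 \<and>
      (\<forall>f\<in>Cc_infty A UNIV. energy (X i f) \<le> e * energy (X i (X i f)) + C i * energy f)" ..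
    let ?W = "UNIV \<times> {J :: 'k list. length J = l}"
    have "?S (Suc l) u \<le> e * ?S (Suc (Suc l)) u + (\<Sum>i\<in>UNIV. C i) * ?S l u" if u: "u \<in> Cc_infty A UNIV" for u
    proof -
      have "?S (Suc l) u = (\<Sum>(i, J)\<in>?W. energy (X i (foldr X J u)))"
        unfolding words_Suc by (subst sum.reindex) (auto simp: inj_on_def case_prod_beta)
      also have "\<dots> \<le> (\<Sum>(i, J)\<in>?W. e * energy (foldr X (i # i # J) u) + C i * energy (foldr X J u))"
        by (rule sum_mono) (use C iter_Cc_infty[OF u] in auto)
      also have "\<dots> = e * (\<Sum>(i, J)\<in>?W. energy (foldr X (i # i # J) u)) + (\<Sum>(i, J)\<in>?W. C i * energy (foldr X J u))"
        by (simp add: case_prod_beta sum.distrib sum_distrib_left)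
      also have "(\<Sum>(i, J)\<in>?W. C i * energy (foldr X J u)) = (\<Sum>i\<in>UNIV. C i) * ?S l u"
        by (simp add: sum.cartesian_product[symmetric] sum_distrib_left sum_distrib_right)
          (subst sum.swap, simp)
      \<comment> \<open>The interpolation inequality repeats the outermost field. The words
        \<open>i # i # J\<close> are only some of those of length \<open>l + 2\<close>, and the
        remaining ones may be added because energies are nonnegative.\<close>
      also have "(\<Sum>(i, J)\<in>?W. energy (foldr X (i # i # J) u)) = (\<Sum>I\<in>(\<lambda>(i, J). i # i # J) ` ?W. energy (foldr X I u))"
        by (subst sum.reindex) (auto simp: inj_on_def case_prod_beta)
      also have "\<dots> \<le> ?S (Suc (Suc l)) u"
        by (rule sum_mono2) auto
      finally show ?thesis using \<open>e > 0\<close> by simp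
    qed
    moreover have "(\<Sum>i\<in>UNIV. C i) \<ge> 0" using C by (intro sum_nonneg) auto
    ultimately show "\<exists>C\<ge>0. \<forall>u\<in>Cc_infty A UNIV. ?S (Suc l) u \<le> e * ?S (Suc (Suc l)) u + C * ?S l u" by blast
  qed
  then show ?thesis by simp
qed

end

section \<open>Operators with left-invariant principal part\<close>

context haar_finite_fields
begin

lemma smooth_iter_measurable: "u \<in> smooth_fun A \<Longrightarrow> foldr X I u \<in> borel_measurable lam"
  by (rule smooth_fun_measurable[OF iter_smooth])

text \<open>The left translates of the coefficients sweep out the group, so Fubini's theorem turns left
  invariance into the statement that the coefficients may be frozen at almost every point.\<close>
lemma freeze_coefficients:
  assumes c: "\<And>I. length I = m \<Longrightarrow> c I \<in> borel_measurable lam"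
    and inv: "left_invariant_op A lam (diff_entry X {I. length I = m} c)"
    and u: "u \<in> Cc_infty A UNIV"
  shows "AE z in lam. AE y in lam. diff_entry X {I. length I = m} c u y =
    (\<Sum>I\<in>{I. length I = m}. c I z * foldr X I u y)"
proof -
  let ?S = "\<lambda>z y. \<Sum>I\<in>{I. length I = m}. c I z * foldr X I u y"
  note us = Cc_infty_smooth[OF u]
  have cm: "(\<lambda>x. c I (f x)) \<in> borel_measurable M" if "length I = m" "f \<in> borel_measurable M" for I f and M :: "'z measure"
    using measurable_compose[OF that(2), of "c I" borel] c[OF that(1)] by simp
  have um: "(\<lambda>x. foldr X I u (f x)) \<in> borel_measurable M" if "f \<in> borel_measurable M" for I f and M :: "'z measure"
    using measurable_compose[OF that, of "foldr X I u" borel] smooth_iter_measurable[OF us, of I] by simp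
  interpret P: pair_sigma_finite lam lam ..
  \<comment> \<open>Left invariance spelled out: the derivatives of \<open>u\<close> are taken at
    the same point on both sides, while the coefficients are taken at \<open>y\<close> on the left
    and at \<open>- x + y\<close> on the right.\<close>
  have 1: "AE y in lam. ?S y (- x + y) = ?S (- x + y) (- x + y)" for x
  proof -
    have "AE y in lam. diff_entry X {I. length I = m} c (ltrans x u) y = ltrans x (diff_entry X {I. length I = m} c u) y"
      using inv u unfolding left_invariant_op_def by blast
    then show ?thesis
      by (simp add: diff_entry_def iter_ltrans[OF us]) (simp add: ltrans_def)
  qed
  have "AE y in lam. AE x in lam. ?S y (- x + y) = ?S (- x + y) (- x + y)"
  proof (subst P.AE_commute[symmetric])
    show "{z \<in> space (lam \<Otimes>\<^sub>M lam). ?S (snd z) (- fst z + snd z) = ?S (- fst z + snd z) (- fst z + snd z)} \<in> sets (lam \<Otimes>\<^sub>M lam)"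
      by (intro borel_measurable_eq borel_measurable_sum borel_measurable_times cm um) auto
    show "AE x in lam. AE y in lam. ?S y (- x + y) = ?S (- x + y) (- x + y)"
      by (rule AE_I2, rule 1)
  qed
  then show ?thesis
  proof eventually_elim
    case (elim y)
    \<comment> \<open>For fixed \<open>y\<close>, replacing \<open>x\<close> by \<open>y + x\<close>
      turns \<open>- x + y\<close> into \<open>- x\<close>, and inversion preserves null sets; so
      the operator has the coefficients frozen at \<open>y\<close> almost everywhere.\<close>
    from AE_translate[OF elim, of y]
    have "AE x in lam. ?S y (- x) = ?S (- x) (- x)"
      by (simp add: minus_add add.assoc del: add_uminus_conv_diff)
    from AE_uminus[OF this] show ?case
      by (simp add: diff_entry_def eq_commute)
  qed
qed

text \<open>The sets on which the sum of the coefficients is at most an integer exhaust the group,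
  so one of them has positive measure and meets the set of admissible freezing points. Thus
  \<open>N\<close> depends on the coefficients alone. Intersecting two sets of full measure freezes
  \<open>u\<close> and \<open>v\<close> at one common point.\<close>

lemma frozen_coefficients_bounded:
  assumes c: "\<And>I. length I = m \<Longrightarrow> c I \<in> borel_measurable lam"
    and inv: "left_invariant_op A lam (diff_entry X {I. length I = m} c)"
  shows "\<exists>N\<ge>0. \<forall>u\<in>Cc_infty A UNIV. \<forall>v\<in>Cc_infty A UNIV. \<exists>\<kappa>. (\<forall>I. \<bar>\<kappa> I\<bar> \<le> N) \<and>
    (AE y in lam. diff_entry X {I. length I = m} c u y = (\<Sum>I\<in>{I. length I = m}. \<kappa> I * foldr X I u y)) \<and>
    (AE y in lam. diff_entry X {I. length I = m} c v y = (\<Sum>I\<in>{I. length I = m}. \<kappa> I * foldr X I v y))"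
proof -
  define Z where "Z N = {z. (\<Sum>I\<in>{I. length I = m}. \<bar>c I z\<bar>) \<le> real N}" for N :: nat
  have sm: "(\<lambda>z. \<Sum>I\<in>{I. length I = m}. \<bar>c I z\<bar>) \<in> borel_measurable lam"
    by (intro borel_measurable_sum borel_measurable_abs c) auto
  have Z: "Z N \<in> sets lam" for N
    unfolding Z_def using sm by measurable
  have "\<exists>N. emeasure lam (Z N) \<noteq> 0"
  proof (rule ccontr)
    assume "\<not> ?thesis"
    then have "(\<Union>N. Z N) \<in> null_sets lam" using Z by (intro null_sets_UN) auto
    moreover have "(\<Union>N. Z N) = UNIV"
    proof (intro equalityI subsetI UNIV_I)
      fix z
      obtain N :: nat where "(\<Sum>I\<in>{I. length I = m}. \<bar>c I z\<bar>) \<le> real N" using real_arch_simple by blast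
      then show "z \<in> (\<Union>N. Z N)" by (auto simp: Z_def)
    qed
    ultimately show False using emeasure_lam_UNIV by auto
  qed
  then obtain N where N: "emeasure lam (Z N) \<noteq> 0" ..
  have "\<exists>\<kappa>. (\<forall>I. \<bar>\<kappa> I\<bar> \<le> real N) \<and>
    (AE y in lam. diff_entry X {I. length I = m} c u y = (\<Sum>I\<in>{I. length I = m}. \<kappa> I * foldr X I u y)) \<and>
    (AE y in lam. diff_entry X {I. length I = m} c v y = (\<Sum>I\<in>{I. length I = m}. \<kappa> I * foldr X I v y))"
    if u: "u \<in> Cc_infty A UNIV" and v: "v \<in> Cc_infty A UNIV" for u v
  proof -
    let ?F = "\<lambda>u z. AE y in lam. diff_entry X {I. length I = m} c u y =
      (\<Sum>I\<in>{I. length I = m}. c I z * foldr X I u y)"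
    have "AE z in lam. ?F u z \<and> ?F v z"
      using freeze_coefficients[OF c inv u] freeze_coefficients[OF c inv v] by (rule AE_conjI)
    moreover have "\<not> (AE z in lam. z \<notin> Z N)"
      using N Z[of N] by (simp add: AE_iff_null_sets[OF Z, symmetric] null_sets_def)
    ultimately have "\<exists>z\<in>Z N. ?F u z \<and> ?F v z"
    proof -
      assume ae: "AE z in lam. ?F u z \<and> ?F v z" and n: "\<not> (AE z in lam. z \<notin> Z N)"
      show ?thesis
      proof (rule ccontr)
        assume no: "\<not> (\<exists>z\<in>Z N. ?F u z \<and> ?F v z)"
        have "AE z in lam. z \<notin> Z N" using ae by (rule AE_mp) (use no in \<open>intro AE_I2, blast\<close>)
        then show False using n by blast
      qed
    qed
    then obtain z where z: "z \<in> Z N" "?F u z" "?F v z" by blast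
    have b: "\<bar>c I z\<bar> \<le> real N" if "length I = m" for I
    proof -
      have "\<bar>c I z\<bar> \<le> (\<Sum>I\<in>{I. length I = m}. \<bar>c I z\<bar>)"
        by (rule member_le_sum) (use that in auto)
      then show ?thesis using z(1) by (simp add: Z_def)
    qed
    show ?thesis
      by (intro exI[of _ "\<lambda>I. if length I = m then c I z else 0"]) (use b z(2,3) in auto)
  qed
  then show ?thesis by (intro exI[of _ "real N"]) auto
qed

text \<open>In every term except the one with all derivatives on \<open>v\<close>, at least one
  field has hit \<open>u\<close>, so \<open>v\<close> carries fewer derivatives than
  \<open>I\<close> is long. A list is used because terms may repeat.\<close>

lemma leibniz_words:
  "\<exists>L. (\<forall>(J, K)\<in>set L. length J \<le> length I \<and> length K < length I) \<and>
    (\<forall>u\<in>smooth_fun A. \<forall>v\<in>smooth_fun A. foldr X I (\<lambda>y. u y * v y) =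
      (\<lambda>y. u y * foldr X I v y + (\<Sum>(J, K)\<leftarrow>L. foldr X J u y * foldr X K v y)))"
proof (induction I)
  case Nil
  then show ?case by (intro exI[of _ "[]"]) simp
next
  case (Cons i I)
  then obtain L where L: "\<forall>(J, K)\<in>set L. length J \<le> length I \<and> length K < length I"
    "\<forall>u\<in>smooth_fun A. \<forall>v\<in>smooth_fun A. foldr X I (\<lambda>y. u y * v y) =
      (\<lambda>y. u y * foldr X I v y + (\<Sum>(J, K)\<leftarrow>L. foldr X J u y * foldr X K v y))" by blast
  let ?L = "([i], I) # map (\<lambda>(J, K). (i # J, K)) L @ map (\<lambda>(J, K). (J, i # K)) L"
  show ?case
  proof (intro exI[of _ ?L] conjI ballI)
    show "case q of (J, K) \<Rightarrow> length J \<le> length (i # I) \<and> length K < length (i # I)" if "q \<in> set ?L" for q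
      using that L(1) by fastforce
    fix u v assume u: "u \<in> smooth_fun A" and v: "v \<in> smooth_fun A"
    note us = iter_smooth[OF u] and vs = iter_smooth[OF v]
    have sl: "(\<lambda>y. \<Sum>(J, K)\<leftarrow>L. foldr X J u y * foldr X K v y) \<in> smooth_fun A" for L
      by (induction L) (auto intro!: smooth_fun_const smooth_fun_add smooth_fun_mult us vs)
    have dl: "X i (\<lambda>y. \<Sum>(J, K)\<leftarrow>L. foldr X J u y * foldr X K v y) =
      (\<lambda>y. (\<Sum>(J, K)\<leftarrow>L. foldr X (i # J) u y * foldr X K v y) + (\<Sum>(J, K)\<leftarrow>L. foldr X J u y * foldr X (i # K) v y))" for L
    proof (induction L)
      case Nil
      then show ?case by (simp add: X.field_const)
    next
      case (Cons q L)
      obtain J K where q: "q = (J, K)" by (cases q)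
      show ?case
        using Cons.IH
        by (simp add: q X.field_add[OF smooth_fun_mult[OF us vs] sl] X.field_mult[OF us vs] algebra_simps)
    qed
    have "foldr X (i # I) (\<lambda>y. u y * v y) = X i (\<lambda>y. u y * foldr X I v y + (\<Sum>(J, K)\<leftarrow>L. foldr X J u y * foldr X K v y))"
      using L(2) u v by simp
    also have "\<dots> = (\<lambda>y. u y * foldr X (i # I) v y + foldr X I v y * X i u y
      + ((\<Sum>(J, K)\<leftarrow>L. foldr X (i # J) u y * foldr X K v y) + (\<Sum>(J, K)\<leftarrow>L. foldr X J u y * foldr X (i # K) v y)))"
      by (simp add: X.field_add[OF smooth_fun_mult[OF u vs] sl] X.field_mult[OF u vs] dl)
    also have "\<dots> = (\<lambda>y. u y * foldr X (i # I) v y + (\<Sum>(J, K)\<leftarrow>?L. foldr X J u y * foldr X K v y))"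
      by (simp add: o_def case_prod_unfold algebra_simps)
    finally show "foldr X (i # I) (\<lambda>y. u y * v y) =
      (\<lambda>y. u y * foldr X (i # I) v y + (\<Sum>(J, K)\<leftarrow>?L. foldr X J u y * foldr X K v y))" .
  qed
qed

text \<open>There are finitely many words of length at most \<open>m\<close>, so the numbers of
  Leibniz terms have a common bound. Quantifying over \<open>g\<close> at a single point allows the
  commutator to be dominated by any function of the point.\<close>

lemma leibniz_bound:
  "\<exists>c\<ge>0. \<forall>I. length I \<le> m \<longrightarrow> (\<forall>u\<in>smooth_fun A. \<forall>v\<in>smooth_fun A. \<forall>y. \<forall>g.
    (\<forall>J K. length J \<le> m \<longrightarrow> length K < m \<longrightarrow> \<bar>foldr X J u y * foldr X K v y\<bar> \<le> g) \<longrightarrow>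
    \<bar>foldr X I (\<lambda>y. u y * v y) y - u y * foldr X I v y\<bar> \<le> c * g)"
proof -
  have "\<forall>I. \<exists>L. (\<forall>(J, K)\<in>set L. length J \<le> length I \<and> length K < length I) \<and>
    (\<forall>u\<in>smooth_fun A. \<forall>v\<in>smooth_fun A. foldr X I (\<lambda>y. u y * v y) =
      (\<lambda>y. u y * foldr X I v y + (\<Sum>(J, K)\<leftarrow>L. foldr X J u y * foldr X K v y)))"
    using leibniz_words by blast
  from choice[OF this] obtain L where L: "\<forall>I. (\<forall>(J, K)\<in>set (L I). length J \<le> length I \<and> length K < length I) \<and>
    (\<forall>u\<in>smooth_fun A. \<forall>v\<in>smooth_fun A. foldr X I (\<lambda>y. u y * v y) =
      (\<lambda>y. u y * foldr X I v y + (\<Sum>(J, K)\<leftarrow>L I. foldr X J u y * foldr X K v y)))" ..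
  let ?c = "\<Sum>I\<in>{I. length I \<le> m}. real (length (L I))"
  have "\<bar>foldr X I (\<lambda>y. u y * v y) y - u y * foldr X I v y\<bar> \<le> ?c * g"
    if I: "length I \<le> m" and u: "u \<in> smooth_fun A" and v: "v \<in> smooth_fun A"
      and g: "\<forall>J K. length J \<le> m \<longrightarrow> length K < m \<longrightarrow> \<bar>foldr X J u y * foldr X K v y\<bar> \<le> g" for I u v y g
  proof -
    have LI: "\<forall>(J, K)\<in>set (L I). length J \<le> length I \<and> length K < length I" using L by blast
    have eq: "foldr X I (\<lambda>y. u y * v y) = (\<lambda>y. u y * foldr X I v y + (\<Sum>(J, K)\<leftarrow>L I. foldr X J u y * foldr X K v y))"
      using L u v by blast
    have b: "\<forall>q\<in>set (L I). \<bar>foldr X (fst q) u y * foldr X (snd q) v y\<bar> \<le> g"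
      using LI I g by fastforce
    have "\<bar>\<Sum>q\<leftarrow>l. foldr X (fst q) u y * foldr X (snd q) v y\<bar> \<le> real (length l) * g"
      if "\<forall>q\<in>set l. \<bar>foldr X (fst q) u y * foldr X (snd q) v y\<bar> \<le> g" for l
      using that by (induction l) (auto simp: algebra_simps)
    from this[OF b] have "\<bar>foldr X I (\<lambda>y. u y * v y) y - u y * foldr X I v y\<bar> \<le> real (length (L I)) * g"
      by (simp add: eq case_prod_unfold)
    also have "\<dots> \<le> ?c * g"
    proof (cases "L I = []")
      case True
      show ?thesis
      \<comment> \<open>For \<open>m > 0\<close> the pair of empty words shows
        \<open>0 \<le> g\<close>. For \<open>m = 0\<close> no \<open>K\<close> is admissible, so
        \<open>g\<close> may be negative; but then every list is empty and the constant is
        0.\<close>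
      proof (cases "m = 0")
        case m: False
        have "0 \<le> \<bar>foldr X [] u y * foldr X [] v y\<bar>" by simp
        also have "\<dots> \<le> g" using g m by (metis le0 list.size(3) neq0_conv)
        finally show ?thesis using True by (simp add: sum_nonneg)
      next
        case m: True
        have "L I' = []" if "length I' \<le> m" for I'
          using L that m by (cases "L I'") (auto simp: split: prod.splits dest!: spec[of _ I'])
        then have "?c = 0" by (intro sum.neutral) auto
        then show ?thesis using True by simp
      qed
    next
      case False
      then obtain q where "q \<in> set (L I)" by (meson last_in_set)
      then have "0 \<le> g" using b by (meson abs_ge_zero order_trans)
      moreover have "real (length (L I)) \<le> ?c"
        by (rule member_le_sum[of I _ "\<lambda>I. real (length (L I))"]) (use I in auto)
      ultimately show ?thesis by (rule mult_right_mono[rotated])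
    qed
    finally show ?thesis .
  qed
  then show ?thesis by (intro exI[of _ ?c]) (auto intro: sum_nonneg)
qed

text \<open>After Tonelli, the inner integral of \<open>\<bar>\<psi> (- x + y)\<bar> powr p\<close>
  over \<open>x\<close> does not depend on \<open>y\<close>, by left invariance. The reflection in
  the constant remains because the group may fail to be unimodular.\<close>

lemma powint_average:
  assumes \<psi>: "\<psi> \<in> smooth_fun A" and [measurable]: "f \<in> borel_measurable lam"
  shows "(\<integral>\<^sup>+ x. powint lam p (\<lambda>y. ltrans x \<psi> y * f y) \<partial>lam) = powint lam p (\<lambda>x. \<psi> (- x)) * powint lam p f"
proof -
  interpret P: pair_sigma_finite lam lam ..
  have [measurable]: "\<psi> \<in> borel_measurable borel" using smooth_fun_measurable[OF \<psi>] by simp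
  have [measurable]: "f \<in> borel_measurable borel" using assms(2) by simp
  have "(\<integral>\<^sup>+ x. powint lam p (\<lambda>y. ltrans x \<psi> y * f y) \<partial>lam) =
    (\<integral>\<^sup>+ x. \<integral>\<^sup>+ y. ennreal (\<bar>\<psi> (- x + y)\<bar> powr p) * ennreal (\<bar>f y\<bar> powr p) \<partial>lam \<partial>lam)"
    unfolding powint_def ltrans_def by (simp add: abs_mult powr_mult ennreal_mult)
  also have "\<dots> = (\<integral>\<^sup>+ y. \<integral>\<^sup>+ x. ennreal (\<bar>\<psi> (- x + y)\<bar> powr p) * ennreal (\<bar>f y\<bar> powr p) \<partial>lam \<partial>lam)"
    by (rule P.Fubini'[symmetric]) measurable
  also have "\<dots> = (\<integral>\<^sup>+ y. (\<integral>\<^sup>+ x. ennreal (\<bar>\<psi> (- x + y)\<bar> powr p) \<partial>lam) * ennreal (\<bar>f y\<bar> powr p) \<partial>lam)"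
    by (intro nn_integral_cong nn_integral_multc) measurable
  also have "\<dots> = (\<integral>\<^sup>+ y. powint lam p (\<lambda>x. \<psi> (- x)) * ennreal (\<bar>f y\<bar> powr p) \<partial>lam)"
  proof (rule nn_integral_cong)
    fix y
    have "(\<integral>\<^sup>+ x. ennreal (\<bar>\<psi> (- x + y)\<bar> powr p) \<partial>lam) = (\<integral>\<^sup>+ x. ennreal (\<bar>\<psi> (- (y + x) + y)\<bar> powr p) \<partial>lam)"
      by (rule nn_integral_translate[symmetric]) measurable
    also have "\<dots> = powint lam p (\<lambda>x. \<psi> (- x))"
      unfolding powint_def by (simp add: minus_add add.assoc del: add_uminus_conv_diff)
    finally show "(\<integral>\<^sup>+ x. ennreal (\<bar>\<psi> (- x + y)\<bar> powr p) \<partial>lam) * ennreal (\<bar>f y\<bar> powr p) =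
      powint lam p (\<lambda>x. \<psi> (- x)) * ennreal (\<bar>f y\<bar> powr p)" by simp
  qed
  also have "\<dots> = powint lam p (\<lambda>x. \<psi> (- x)) * powint lam p f"
    unfolding powint_def by (rule nn_integral_cmult) measurable
  finally show ?thesis .
qed

lemma powint_reflected_finite:
  assumes "\<psi> \<in> Cc_infty A \<Omega>" shows "powint lam p (\<lambda>x. \<psi> (- x)) < \<infinity>"
proof -
  obtain K where K: "\<psi> \<in> smooth_fun A" "compact K" "\<And>y. y \<notin> K \<Longrightarrow> \<psi> y = 0" using Cc_inftyE[OF assms] by metis
  have "integrable lam (\<lambda>x. \<bar>\<psi> (- x)\<bar> powr p)"
  proof (rule integrable_continuous_compact)
    show "continuous_on UNIV (\<lambda>x. \<bar>\<psi> (- x)\<bar> powr p)"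
      using p_ge_1 by (intro continuous_on_powr' continuous_intros
          continuous_on_compose2[OF smooth_fun_continuous[OF K(1), of UNIV]]) auto
    show "compact (uminus ` K)" by (intro compact_continuous_image K(2) continuous_intros)
    fix x assume "x \<notin> uminus ` K"
    then have "- x \<notin> K" by (metis imageI minus_minus)
    then show "\<bar>\<psi> (- x)\<bar> powr p = 0" using K(3) by simp
  qed
  then show ?thesis unfolding powint_def by (auto simp: integrable_iff_bounded)
qed

end

lemma sum_UNIV_sum:
  fixes f :: "'a::finite + 'b::finite \<Rightarrow> 'c::comm_monoid_add"
  shows "(\<Sum>k\<in>UNIV. f k) = (\<Sum>a\<in>UNIV. f (Inl a)) + (\<Sum>b\<in>UNIV. f (Inr b))"
  by (simp add: UNIV_Plus_UNIV[symmetric] sum.Plus del: UNIV_Plus_UNIV)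

section \<open>Matrix operators: upper bound and local estimate\<close>

locale invariant_principal = haar_finite_fields A lam X p
  for A :: "('g::{topological_group_add, t2_space, second_countable_topology},
               'e::euclidean_space) atlas" and lam
    and X :: "'k::finite \<Rightarrow> ('g \<Rightarrow> real) \<Rightarrow> 'g \<Rightarrow> real" and p :: real +
  fixes m :: nat and a :: "'n::finite \<Rightarrow> 'm::finite \<Rightarrow> 'k list \<Rightarrow> 'g \<Rightarrow> real"
  assumes m_ge_1: "m \<ge> 1"
    and coeff_measurable: "length I \<le> m \<Longrightarrow> a i j I \<in> borel_measurable lam"
    and principal_inv: "left_invariant_op A lam (diff_entry X {I. length I = m} (a i j))"
    and lower_bounded: "length I < m \<Longrightarrow> ess_bounded lam (a i j I)"
begin

abbreviation "P \<equiv> diff_op X {I. length I \<le> m} a"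
abbreviation "Pm \<equiv> diff_op X {I. length I = m} a"
abbreviation "Pl \<equiv> diff_op X {I. length I < m} a"
abbreviation "\<D> \<equiv> Cc_infty_vec A UNIV"

lemma vec_Cc: "\<alpha> \<in> \<D> \<Longrightarrow> \<alpha> i \<in> Cc_infty A UNIV"
  by (simp add: Cc_infty_vec_def)

lemma vec_smooth: "\<alpha> \<in> \<D> \<Longrightarrow> \<alpha> i \<in> smooth_fun A"
  by (rule Cc_infty_smooth[OF vec_Cc])

lemma op_split: "P \<alpha> j y = Pm \<alpha> j y + Pl \<alpha> j y"
proof -
  have "{I :: 'k list. length I \<le> m} = {I. length I = m} \<union> {I. length I < m}" by auto
  then show ?thesis
    by (simp add: diff_op_def diff_entry_def sum.distrib[symmetric])
      (subst sum.union_disjoint, auto)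
qed

lemma op_measurable:
  assumes "\<alpha> \<in> \<D>" shows "P \<alpha> j \<in> borel_measurable lam"
  unfolding diff_op_def diff_entry_def
  by (intro borel_measurable_sum borel_measurable_times coeff_measurable smooth_iter_measurable
      vec_smooth[OF assms]) auto

lemma vec_diff: "\<alpha> \<in> \<D> \<Longrightarrow> \<beta> \<in> \<D> \<Longrightarrow> (\<lambda>i y. \<alpha> i y - \<beta> i y) \<in> \<D>"
  by (auto simp: Cc_infty_vec_def intro: Cc_infty_diff)

lemma op_diff:
  assumes "\<alpha> \<in> \<D>" "\<beta> \<in> \<D>"
  shows "P (\<lambda>i y. \<alpha> i y - \<beta> i y) j y = P \<alpha> j y - P \<beta> j y"
proof -
  have "foldr X I (\<lambda>y. \<alpha> i y - \<beta> i y) = (\<lambda>y. foldr X I (\<alpha> i) y - foldr X I (\<beta> i) y)" for i I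
    by (intro iter_diff vec_smooth assms)
  then show ?thesis
    by (simp add: diff_op_def diff_entry_def right_diff_distrib sum_subtractf)
qed

text \<open>The dominating function \<open>g\<close> is left free, and \<open>B\<close> is fixed
  before it. The bound is later applied with a sum of derivatives, with a quotient by the cut-off,
  and with a translated function.\<close>

lemma lower_order_bound:
  "\<exists>B\<ge>0. \<forall>\<alpha> g. \<forall>j. AE y in lam. (\<forall>i K. length K < m \<longrightarrow> \<bar>foldr X K (\<alpha> i) y\<bar> \<le> g y) \<longrightarrow> \<bar>Pl \<alpha> j y\<bar> \<le> B * g y"
proof -
  have "\<forall>q. \<exists>C. length (snd (snd q)) < m \<longrightarrow> (AE y in lam. \<bar>a (fst q) (fst (snd q)) (snd (snd q)) y\<bar> \<le> C)"
    using lower_bounded unfolding ess_bounded_def by blast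
  from choice[OF this] obtain C where C: "\<forall>q. length (snd (snd q)) < m \<longrightarrow>
    (AE y in lam. \<bar>a (fst q) (fst (snd q)) (snd (snd q)) y\<bar> \<le> C q)" ..
  let ?B = "\<Sum>j\<in>UNIV. \<Sum>i\<in>UNIV. \<Sum>K\<in>{K. length K < m}. \<bar>C (i, j, K)\<bar>"
  have "AE y in lam. (\<forall>i K. length K < m \<longrightarrow> \<bar>foldr X K (\<alpha> i) y\<bar> \<le> g y) \<longrightarrow> \<bar>Pl \<alpha> j y\<bar> \<le> ?B * g y"
    for \<alpha> :: "'n \<Rightarrow> 'g \<Rightarrow> real" and g and j :: 'm
  proof -
    have "AE y in lam. \<forall>i. \<forall>K\<in>{K. length K < m}. \<bar>a i j K y\<bar> \<le> C (i, j, K)"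
    proof (subst AE_all_countable, intro allI, subst AE_ball_countable)
      show "countable {K :: 'k list. length K < m}" by (rule countable_finite) simp
      show "\<forall>K\<in>{K. length K < m}. AE y in lam. \<bar>a i j K y\<bar> \<le> C (i, j, K)" for i
        using C by (auto dest: spec[of _ "(i, j, _)"])
    qed
    then show ?thesis
    proof eventually_elim
      case (elim y)
      show ?case
      proof
        assume g: "\<forall>i K. length K < m \<longrightarrow> \<bar>foldr X K (\<alpha> i) y\<bar> \<le> g y"
        have g0: "0 \<le> g y"
          using spec[OF spec[OF g, of undefined], of "[]"] m_ge_1 by (auto intro: order_trans[OF abs_ge_zero])
        have "\<bar>Pl \<alpha> j y\<bar> \<le> (\<Sum>i\<in>UNIV. \<Sum>K\<in>{K. length K < m}. \<bar>a i j K y * foldr X K (\<alpha> i) y\<bar>)"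
          unfolding diff_op_def diff_entry_def by (intro order_trans[OF sum_abs] sum_mono order_refl)
        also have "\<dots> \<le> (\<Sum>i\<in>UNIV. \<Sum>K\<in>{K. length K < m}. \<bar>C (i, j, K)\<bar> * g y)"
        proof (intro sum_mono)
          fix i and K :: "'k list" assume K: "K \<in> {K. length K < m}"
          have "\<bar>a i j K y\<bar> \<le> \<bar>C (i, j, K)\<bar>" using bspec[OF spec[OF elim, of i] K] by simp
          moreover have "\<bar>foldr X K (\<alpha> i) y\<bar> \<le> g y" using g K by blast
          ultimately show "\<bar>a i j K y * foldr X K (\<alpha> i) y\<bar> \<le> \<bar>C (i, j, K)\<bar> * g y"
            unfolding abs_mult by (intro mult_mono) auto
        qed
        also have "\<dots> = (\<Sum>i\<in>UNIV. \<Sum>K\<in>{K. length K < m}. \<bar>C (i, j, K)\<bar>) * g y"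
          by (simp add: sum_distrib_right)
        also have "\<dots> \<le> ?B * g y"
        proof (rule mult_right_mono[OF _ g0])
          show "(\<Sum>i\<in>UNIV. \<Sum>K\<in>{K. length K < m}. \<bar>C (i, j, K)\<bar>) \<le> ?B"
            by (rule member_le_sum[of j UNIV "\<lambda>j. \<Sum>i\<in>UNIV. \<Sum>K\<in>{K. length K < m}. \<bar>C (i, j, K)\<bar>"])
              (auto intro!: sum_nonneg)
        qed
        finally show "\<bar>Pl \<alpha> j y\<bar> \<le> ?B * g y" .
      qed
    qed
  qed
  moreover have "?B \<ge> 0" by (intro sum_nonneg) simp
  ultimately show ?thesis by blast
qed

lemma principal_frozen:
  "\<exists>N\<ge>0. \<forall>\<alpha>\<in>\<D>. \<forall>\<beta>\<in>\<D>. \<forall>j. \<exists>\<kappa>. (\<forall>i I. \<bar>\<kappa> i I\<bar> \<le> N) \<and>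
    (AE y in lam. Pm \<alpha> j y = (\<Sum>i\<in>UNIV. \<Sum>I\<in>{I. length I = m}. \<kappa> i I * foldr X I (\<alpha> i) y)) \<and>
    (AE y in lam. Pm \<beta> j y = (\<Sum>i\<in>UNIV. \<Sum>I\<in>{I. length I = m}. \<kappa> i I * foldr X I (\<beta> i) y))"
proof -
  let ?E = "\<lambda>i j u \<kappa>. AE y in lam. diff_entry X {I. length I = m} (a i j) u y = (\<Sum>I\<in>{I. length I = m}. \<kappa> I * foldr X I u y)"
  have "\<forall>q. \<exists>N. N \<ge> 0 \<and> (\<forall>u\<in>Cc_infty A UNIV. \<forall>v\<in>Cc_infty A UNIV. \<exists>\<kappa>. (\<forall>I. \<bar>\<kappa> I\<bar> \<le> N) \<and>
    ?E (fst q) (snd q) u \<kappa> \<and> ?E (fst q) (snd q) v \<kappa>)"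
    using frozen_coefficients_bounded[OF coeff_measurable principal_inv] by auto
  from choice[OF this] obtain N where N: "\<forall>q. N q \<ge> 0 \<and> (\<forall>u\<in>Cc_infty A UNIV. \<forall>v\<in>Cc_infty A UNIV.
    \<exists>\<kappa>. (\<forall>I. \<bar>\<kappa> I\<bar> \<le> N q) \<and> ?E (fst q) (snd q) u \<kappa> \<and> ?E (fst q) (snd q) v \<kappa>)" ..
  let ?N = "\<Sum>q\<in>UNIV. N q"
  have NN: "N q \<le> ?N" for q by (rule member_le_sum) (use N in auto)
  have "\<exists>\<kappa>. (\<forall>i I. \<bar>\<kappa> i I\<bar> \<le> ?N) \<and>
    (AE y in lam. Pm \<alpha> j y = (\<Sum>i\<in>UNIV. \<Sum>I\<in>{I. length I = m}. \<kappa> i I * foldr X I (\<alpha> i) y)) \<and>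
    (AE y in lam. Pm \<beta> j y = (\<Sum>i\<in>UNIV. \<Sum>I\<in>{I. length I = m}. \<kappa> i I * foldr X I (\<beta> i) y))"
    if \<alpha>: "\<alpha> \<in> \<D>" and \<beta>: "\<beta> \<in> \<D>" for \<alpha> \<beta> j
  proof -
    have "\<forall>i. \<exists>\<kappa>. (\<forall>I. \<bar>\<kappa> I\<bar> \<le> N (i, j)) \<and> ?E i j (\<alpha> i) \<kappa> \<and> ?E i j (\<beta> i) \<kappa>"
    proof
      fix i
      from spec[OF N, of "(i, j)"] show "\<exists>\<kappa>. (\<forall>I. \<bar>\<kappa> I\<bar> \<le> N (i, j)) \<and> ?E i j (\<alpha> i) \<kappa> \<and> ?E i j (\<beta> i) \<kappa>"
        using vec_Cc[OF \<alpha>, of i] vec_Cc[OF \<beta>, of i] by simp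
    qed
    from choice[OF this] obtain \<kappa> where \<kappa>: "\<forall>i. (\<forall>I. \<bar>\<kappa> i I\<bar> \<le> N (i, j)) \<and> ?E i j (\<alpha> i) (\<kappa> i) \<and> ?E i j (\<beta> i) (\<kappa> i)" ..
    have sum: "AE y in lam. Pm \<gamma> j y = (\<Sum>i\<in>UNIV. \<Sum>I\<in>{I. length I = m}. \<kappa> i I * foldr X I (\<gamma> i) y)"
      if "\<forall>i. ?E i j (\<gamma> i) (\<kappa> i)" for \<gamma>
    proof -
      have "AE y in lam. \<forall>i. diff_entry X {I. length I = m} (a i j) (\<gamma> i) y = (\<Sum>I\<in>{I. length I = m}. \<kappa> i I * foldr X I (\<gamma> i) y)"
        using that by (simp add: AE_all_countable)
      then show ?thesis by eventually_elim (simp add: diff_op_def)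
    qed
    show ?thesis
    proof (intro exI[of _ \<kappa>] conjI allI)
      show "\<bar>\<kappa> i I\<bar> \<le> ?N" for i I using \<kappa> NN[of "(i, j)"] by (meson order_trans)
    qed (use \<kappa> in \<open>intro sum, blast\<close>)+
  qed
  moreover have "?N \<ge> 0" using N by (intro sum_nonneg) blast
  ultimately show ?thesis by blast
qed

lemma operator_bound:
  "\<exists>C\<ge>0. \<forall>\<alpha>\<in>\<D>. \<forall>j. powint lam p (P \<alpha> j) \<le>
    ennreal C * (\<Sum>(i, I)\<in>UNIV \<times> {I. length I \<le> m}. powint lam p (foldr X I (\<alpha> i)))"
proof -
  obtain N where N: "N \<ge> 0" "\<forall>\<alpha>\<in>\<D>. \<forall>\<beta>\<in>\<D>. \<forall>j. \<exists>\<kappa>. (\<forall>i I. \<bar>\<kappa> i I\<bar> \<le> N) \<and>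
    (AE y in lam. Pm \<alpha> j y = (\<Sum>i\<in>UNIV. \<Sum>I\<in>{I. length I = m}. \<kappa> i I * foldr X I (\<alpha> i) y)) \<and>
    (AE y in lam. Pm \<beta> j y = (\<Sum>i\<in>UNIV. \<Sum>I\<in>{I. length I = m}. \<kappa> i I * foldr X I (\<beta> i) y))"
    using principal_frozen by blast
  obtain B where B: "B \<ge> 0" "\<forall>\<alpha> g. \<forall>j. AE y in lam.
    (\<forall>i K. length K < m \<longrightarrow> \<bar>foldr X K (\<alpha> i) y\<bar> \<le> g y) \<longrightarrow> \<bar>Pl \<alpha> j y\<bar> \<le> B * g y"
    using lower_order_bound by blast
  let ?Ix = "UNIV \<times> {I :: 'k list. length I \<le> m} :: ('n \<times> 'k list) set"
  let ?n = "real CARD('n) * real (card {I :: 'k list. length I = m})"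
  let ?c = "?n * N + B"
  have "powint lam p (P \<alpha> j) \<le> ennreal ((?c * real (card ?Ix)) powr p) *
    (\<Sum>k\<in>?Ix. powint lam p (foldr X (snd k) (\<alpha> (fst k))))" if \<alpha>: "\<alpha> \<in> \<D>" for \<alpha> j
  proof (rule powint_le_sum)
    let ?G = "\<lambda>y. \<Sum>k\<in>?Ix. \<bar>foldr X (snd k) (\<alpha> (fst k)) y\<bar>"
    have G: "\<bar>foldr X I (\<alpha> i) y\<bar> \<le> ?G y" if "length I \<le> m" for i I y
      using member_le_sum[of "(i, I)" ?Ix "\<lambda>k. \<bar>foldr X (snd k) (\<alpha> (fst k)) y\<bar>"] that by simp
    obtain \<kappa> where \<kappa>: "\<forall>i I. \<bar>\<kappa> i I\<bar> \<le> N"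
      "AE y in lam. Pm \<alpha> j y = (\<Sum>i\<in>UNIV. \<Sum>I\<in>{I. length I = m}. \<kappa> i I * foldr X I (\<alpha> i) y)"
      using spec[OF bspec[OF bspec[OF N(2) \<alpha>] \<alpha>], of j] by blast
    show "AE y in lam. \<bar>P \<alpha> j y\<bar> \<le> ?c * ?G y"
      using \<kappa>(2) spec[OF spec[OF spec[OF B(2), of \<alpha>], of ?G], of j]
    proof eventually_elim
      case (elim y)
      have "\<bar>Pm \<alpha> j y\<bar> \<le> (\<Sum>i\<in>UNIV. \<Sum>I\<in>{I. length I = m}. \<bar>\<kappa> i I * foldr X I (\<alpha> i) y\<bar>)"
        unfolding elim(1) by (intro order_trans[OF sum_abs] sum_mono order_refl)
      also have "\<dots> \<le> (\<Sum>i\<in>(UNIV :: 'n set). \<Sum>I\<in>{I :: 'k list. length I = m}. N * ?G y)"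
        unfolding abs_mult using \<kappa>(1) G N(1) by (intro sum_mono mult_mono) auto
      also have "\<dots> = ?n * N * ?G y" by simp
      finally have "\<bar>Pm \<alpha> j y\<bar> \<le> ?n * N * ?G y" .
      moreover have "\<bar>Pl \<alpha> j y\<bar> \<le> B * ?G y"
        by (rule mp[OF elim(2)]) (intro allI impI G less_imp_le)
      ultimately show ?case unfolding op_split by (simp only: distrib_right)
    qed
    show "foldr X (snd k) (\<alpha> (fst k)) \<in> borel_measurable lam" for k
      by (intro smooth_iter_measurable vec_smooth[OF \<alpha>])
  qed (use p_ge_1 N(1) B(1) in auto)
  then show ?thesis
    by (intro exI[of _ "(?c * real (card ?Ix)) powr p"]) (auto simp: case_prod_unfold)
qed

lemma local_estimate:
  assumes mh: "maximal_hypoelliptic A lam X m p \<Omega> P"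
  shows "\<exists>C\<ge>0. \<forall>\<alpha>\<in>Cc_infty_vec A \<Omega>. \<forall>i I. length I \<le> m \<longrightarrow> powint lam p (foldr X I (\<alpha> i)) \<le>
    ennreal C * ((\<Sum>j\<in>UNIV. powint lam p (P \<alpha> j)) + (\<Sum>i\<in>UNIV. powint lam p (\<alpha> i)))"
proof -
  obtain C where C: "C > 0" "\<forall>\<alpha>\<in>Cc_infty_vec A \<Omega>. (\<Sum>l\<le>m. seminorm_X_vec lam X l p \<alpha>)
          \<le> ennreal C * (Lp_norm_vec lam p (P \<alpha>) + Lp_norm_vec lam p \<alpha>)"
    using mh unfolding maximal_hypoelliptic_def by blast
  let ?F = "UNIV :: ('m + 'n) set"
  have "powint lam p (foldr X I (\<alpha> i)) \<le> ennreal ((1 + C * real (card ?F)) powr p) *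
    ((\<Sum>j\<in>UNIV. powint lam p (P \<alpha> j)) + (\<Sum>i\<in>UNIV. powint lam p (\<alpha> i)))"
    if \<alpha>: "\<alpha> \<in> Cc_infty_vec A \<Omega>" and I: "length I \<le> m" for \<alpha> i I
  proof -
    have \<alpha>D: "\<alpha> \<in> \<D>" using \<alpha> Cc_infty_mono[of _ \<Omega> UNIV] by (auto simp: Cc_infty_vec_def)
    let ?h = "\<lambda>k. case k of Inl j \<Rightarrow> P \<alpha> j | Inr i \<Rightarrow> \<alpha> i"
    have "Lp_norm lam p (foldr X I (\<alpha> i)) \<le> seminorm_X lam X (length I) p (\<alpha> i)"
      unfolding seminorm_X_def by (rule member_le_sum[of I _ "\<lambda>I. Lp_norm lam p (foldr X I (\<alpha> i))"]) auto
    also have "\<dots> \<le> seminorm_X_vec lam X (length I) p \<alpha>"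
      unfolding seminorm_X_vec_def by (rule member_le_sum[of i _ "\<lambda>i. seminorm_X lam X (length I) p (\<alpha> i)"]) auto
    also have "\<dots> \<le> (\<Sum>l\<le>m. seminorm_X_vec lam X l p \<alpha>)"
      by (rule member_le_sum[of "length I" _ "\<lambda>l. seminorm_X_vec lam X l p \<alpha>"]) (use I in auto)
    also have "\<dots> \<le> ennreal C * (Lp_norm_vec lam p (P \<alpha>) + Lp_norm_vec lam p \<alpha>)" using C(2) \<alpha> by blast
    also have "Lp_norm_vec lam p (P \<alpha>) + Lp_norm_vec lam p \<alpha> = (\<Sum>k\<in>?F. Lp_norm lam p (?h k))"
      by (simp add: Lp_norm_vec_def sum_UNIV_sum)
    finally have "powint lam p (foldr X I (\<alpha> i)) \<le> ennreal ((1 + C * real (card ?F)) powr p) * (\<Sum>k\<in>?F. powint lam p (?h k))"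
      using C(1) p_ge_1 op_measurable[OF \<alpha>D] smooth_fun_measurable[OF vec_smooth[OF \<alpha>D]]
      by (intro Lp_norm_sum_transfer smooth_iter_measurable vec_smooth[OF \<alpha>D]) (auto split: sum.split)
    then show ?thesis by (simp add: sum_UNIV_sum)
  qed
  then show ?thesis by (intro exI[of _ "(1 + C * real (card ?F)) powr p"]) auto
qed

end

section \<open>Localization by translated cut-off functions\<close>

context invariant_principal
begin

text \<open>The quantities that remain on the right after cutting off with the translated bump.
  Order \<open>m\<close> occurs only through \<open>P \<alpha>\<close>; all explicit derivatives
  will have order less than \<open>m\<close>. Each function is a translate by \<open>x\<close> times
  a factor independent of \<open>x\<close>, the shape that \<open>powint_average\<close> integrates
  over \<open>x\<close>.\<close>

definition localized :: "('g \<Rightarrow> real) \<Rightarrow> 'g \<Rightarrow> ('n \<Rightarrow> 'g \<Rightarrow> real) \<Rightarrow> 'm + 'n \<times> 'k list \<times> 'k list \<Rightarrow> 'g \<Rightarrow> real" where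
  "localized \<phi> x \<alpha> k = (case k of Inl j \<Rightarrow> \<lambda>y. ltrans x \<phi> y * P \<alpha> j y
    | Inr (i, J, K) \<Rightarrow> \<lambda>y. ltrans x (foldr X J \<phi>) y * foldr X K (\<alpha> i) y)"

definition loc_index :: "('m + 'n \<times> 'k list \<times> 'k list) set" where
  "loc_index = UNIV <+> (UNIV \<times> {J. length J \<le> m} \<times> {K. length K < m})"

lemma finite_loc_index [simp]: "finite loc_index"
  by (simp add: loc_index_def)

lemma localized_measurable:
  assumes "\<phi> \<in> smooth_fun A" "\<alpha> \<in> \<D>" shows "localized \<phi> x \<alpha> k \<in> borel_measurable lam"
  unfolding localized_def
  by (auto split: sum.split prod.split intro!: borel_measurable_times op_measurable assms smooth_iter_measurable
      smooth_fun_measurable[OF smooth_fun_ltrans] iter_smooth vec_smooth[OF assms(2)])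

text \<open>The vector \<open>\<beta>\<close>, which is \<open>\<alpha>\<close> times the translated
  bump, is supported in the translate of \<open>\<Omega>\<close> by \<open>x\<close>. Moving it back
  gives \<open>\<gamma>\<close>, supported in \<open>\<Omega>\<close>, where maximal hypoellipticity
  applies. Left translations commute with the fields and preserve \<open>powint\<close>, so the
  constant does not depend on \<open>x\<close>.\<close>

lemma localized_estimate:
  assumes mh: "maximal_hypoelliptic A lam X m p \<Omega> P" and \<phi>: "\<phi> \<in> Cc_infty A \<Omega>"
  shows "\<exists>C\<ge>0. \<forall>x. \<forall>\<alpha>\<in>\<D>. \<forall>i I. length I \<le> m \<longrightarrow>
    powint lam p (\<lambda>y. ltrans x \<phi> y * foldr X I (\<alpha> i) y) \<le> ennreal C * (\<Sum>k\<in>loc_index. powint lam p (localized \<phi> x \<alpha> k))"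
proof -
  obtain c where c: "c \<ge> 0" "\<forall>I. length I \<le> m \<longrightarrow> (\<forall>u\<in>smooth_fun A. \<forall>v\<in>smooth_fun A. \<forall>y. \<forall>g.
    (\<forall>J K. length J \<le> m \<longrightarrow> length K < m \<longrightarrow> \<bar>foldr X J u y * foldr X K v y\<bar> \<le> g) \<longrightarrow>
    \<bar>foldr X I (\<lambda>y. u y * v y) y - u y * foldr X I v y\<bar> \<le> c * g)"
    using leibniz_bound[of m] by blast
  obtain N where N: "N \<ge> 0" "\<forall>\<alpha>\<in>\<D>. \<forall>\<beta>\<in>\<D>. \<forall>j. \<exists>\<kappa>. (\<forall>i I. \<bar>\<kappa> i I\<bar> \<le> N) \<and>
    (AE y in lam. Pm \<alpha> j y = (\<Sum>i\<in>UNIV. \<Sum>I\<in>{I. length I = m}. \<kappa> i I * foldr X I (\<alpha> i) y)) \<and>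
    (AE y in lam. Pm \<beta> j y = (\<Sum>i\<in>UNIV. \<Sum>I\<in>{I. length I = m}. \<kappa> i I * foldr X I (\<beta> i) y))"
    using principal_frozen by blast
  obtain B where B: "B \<ge> 0" "\<forall>\<alpha> g. \<forall>j. AE y in lam.
    (\<forall>i K. length K < m \<longrightarrow> \<bar>foldr X K (\<alpha> i) y\<bar> \<le> g y) \<longrightarrow> \<bar>Pl \<alpha> j y\<bar> \<le> B * g y"
    using lower_order_bound by blast
  obtain C where C: "C \<ge> 0" "\<forall>\<alpha>\<in>Cc_infty_vec A \<Omega>. \<forall>i I. length I \<le> m \<longrightarrow> powint lam p (foldr X I (\<alpha> i)) \<le>
    ennreal C * ((\<Sum>j\<in>UNIV. powint lam p (P \<alpha> j)) + (\<Sum>i\<in>UNIV. powint lam p (\<alpha> i)))"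
    using local_estimate[OF mh] by blast
  note \<phi>s = Cc_infty_smooth[OF \<phi>]
  let ?n = "real CARD('n) * real (card {I :: 'k list. length I = m})"
  \<comment> \<open>The constant for \<open>Pm \<beta>\<close>: its summands come from the
    commutator of \<open>Pm\<close> with the cut-off, from the cut-off times
    \<open>P \<alpha>\<close>, and from the cut-off times \<open>Pl \<alpha>\<close>. In
    \<open>c3\<close> the lower order part of \<open>P \<gamma>\<close> is added, and
    \<open>q1\<close>, \<open>q2\<close>, \<open>q3\<close> are the corresponding constants for
    \<open>p\<close>-th powers.\<close>
  define c2 where "c2 = ?n * (N * c) + 1 + B"
  define c3 where "c3 = c2 + B * (1 + c)"
  let ?d = "real (card loc_index)"
  define q1 where "q1 = (c3 * ?d) powr p"
  define q2 where "q2 = ((1 + c) * ?d) powr p"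
  define q3 where "q3 = (c * ?d) powr p"
  define C' where "C' = 2 powr p * (C * (real CARD('m) * q1 + real CARD('n) * q2) + q3)"
  have nonneg: "c2 \<ge> 0" "c3 \<ge> 0" "q1 \<ge> 0" "q2 \<ge> 0" "q3 \<ge> 0"
    using c(1) N(1) B(1) by (auto simp: c2_def c3_def q1_def q2_def q3_def)
  have "powint lam p (\<lambda>y. ltrans x \<phi> y * foldr X I (\<alpha> i) y) \<le> ennreal C' * (\<Sum>k\<in>loc_index. powint lam p (localized \<phi> x \<alpha> k))"
    if \<alpha>: "\<alpha> \<in> \<D>" and I: "length I \<le> m" for x \<alpha> i I
  proof -
    let ?f = "ltrans x \<phi>" and ?F = "localized \<phi> x \<alpha>"
    let ?S = "\<Sum>k\<in>loc_index. powint lam p (?F k)"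
    define G where "G y = (\<Sum>k\<in>loc_index. \<bar>?F k y\<bar>)" for y
    define \<beta> where "\<beta> i = (\<lambda>y. ?f y * \<alpha> i y)" for i
    define \<gamma> where "\<gamma> i = ltrans (- x) (\<beta> i)" for i
    have fs: "?f \<in> smooth_fun A" by (rule smooth_fun_ltrans[OF \<phi>s])
    have Fm: "?F k \<in> borel_measurable lam" for k by (rule localized_measurable[OF \<phi>s \<alpha>])
    have FG: "\<bar>?F k y\<bar> \<le> G y" if "k \<in> loc_index" for k y
      unfolding G_def by (rule member_le_sum[OF that]) auto
    have G0: "G y \<ge> 0" for y unfolding G_def by (rule sum_nonneg) simp
    have low: "\<bar>foldr X J ?f y * foldr X K (\<alpha> i) y\<bar> \<le> G y" if "length J \<le> m" "length K < m" for J K i y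
    proof -
      have "Inr (i, J, K) \<in> loc_index" using that by (auto simp: loc_index_def)
      from FG[OF this, of y] show ?thesis by (simp add: localized_def iter_ltrans[OF \<phi>s])
    qed
    have PG: "\<bar>?f y * P \<alpha> j y\<bar> \<le> G y" for j y
    proof -
      have "Inl j \<in> loc_index" by (auto simp: loc_index_def)
      from FG[OF this, of y] show ?thesis by (simp add: localized_def)
    qed
    have \<beta>\<Omega>: "\<beta> i \<in> Cc_infty A ((\<lambda>y. x + y) ` \<Omega>)" for i
      unfolding \<beta>_def by (rule Cc_infty_mult[OF Cc_infty_ltrans[OF \<phi>] vec_smooth[OF \<alpha>]])
    have \<beta>: "\<beta> \<in> \<D>" using Cc_infty_mono[OF \<beta>\<Omega> subset_UNIV] by (simp add: Cc_infty_vec_def)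
    have \<gamma>: "\<gamma> \<in> Cc_infty_vec A \<Omega>"
    proof -
      have "(\<lambda>y. - x + y) ` (\<lambda>y. x + y) ` \<Omega> = \<Omega>" by (simp add: image_image add.assoc[symmetric])
      then show ?thesis using Cc_infty_ltrans[OF \<beta>\<Omega>, of "- x"] by (simp add: Cc_infty_vec_def \<gamma>_def)
    qed
    have X\<gamma>: "foldr X I (\<gamma> i) = ltrans (- x) (foldr X I (\<beta> i))" for I i
      unfolding \<gamma>_def by (rule iter_ltrans[OF vec_smooth[OF \<beta>]])
    have leib: "\<bar>foldr X I (\<beta> i) y - ?f y * foldr X I (\<alpha> i) y\<bar> \<le> c * G y" if "length I \<le> m" for I i y
      using c(2) that fs vec_smooth[OF \<alpha>, of i] low[of _ _ y i] unfolding \<beta>_def by blast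
    have lowX: "\<bar>foldr X K (\<beta> i) y\<bar> \<le> (1 + c) * G y" if "length K < m" for K i y
      using leib[of K i y] low[of "[]" K y i] that by (simp add: distrib_right)
    have Pm\<beta>: "AE y in lam. \<bar>Pm \<beta> j y\<bar> \<le> c2 * G y" for j
    proof -
      obtain \<kappa> where \<kappa>: "\<forall>i I. \<bar>\<kappa> i I\<bar> \<le> N"
        "AE y in lam. Pm \<alpha> j y = (\<Sum>i\<in>UNIV. \<Sum>I\<in>{I. length I = m}. \<kappa> i I * foldr X I (\<alpha> i) y)"
        "AE y in lam. Pm \<beta> j y = (\<Sum>i\<in>UNIV. \<Sum>I\<in>{I. length I = m}. \<kappa> i I * foldr X I (\<beta> i) y)"
        using spec[OF bspec[OF bspec[OF N(2) \<alpha>] \<beta>], of j] by blast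
      show ?thesis
        using \<kappa>(2,3) spec[OF spec[OF spec[OF B(2), of \<alpha>], of "\<lambda>y. G y / \<bar>?f y\<bar>"], of j]
      proof eventually_elim
        case (elim y)
        have "Pm \<beta> j y - ?f y * Pm \<alpha> j y =
          (\<Sum>i\<in>UNIV. \<Sum>I\<in>{I. length I = m}. \<kappa> i I * (foldr X I (\<beta> i) y - ?f y * foldr X I (\<alpha> i) y))"
          unfolding elim(1,2) by (simp add: sum_distrib_left sum_subtractf[symmetric] algebra_simps)
        also have "\<bar>\<dots>\<bar> \<le> (\<Sum>i\<in>UNIV. \<Sum>I\<in>{I. length I = m}. \<bar>\<kappa> i I * (foldr X I (\<beta> i) y - ?f y * foldr X I (\<alpha> i) y)\<bar>)"
          by (intro order_trans[OF sum_abs] sum_mono order_refl)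
        also have "\<dots> \<le> (\<Sum>i\<in>(UNIV :: 'n set). \<Sum>I\<in>{I :: 'k list. length I = m}. N * (c * G y))"
          unfolding abs_mult using \<kappa>(1) leib N(1) by (intro sum_mono mult_mono) auto
        also have "\<dots> = ?n * (N * c) * G y" by simp
        finally have 1: "\<bar>Pm \<beta> j y - ?f y * Pm \<alpha> j y\<bar> \<le> ?n * (N * c) * G y" .
        \<comment> \<open>\<open>G\<close> dominates derivatives of \<open>\<alpha>\<close> only
          after multiplication by the cut-off, so \<open>lower_order_bound\<close> was invoked with
          \<open>G\<close> divided by the cut-off. Multiplying back gives the claim where the
          cut-off is nonzero, and elsewhere the left-hand side vanishes.\<close>
        have 2: "\<bar>?f y * Pl \<alpha> j y\<bar> \<le> B * G y"
        proof (cases "?f y = 0")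
          case False
          have "\<bar>foldr X K (\<alpha> i) y\<bar> \<le> G y / \<bar>?f y\<bar>" if "length K < m" for i K
            using low[of "[]" K y i] that False by (simp add: abs_mult field_simps)
          then have "\<bar>Pl \<alpha> j y\<bar> \<le> B * (G y / \<bar>?f y\<bar>)" using elim(3) by blast
          then show ?thesis using False by (simp add: abs_mult field_simps)
        qed (use B(1) G0 in simp)
        have "Pm \<beta> j y = (Pm \<beta> j y - ?f y * Pm \<alpha> j y) + (?f y * P \<alpha> j y - ?f y * Pl \<alpha> j y)"
          by (simp add: op_split algebra_simps)
        then have "\<bar>Pm \<beta> j y\<bar> \<le> ?n * (N * c) * G y + (G y + B * G y)"
          using 1 2 PG[of y j] by linarith
        then show ?case by (simp add: c2_def algebra_simps)
      qed
    qed
    have P\<gamma>: "AE y in lam. \<bar>P \<gamma> j y\<bar> \<le> c3 * G (x + y)" for j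
    proof -
      \<comment> \<open>Only the principal part can be moved along with the translation. The lower
        order part acts on \<open>\<gamma>\<close> with its own coefficients at the new place, and
        is bounded there through the lower derivatives of \<open>\<beta>\<close>.\<close>
      have "AE y in lam. diff_entry X {I. length I = m} (a i j) (\<gamma> i) y = ltrans (- x) (diff_entry X {I. length I = m} (a i j) (\<beta> i)) y" for i
        using principal_inv[of i j] vec_Cc[OF \<beta>, of i] unfolding left_invariant_op_def \<gamma>_def by blast
      then have "AE y in lam. \<forall>i. diff_entry X {I. length I = m} (a i j) (\<gamma> i) y = ltrans (- x) (diff_entry X {I. length I = m} (a i j) (\<beta> i)) y"
        by (simp add: AE_all_countable)
      then have eq: "AE y in lam. Pm \<gamma> j y = Pm \<beta> j (x + y)"
        by eventually_elim (simp add: diff_op_def ltrans_def)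
      show ?thesis
        using eq AE_translate[OF Pm\<beta>, of j x] spec[OF spec[OF spec[OF B(2), of \<gamma>], of "\<lambda>y. (1 + c) * G (x + y)"], of j]
      proof eventually_elim
        case (elim y)
        have "\<bar>Pl \<gamma> j y\<bar> \<le> B * ((1 + c) * G (x + y))"
          by (rule mp[OF elim(3)]) (auto simp: X\<gamma> ltrans_def lowX)
        then have "\<bar>P \<gamma> j y\<bar> \<le> c2 * G (x + y) + B * ((1 + c) * G (x + y))"
          using elim(1,2) unfolding op_split by linarith
        then show ?case by (simp add: c3_def algebra_simps)
      qed
    qed
    have e1: "powint lam p (P \<gamma> j) \<le> ennreal q1 * ?S" for j
    proof -
      have "powint lam p (P \<gamma> j) \<le> ennreal q1 * (\<Sum>k\<in>loc_index. powint lam p (ltrans (- x) (?F k)))"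
        unfolding q1_def
      proof (rule powint_le_sum)
        show "AE y in lam. \<bar>P \<gamma> j y\<bar> \<le> c3 * (\<Sum>k\<in>loc_index. \<bar>ltrans (- x) (?F k) y\<bar>)"
          using P\<gamma>[of j] by (simp add: G_def ltrans_def)
        show "ltrans (- x) (?F k) \<in> borel_measurable lam" for k
          unfolding ltrans_def using Fm[of k] by measurable
      qed (use p_ge_1 nonneg in auto)
      then show ?thesis using powint_ltrans[OF Fm] by simp
    qed
    have e2: "powint lam p (\<gamma> i) \<le> ennreal q2 * ?S" for i
    proof -
      have "powint lam p (\<gamma> i) = powint lam p (\<beta> i)"
        unfolding \<gamma>_def by (rule powint_ltrans[OF smooth_fun_measurable[OF vec_smooth[OF \<beta>]]])
      also have "\<dots> \<le> ennreal q2 * ?S"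
        unfolding q2_def
        by (rule powint_le_sum) (use p_ge_1 c(1) m_ge_1 Fm lowX[of "[]" i] in \<open>auto simp: G_def\<close>)
      finally show ?thesis .
    qed
    have e3: "powint lam p (foldr X I (\<beta> i)) \<le> ennreal (C * (real CARD('m) * q1 + real CARD('n) * q2)) * ?S"
    proof -
      have "powint lam p (foldr X I (\<beta> i)) = powint lam p (foldr X I (\<gamma> i))"
        unfolding X\<gamma> by (rule powint_ltrans[symmetric, OF smooth_iter_measurable[OF vec_smooth[OF \<beta>]]])
      also have "\<dots> \<le> ennreal C * ((\<Sum>j\<in>UNIV. powint lam p (P \<gamma> j)) + (\<Sum>i\<in>UNIV. powint lam p (\<gamma> i)))"
        using C(2) \<gamma> I by blast
      also have "\<dots> \<le> ennreal C * ((\<Sum>j\<in>(UNIV :: 'm set). ennreal q1 * ?S) + (\<Sum>i\<in>(UNIV :: 'n set). ennreal q2 * ?S))"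
        by (intro mult_left_mono add_mono sum_mono e1 e2) auto
      also have "\<dots> = ennreal C * (ennreal (real CARD('m) * q1 + real CARD('n) * q2) * ?S)"
        using nonneg by (simp add: ennreal_mult ennreal_plus distrib_right mult.assoc ennreal_of_nat_eq_real_of_nat)
      also have "\<dots> = ennreal (C * (real CARD('m) * q1 + real CARD('n) * q2)) * ?S"
        using C(1) nonneg by (simp add: ennreal_mult mult.assoc)
      finally show ?thesis .
    qed
    have Gm: "G \<in> borel_measurable lam" unfolding G_def by (intro borel_measurable_sum borel_measurable_abs Fm)
    have "powint lam p (\<lambda>y. ?f y * foldr X I (\<alpha> i) y) \<le> ennreal (2 powr p) * (powint lam p (foldr X I (\<beta> i)) + powint lam p (\<lambda>y. c * G y))"
    proof (rule powint_le_add)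
      show "AE y in lam. \<bar>?f y * foldr X I (\<alpha> i) y\<bar> \<le> \<bar>foldr X I (\<beta> i) y\<bar> + \<bar>c * G y\<bar>"
      proof (rule AE_I2)
        fix y
        show "\<bar>?f y * foldr X I (\<alpha> i) y\<bar> \<le> \<bar>foldr X I (\<beta> i) y\<bar> + \<bar>c * G y\<bar>"
          using leib[OF I, of i y] by linarith
      qed
    qed (use p_ge_1 Gm smooth_iter_measurable[OF vec_smooth[OF \<beta>]] in auto)
    also have "\<dots> \<le> ennreal (2 powr p) * (ennreal (C * (real CARD('m) * q1 + real CARD('n) * q2)) * ?S + ennreal q3 * ?S)"
    proof (intro mult_left_mono add_mono e3)
      show "powint lam p (\<lambda>y. c * G y) \<le> ennreal q3 * ?S"
        unfolding q3_def
        by (rule powint_le_sum) (use p_ge_1 c(1) G0 Fm in \<open>auto simp: G_def abs_mult\<close>)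
    qed simp
    also have "\<dots> = ennreal C' * ?S"
      using C(1) nonneg by (simp add: C'_def ennreal_mult ennreal_plus distrib_right mult.assoc)
    finally show ?thesis .
  qed
  moreover have "C' \<ge> 0" using C(1) nonneg by (simp add: C'_def)
  ultimately show ?thesis by blast
qed

lemma powint_average_measurable:
  assumes \<psi>: "\<psi> \<in> smooth_fun A" and "f \<in> borel_measurable lam"
  shows "(\<lambda>x. powint lam p (\<lambda>y. ltrans x \<psi> y * f y)) \<in> borel_measurable lam"
proof -
  have [measurable]: "\<psi> \<in> borel_measurable borel" using smooth_fun_measurable[OF \<psi>] by simp
  have [measurable]: "f \<in> borel_measurable borel" using assms(2) by simp
  show ?thesis unfolding powint_def ltrans_def by measurable
qed

text \<open>Integration over \<open>x\<close> replaces every factor involving the bump by a number,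
  \<open>r []\<close> on the left and \<open>r J\<close> on the right. The translate
  \<open>x\<close> disappears, and what is left concerns \<open>\<alpha>\<close> on the whole
  group.\<close>

lemma averaged_estimate:
  assumes mh: "maximal_hypoelliptic A lam X m p \<Omega> P" and \<Omega>: "open \<Omega>" "\<Omega> \<noteq> {}"
  shows "\<exists>C\<ge>0. \<forall>\<alpha>\<in>\<D>. \<forall>i I. length I \<le> m \<longrightarrow> powint lam p (foldr X I (\<alpha> i)) \<le>
    ennreal C * ((\<Sum>j\<in>UNIV. powint lam p (P \<alpha> j)) + (\<Sum>i\<in>UNIV. \<Sum>K\<in>{K. length K < m}. powint lam p (foldr X K (\<alpha> i))))"
proof -
  obtain w where "w \<in> \<Omega>" using \<Omega>(2) by blast
  obtain \<phi> V where \<phi>: "\<phi> \<in> Cc_infty A \<Omega>" and V: "open V" "w \<in> V" "\<forall>x\<in>V. \<phi> x = 1"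
    using exists_bump[OF \<Omega>(1) \<open>w \<in> \<Omega>\<close>] by metis
  note \<phi>s = Cc_infty_smooth[OF \<phi>]
  define \<kappa> where "\<kappa> J = powint lam p (\<lambda>x. foldr X J \<phi> (- x))" for J
  have \<kappa>fin: "\<kappa> J < \<infinity>" for J unfolding \<kappa>_def by (rule powint_reflected_finite[OF iter_Cc_infty[OF \<phi>]])
  define r where "r J = enn2real (\<kappa> J)" for J
  have \<kappa>r: "\<kappa> J = ennreal (r J)" "r J \<ge> 0" for J using \<kappa>fin[of J] by (simp_all add: r_def)
  \<comment> \<open>The bump is 1 on a nonempty open set, whose reflection is open and so has
    positive measure. The left-hand factor can therefore be divided out at the end.\<close>
  have "\<kappa> [] \<noteq> 0"
  proof
    assume "\<kappa> [] = 0"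
    then have 0: "AE x in lam. ennreal (\<bar>\<phi> (- x)\<bar> powr p) = 0"
      unfolding \<kappa>_def powint_def
    proof (subst (asm) nn_integral_0_iff_AE)
      have [measurable]: "\<phi> \<in> borel_measurable borel" using smooth_fun_measurable[OF \<phi>s] by simp
      show "(\<lambda>x. ennreal (\<bar>foldr X [] \<phi> (- x)\<bar> powr p)) \<in> borel_measurable lam" by simp
    qed simp
    have o: "open {x. - x \<in> V}"
      using open_vimage[OF V(1), of uminus] by (simp add: vimage_def continuous_on_minus)
    have "AE x in lam. x \<notin> {x. - x \<in> V}"
      using 0 by eventually_elim (use V(3) in auto)
    then have "{x. - x \<in> V} = {}" by (rule open_AE_notin[OF o])
    then show False using V(2) by (auto dest: spec[of _ "- w"] simp: set_eq_iff)
  qed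
  then have r0: "r [] > 0" using \<kappa>r[of "[]"] by (auto simp: less_le)
  obtain C where C: "C \<ge> 0" "\<forall>x. \<forall>\<alpha>\<in>\<D>. \<forall>i I. length I \<le> m \<longrightarrow>
    powint lam p (\<lambda>y. ltrans x \<phi> y * foldr X I (\<alpha> i) y) \<le> ennreal C * (\<Sum>k\<in>loc_index. powint lam p (localized \<phi> x \<alpha> k))"
    using localized_estimate[OF mh \<phi>] by blast
  let ?R = "\<Sum>J\<in>{J. length J \<le> m}. r J"
  have R0: "?R \<ge> 0" by (intro sum_nonneg) (rule \<kappa>r)
  define C' where "C' = C * ?R / r []"
  have rR: "r [] \<le> ?R"
    by (rule member_le_sum) (use \<kappa>r in auto)
  have "powint lam p (foldr X I (\<alpha> i)) \<le>
    ennreal C' * ((\<Sum>j\<in>UNIV. powint lam p (P \<alpha> j)) + (\<Sum>i\<in>UNIV. \<Sum>K\<in>{K. length K < m}. powint lam p (foldr X K (\<alpha> i))))"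
    if \<alpha>: "\<alpha> \<in> \<D>" and I: "length I \<le> m" for \<alpha> i I
  proof -
    let ?L = "\<Sum>i\<in>UNIV. \<Sum>K\<in>{K. length K < m}. powint lam p (foldr X K (\<alpha> i))"
    let ?Q = "\<Sum>j\<in>UNIV. powint lam p (P \<alpha> j)"
    have meas: "(\<lambda>x. powint lam p (localized \<phi> x \<alpha> k)) \<in> borel_measurable lam" for k
      by (cases k) (auto simp: localized_def split: prod.split
        intro!: powint_average_measurable \<phi>s iter_smooth op_measurable[OF \<alpha>] smooth_iter_measurable vec_smooth[OF \<alpha>])
    have avg: "(\<integral>\<^sup>+ x. powint lam p (localized \<phi> x \<alpha> k) \<partial>lam) = (case k of Inl j \<Rightarrow> ennreal (r []) * powint lam p (P \<alpha> j)
        | Inr (i, J, K) \<Rightarrow> ennreal (r J) * powint lam p (foldr X K (\<alpha> i)))" for k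
      using powint_average[OF iter_smooth[OF \<phi>s, of "[]"] op_measurable[OF \<alpha>]]
        powint_average[OF iter_smooth[OF \<phi>s] smooth_iter_measurable[OF vec_smooth[OF \<alpha>]]]
      unfolding localized_def \<kappa>r(1)[symmetric] \<kappa>_def by (auto split: sum.split prod.split)
    have "ennreal (r []) * powint lam p (foldr X I (\<alpha> i)) = (\<integral>\<^sup>+ x. powint lam p (\<lambda>y. ltrans x \<phi> y * foldr X I (\<alpha> i) y) \<partial>lam)"
      using powint_average[OF \<phi>s smooth_iter_measurable[OF vec_smooth[OF \<alpha>]], of I i]
      by (simp add: \<kappa>r(1)[symmetric] \<kappa>_def)
    also have "\<dots> \<le> (\<integral>\<^sup>+ x. ennreal C * (\<Sum>k\<in>loc_index. powint lam p (localized \<phi> x \<alpha> k)) \<partial>lam)"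
      using C(2) \<alpha> I by (intro nn_integral_mono) blast
    also have "\<dots> = ennreal C * (\<Sum>k\<in>loc_index. \<integral>\<^sup>+ x. powint lam p (localized \<phi> x \<alpha> k) \<partial>lam)"
      using meas by (simp add: nn_integral_cmult nn_integral_sum borel_measurable_sum)
    also have "(\<Sum>k\<in>loc_index. \<integral>\<^sup>+ x. powint lam p (localized \<phi> x \<alpha> k) \<partial>lam) =
      ennreal (r []) * ?Q + (\<Sum>i\<in>UNIV. \<Sum>J\<in>{J. length J \<le> m}. \<Sum>K\<in>{K. length K < m}. ennreal (r J) * powint lam p (foldr X K (\<alpha> i)))"
      unfolding avg loc_index_def
      by (subst sum.Plus) (simp_all add: sum_distrib_left sum.cartesian_product case_prod_unfold)
    also have "(\<Sum>i\<in>UNIV. \<Sum>J\<in>{J. length J \<le> m}. \<Sum>K\<in>{K. length K < m}. ennreal (r J) * powint lam p (foldr X K (\<alpha> i))) = ennreal ?R * ?L"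
      by (simp add: sum_distrib_left[symmetric] sum_distrib_right[symmetric] sum_ennreal \<kappa>r(2))
    \<comment> \<open>Enlarging \<open>r []\<close> to \<open>?R\<close> gives both sums the same
      factor.\<close>
    also have "ennreal C * (ennreal (r []) * ?Q + ennreal ?R * ?L) \<le> ennreal C * (ennreal ?R * ?Q + ennreal ?R * ?L)"
      using rR by (intro mult_left_mono add_mono mult_right_mono ennreal_leI) auto
    also have "\<dots> = ennreal (r []) * (ennreal C' * (?Q + ?L))"
    proof -
      have "ennreal (r []) * ennreal C' = ennreal C * ennreal ?R"
        using r0 C(1) R0 by (simp add: C'_def ennreal_mult[symmetric])
      then show ?thesis by (simp add: distrib_left[symmetric] mult.assoc[symmetric])
    qed
    finally show ?thesis using r0 by (subst (asm) ennreal_mult_le_mult_iff) auto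
  qed
  moreover have "C' \<ge> 0" using C(1) R0 r0 by (simp add: C'_def)
  ultimately show ?thesis by blast
qed

end

section \<open>The global estimate\<close>

context invariant_principal
begin

lemma sum_words_less:
  fixes f :: "'k list \<Rightarrow> real"
  shows "(\<Sum>K\<in>{K. length K < m}. f K) = (\<Sum>k<m. \<Sum>K\<in>{K. length K = k}. f K)"
proof -
  have "(\<Sum>K\<in>{K. length K < m}. f K) = (\<Sum>k\<in>{..<m}. \<Sum>K\<in>{K \<in> {K. length K < m}. length K = k}. f K)"
    by (rule sum.group[symmetric]) auto
  also have "\<dots> = (\<Sum>k<m. \<Sum>K\<in>{K. length K = k}. f K)"
    by (intro sum.cong refl) auto
  finally show ?thesis .
qed

lemma interpolation_lower:
  assumes e: "e > 0"
  shows "\<exists>C\<ge>0. \<forall>u\<in>Cc_infty A UNIV. (\<Sum>K\<in>{K. length K < m}. energy (foldr X K u))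
    \<le> e * (\<Sum>I\<in>{I. length I = m}. energy (foldr X I u)) + C * energy u"
proof -
  let ?S = "\<lambda>k u. \<Sum>I\<in>{I. length I = k}. energy (foldr X I u)"
  \<comment> \<open>The inequality is summed over the \<open>m\<close> orders below
    \<open>m\<close>, and each may use an equal share of \<open>e\<close>.\<close>
  have em: "e / real m > 0" using e m_ge_1 by simp
  have "\<forall>k. \<exists>C. k < m \<longrightarrow> C \<ge> 0 \<and> (\<forall>u\<in>Cc_infty A UNIV. ?S k u \<le> e / real m * ?S m u + C * energy u)"
    using interpolation[OF em] by blast
  from choice[OF this] obtain C where C: "\<forall>k. k < m \<longrightarrow> C k \<ge> 0 \<and>
    (\<forall>u\<in>Cc_infty A UNIV. ?S k u \<le> e / real m * ?S m u + C k * energy u)" ..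
  have "(\<Sum>K\<in>{K. length K < m}. energy (foldr X K u)) \<le> e * ?S m u + (\<Sum>k<m. C k) * energy u"
    if u: "u \<in> Cc_infty A UNIV" for u
  proof -
    have "(\<Sum>K\<in>{K. length K < m}. energy (foldr X K u)) \<le> (\<Sum>k<m. e / real m * ?S m u + C k * energy u)"
      unfolding sum_words_less using C u by (intro sum_mono) auto
    also have "\<dots> = e * ?S m u + (\<Sum>k<m. C k) * energy u"
      using m_ge_1 by (simp add: sum.distrib sum_distrib_right)
    finally show ?thesis .
  qed
  moreover have "(\<Sum>k<m. C k) \<ge> 0" using C by (intro sum_nonneg) auto
  ultimately show ?thesis by blast
qed

lemma vec_powint_energy: "\<alpha> \<in> \<D> \<Longrightarrow> powint lam p (foldr X I (\<alpha> i)) = ennreal (energy (foldr X I (\<alpha> i)))"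
  by (rule powint_eq_energy[OF iter_Cc_infty[OF vec_Cc]])

lemma operator_powint_finite:
  assumes "\<alpha> \<in> \<D>" shows "powint lam p (P \<alpha> j) < \<infinity>"
proof -
  obtain C where C: "\<forall>\<alpha>\<in>\<D>. \<forall>j. powint lam p (P \<alpha> j) \<le>
    ennreal C * (\<Sum>(i, I)\<in>UNIV \<times> {I. length I \<le> m}. powint lam p (foldr X I (\<alpha> i)))"
    using operator_bound by blast
  have "powint lam p (P \<alpha> j) \<le> ennreal C * (\<Sum>(i, I)\<in>UNIV \<times> {I. length I \<le> m}. powint lam p (foldr X I (\<alpha> i)))"
    using C assms by blast
  also have "\<dots> = ennreal C * ennreal (\<Sum>(i, I)\<in>UNIV \<times> {I. length I \<le> m}. energy (foldr X I (\<alpha> i)))"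
    by (simp add: vec_powint_energy[OF assms] sum_ennreal case_prod_unfold)
  also have "\<dots> < \<infinity>" by (simp add: ennreal_mult_less_top)
  finally show ?thesis .
qed

text \<open>Inserting the interpolation inequality into the averaged estimate, summed over all top
  order derivatives, produces those derivatives on the right with a small factor. They are absorbed
  into the left-hand side, which is possible because all quantities are finite on test
  functions.\<close>

lemma global_estimate:
  assumes mh: "maximal_hypoelliptic A lam X m p \<Omega> P" and \<Omega>: "open \<Omega>" "\<Omega> \<noteq> {}"
  shows "\<exists>C\<ge>0. \<forall>\<alpha>\<in>\<D>. \<forall>i I. length I \<le> m \<longrightarrow> powint lam p (foldr X I (\<alpha> i)) \<le>
    ennreal C * ((\<Sum>j\<in>UNIV. powint lam p (P \<alpha> j)) + (\<Sum>i\<in>UNIV. powint lam p (\<alpha> i)))"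
proof -
  obtain C where C: "C \<ge> 0" "\<forall>\<alpha>\<in>\<D>. \<forall>i I. length I \<le> m \<longrightarrow> powint lam p (foldr X I (\<alpha> i)) \<le>
    ennreal C * ((\<Sum>j\<in>UNIV. powint lam p (P \<alpha> j)) + (\<Sum>i\<in>UNIV. \<Sum>K\<in>{K. length K < m}. powint lam p (foldr X K (\<alpha> i))))"
    using averaged_estimate[OF mh \<Omega>] by blast
  define T where "T = real CARD('n) * real (card {I :: 'k list. length I = m}) * C"
  have T: "T \<ge> 0" using C(1) by (simp add: T_def)
  \<comment> \<open>\<open>T\<close> is the constant of the estimate summed over all components and
    all words of length \<open>m\<close>. This \<open>e\<close> gives
    \<open>T * e \<le> 1 / 2\<close>, so that at most half of \<open>S\<close> returns.\<close>
  define e where "e = 1 / (2 * (T + 1))"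
  have e: "e > 0" "T * e \<le> 1 / 2" "e \<le> 1" using T by (auto simp: e_def field_simps)
  obtain D where D: "D \<ge> 0" "\<forall>u\<in>Cc_infty A UNIV. (\<Sum>K\<in>{K. length K < m}. energy (foldr X K u))
    \<le> e * (\<Sum>I\<in>{I. length I = m}. energy (foldr X I u)) + D * energy u"
    using interpolation_lower[OF e(1)] by blast
  have "powint lam p (foldr X I (\<alpha> i)) \<le> ennreal (C * ((1 + 2 * T) * (1 + D))) *
    ((\<Sum>j\<in>UNIV. powint lam p (P \<alpha> j)) + (\<Sum>i\<in>UNIV. powint lam p (\<alpha> i)))"
    if \<alpha>: "\<alpha> \<in> \<D>" and I: "length I \<le> m" for \<alpha> i I
  proof -
    define q where "q = (\<Sum>j\<in>UNIV. enn2real (powint lam p (P \<alpha> j)))"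
    define L where "L = (\<Sum>i\<in>UNIV. \<Sum>K\<in>{K. length K < m}. energy (foldr X K (\<alpha> i)))"
    define S where "S = (\<Sum>i\<in>UNIV. \<Sum>I\<in>{I. length I = m}. energy (foldr X I (\<alpha> i)))"
    define E where "E = (\<Sum>i\<in>UNIV. energy (\<alpha> i))"
    have nn: "q \<ge> 0" "L \<ge> 0" "S \<ge> 0" "E \<ge> 0"
      by (auto simp: q_def L_def S_def E_def intro!: sum_nonneg)
    have Q: "(\<Sum>j\<in>UNIV. powint lam p (P \<alpha> j)) = ennreal q"
      unfolding q_def using operator_powint_finite[OF \<alpha>] by (simp add: sum_ennreal[symmetric])
    have LL: "(\<Sum>i\<in>UNIV. \<Sum>K\<in>{K. length K < m}. powint lam p (foldr X K (\<alpha> i))) = ennreal L"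
      unfolding L_def by (simp add: vec_powint_energy[OF \<alpha>] sum_ennreal sum_nonneg)
    have EE: "(\<Sum>i\<in>UNIV. powint lam p (\<alpha> i)) = ennreal E"
      unfolding E_def using vec_powint_energy[OF \<alpha>, of "[]"] by (simp add: sum_ennreal)
    have est: "energy (foldr X I (\<alpha> i)) \<le> C * (q + L)" if "length I \<le> m" for i I
    proof -
      have "ennreal (energy (foldr X I (\<alpha> i))) \<le> ennreal (C * (q + L))"
        using C(2) \<alpha> that C(1) nn
        by (simp add: vec_powint_energy[OF \<alpha>, symmetric] ennreal_mult ennreal_plus Q[symmetric] LL[symmetric])
      then show ?thesis using C(1) nn by (simp add: ennreal_le_iff)
    qed
    have "S \<le> (\<Sum>i\<in>(UNIV :: 'n set). \<Sum>I\<in>{I :: 'k list. length I = m}. C * (q + L))"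
      unfolding S_def by (intro sum_mono est) simp
    also have "\<dots> = T * (q + L)" by (simp add: T_def)
    finally have S: "S \<le> T * q + T * L" by (simp add: distrib_left)
    have "L \<le> (\<Sum>i\<in>UNIV. e * (\<Sum>I\<in>{I. length I = m}. energy (foldr X I (\<alpha> i))) + D * energy (\<alpha> i))"
      unfolding L_def using D(2) vec_Cc[OF \<alpha>] by (intro sum_mono) blast
    also have "\<dots> = e * S + D * E" by (simp add: S_def E_def sum.distrib sum_distrib_left)
    finally have L: "L \<le> e * S + D * E" .
    have "T * L \<le> T * (e * S + D * E)" using L T by (rule mult_left_mono)
    also have "\<dots> = (T * e) * S + T * (D * E)" by (simp add: algebra_simps)
    also have "\<dots> \<le> 1 / 2 * S + T * (D * E)" using mult_right_mono[OF e(2) nn(3)] by simp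
    finally have "S \<le> 2 * (T * q) + 2 * (T * (D * E))" using S by linarith
    moreover have "e * S \<le> S" using mult_right_mono[OF e(3) nn(3)] by simp
    ultimately have "q + L \<le> (1 + 2 * T) * q + (1 + 2 * T) * (D * E)"
      using L by (simp add: algebra_simps)
    also have "\<dots> \<le> (1 + 2 * T) * ((1 + D) * q) + (1 + 2 * T) * ((1 + D) * E)"
      using T D(1) nn by (intro add_mono mult_left_mono) (auto simp: algebra_simps)
    also have "\<dots> = (1 + 2 * T) * (1 + D) * (q + E)" by (simp add: algebra_simps)
    finally have "C * (q + L) \<le> C * ((1 + 2 * T) * (1 + D) * (q + E))" using C(1) by (rule mult_left_mono)
    then have "energy (foldr X I (\<alpha> i)) \<le> C * ((1 + 2 * T) * (1 + D)) * (q + E)"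
      using est[OF I, of i] by (simp add: mult.assoc)
    then have "ennreal (energy (foldr X I (\<alpha> i))) \<le> ennreal (C * ((1 + 2 * T) * (1 + D)) * (q + E))"
      by (rule ennreal_leI)
    then show ?thesis
      unfolding vec_powint_energy[OF \<alpha>] Q EE
      using C(1) T D(1) nn by (simp add: ennreal_mult ennreal_plus)
  qed
  moreover have "C * ((1 + 2 * T) * (1 + D)) \<ge> 0" using C(1) T D(1) by simp
  ultimately show ?thesis by blast
qed

end

section \<open>Convergence in \<open>L\<^sup>p\<close> and closures\<close>

definition Lp_lim :: "'a measure \<Rightarrow> real \<Rightarrow> (nat \<Rightarrow> 'a \<Rightarrow> real) \<Rightarrow> ('a \<Rightarrow> real) \<Rightarrow> bool" where
  "Lp_lim M p h f \<longleftrightarrow> (\<forall>s>0. \<exists>N. \<forall>n\<ge>N. powint M p (\<lambda>y. h n y - f y) \<le> ennreal s)"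

lemma Lp_limI_inverse:
  assumes "\<And>n. powint M p (\<lambda>y. f y - h n y) \<le> ennreal (1 / real (Suc n))"
  shows "Lp_lim M p h f"
  unfolding Lp_lim_def
proof (intro allI impI)
  fix s :: real assume "s > 0"
  then obtain N where N: "1 / real (Suc N) < s" using nat_approx_posE by blast
  have "powint M p (\<lambda>y. h n y - f y) \<le> ennreal s" if "n \<ge> N" for n
  proof -
    have "1 / real (Suc n) \<le> 1 / real (Suc N)" using that by (simp add: field_simps)
    then show ?thesis
      unfolding powint_minus_commute[of M p "h n" f]
      using N by (intro order_trans[OF assms] ennreal_leI) linarith
  qed
  then show "\<exists>N. \<forall>n\<ge>N. powint M p (\<lambda>y. h n y - f y) \<le> ennreal s" by blast
qed

lemma Lp_lim_finite:
  assumes "finite F" "\<And>k. k \<in> F \<Longrightarrow> Lp_lim M p (\<lambda>n. h n k) (f k)" "s > 0"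
  shows "\<exists>N. \<forall>n\<ge>N. \<forall>k\<in>F. powint M p (\<lambda>y. h n k y - f k y) \<le> ennreal s"
  using assms(1,2)
proof (induction F rule: finite_induct)
  case (insert k F)
  then obtain N1 where "\<forall>n\<ge>N1. \<forall>k\<in>F. powint M p (\<lambda>y. h n k y - f k y) \<le> ennreal s" by auto
  moreover obtain N2 where "\<forall>n\<ge>N2. powint M p (\<lambda>y. h n k y - f k y) \<le> ennreal s"
    using insert.prems[of k] assms(3) unfolding Lp_lim_def by auto
  ultimately show ?case by (intro exI[of _ "max N1 N2"]) auto
qed simp

lemma sum_less_ennreal:
  assumes "finite F" "e > 0" "\<And>k. k \<in> F \<Longrightarrow> h k < ennreal (e / (real (card F) + 1))"
  shows "(\<Sum>k\<in>F. h k) < ennreal e"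
proof -
  have "(\<Sum>k\<in>F. h k) \<le> (\<Sum>k\<in>F. ennreal (e / (real (card F) + 1)))"
    by (intro sum_mono less_imp_le assms(3))
  also have "\<dots> = ennreal (real (card F) * (e / (real (card F) + 1)))"
    using assms(2) by (simp add: ennreal_mult[symmetric] ennreal_of_nat_eq_real_of_nat)
  also have "\<dots> < ennreal e" using assms(2) by (simp add: ennreal_less_iff field_simps)
  finally show ?thesis .
qed

lemma Lp_lim_sum_norm:
  assumes p: "p > 0" and F: "finite F" and lim: "\<And>k. k \<in> F \<Longrightarrow> Lp_lim M p (\<lambda>n. h n k) (f k)"
    and meas: "\<And>k. k \<in> F \<Longrightarrow> f k \<in> borel_measurable M" "\<And>n k. k \<in> F \<Longrightarrow> h n k \<in> borel_measurable M"
    and e: "e > 0"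
  shows "\<exists>N. \<forall>n\<ge>N. (\<Sum>k\<in>F. Lp_norm M p (\<lambda>y. f k y - h n k y)) < e"
proof -
  obtain e' where e': "e' > 0" "ennreal e' \<le> e"
  proof (cases e)
    case (real r)
    then show ?thesis using e that[of r] by simp
  next
    case top
    then show ?thesis using that[of 1] by simp
  qed
  define c where "c = e' / (real (card F) + 1)"
  have c: "c > 0" using e'(1) by (simp add: c_def add_nonneg_pos)
  have s: "(c / 2) powr p > 0" using c by simp
  obtain N where N: "\<forall>n\<ge>N. \<forall>k\<in>F. powint M p (\<lambda>y. h n k y - f k y) \<le> ennreal ((c / 2) powr p)"
    using Lp_lim_finite[of F M p h f, OF F lim s] by blast
  have "(\<Sum>k\<in>F. Lp_norm M p (\<lambda>y. f k y - h n k y)) < e" if n: "n \<ge> N" for n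
  proof -
    have "(\<Sum>k\<in>F. Lp_norm M p (\<lambda>y. f k y - h n k y)) < ennreal e'"
    proof (rule sum_less_ennreal[OF F e'(1)])
      fix k assume k: "k \<in> F"
      have "powint M p (\<lambda>y. f k y - h n k y) \<le> ennreal ((c / 2) powr p)"
        using N n k by (subst powint_minus_commute) blast
      also have "\<dots> < ennreal (c powr p)"
        using c p by (intro ennreal_lessI powr_less_mono2) auto
      finally have "Lp_norm M p (\<lambda>y. f k y - h n k y) < ennreal c"
        using Lp_norm_less_iff[OF p c, of "\<lambda>y. f k y - h n k y" M] meas[OF k] by simp
      then show "Lp_norm M p (\<lambda>y. f k y - h n k y) < ennreal (e' / (real (card F) + 1))" by (simp add: c_def)
    qed
    then show ?thesis using e'(2) by (rule less_le_trans)
  qed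
  then show ?thesis by blast
qed

text \<open>The common functional-analytic core of the two inclusions: a norm estimate for
  differences makes \<open>z\<close> a Cauchy sequence whenever the sequences \<open>h\<close>
  converge. In one direction \<open>z\<close> is a derivative, in the other a component of the
  operator.\<close>

lemma Lp_complete_dominated:
  fixes z :: "nat \<Rightarrow> 'a \<Rightarrow> real"
  assumes p: "p > 0" and F: "finite F" and lim: "\<And>k. k \<in> F \<Longrightarrow> Lp_lim M p (\<lambda>n. h n k) (f k)"
    and meas: "\<And>k. k \<in> F \<Longrightarrow> f k \<in> borel_measurable M" "\<And>n k. k \<in> F \<Longrightarrow> h n k \<in> borel_measurable M"
    and zmeas: "\<And>n. z n \<in> borel_measurable M" and zfin: "\<And>n. powint M p (z n) < \<infinity>"
    and dom: "C \<ge> 0" "\<And>n n'. powint M p (\<lambda>y. z n y - z n' y) \<le> ennreal C * (\<Sum>k\<in>F. powint M p (\<lambda>y. h n k y - h n' k y))"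
  obtains g where "g \<in> Lp M p" "Lp_lim M p z g"
proof -
  have "\<exists>N. \<forall>n\<ge>N. \<forall>n'\<ge>N. powint M p (\<lambda>y. z n y - z n' y) \<le> ennreal e" if e: "e > 0" for e
  proof -
    \<comment> \<open>Solves for the tolerance that yields exactly \<open>e\<close> after the
      triangle inequality with its factor \<open>2 powr p\<close>, the sum over \<open>F\<close> and
      the factor \<open>C\<close>; the added ones prevent division by zero.\<close>
    define s where "s = e / ((C + 1) * 2 powr p * 2 * (real (card F) + 1))"
    have s: "s > 0" using e dom(1) by (simp add: s_def add_nonneg_pos)
    obtain N where N: "\<forall>n\<ge>N. \<forall>k\<in>F. powint M p (\<lambda>y. h n k y - f k y) \<le> ennreal s"
      using Lp_lim_finite[of F M p h f, OF F lim s] by blast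
    have "powint M p (\<lambda>y. z n y - z n' y) \<le> ennreal e" if n: "n \<ge> N" "n' \<ge> N" for n n'
    proof -
      have "powint M p (\<lambda>y. h n k y - h n' k y) \<le> ennreal (2 powr p * (2 * s))" if k: "k \<in> F" for k
      proof -
        have "powint M p (\<lambda>y. h n k y - h n' k y) \<le> ennreal (2 powr p) * (powint M p (\<lambda>y. h n k y - f k y) + powint M p (\<lambda>y. f k y - h n' k y))"
          by (rule powint_triangle) (use p meas[OF k] in auto)
        also have "\<dots> \<le> ennreal (2 powr p) * (ennreal s + ennreal s)"
        proof (intro mult_left_mono add_mono)
          show "powint M p (\<lambda>y. h n k y - f k y) \<le> ennreal s" using N n k by blast
          show "powint M p (\<lambda>y. f k y - h n' k y) \<le> ennreal s"
            using N n k by (subst powint_minus_commute) blast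
        qed simp
        also have "\<dots> = ennreal (2 powr p * (2 * s))" using s by (simp add: ennreal_mult ennreal_plus[symmetric] del: ennreal_plus)
        finally show ?thesis .
      qed
      then have "(\<Sum>k\<in>F. powint M p (\<lambda>y. h n k y - h n' k y)) \<le> (\<Sum>k\<in>F. ennreal (2 powr p * (2 * s)))"
        by (intro sum_mono)
      also have "\<dots> = ennreal (real (card F) * (2 powr p * (2 * s)))"
        using s by (simp add: ennreal_mult ennreal_of_nat_eq_real_of_nat)
      finally have "powint M p (\<lambda>y. z n y - z n' y) \<le> ennreal C * ennreal (real (card F) * (2 powr p * (2 * s)))"
        by (intro order_trans[OF dom(2)] mult_left_mono) auto
      also have "\<dots> = ennreal (C * (real (card F) * (2 powr p * (2 * s))))"
        using dom(1) s by (simp add: ennreal_mult)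
      also have "\<dots> \<le> ennreal ((C + 1) * ((real (card F) + 1) * (2 powr p * (2 * s))))"
        using dom(1) s by (intro ennreal_leI mult_mono) auto
      also have "(C + 1) * ((real (card F) + 1) * (2 powr p * (2 * s))) = e"
      proof -
        have "(C + 1) * 2 powr p * 2 * (real (card F) + 1) > 0" using dom(1) by (simp add: add_nonneg_pos)
        then show ?thesis unfolding s_def by (simp add: field_simps)
      qed
      finally show ?thesis .
    qed
    then show ?thesis by blast
  qed
  then obtain g where g: "g \<in> borel_measurable M" "\<forall>e>0. \<exists>N. \<forall>n\<ge>N. powint M p (\<lambda>y. z n y - g y) \<le> ennreal e"
    using Lp_complete[of p z M, OF p zmeas] by blast
  obtain N where N: "\<forall>n\<ge>N. powint M p (\<lambda>y. z n y - g y) \<le> ennreal 1" using g(2) zero_less_one by blast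
  have "powint M p g \<le> ennreal (2 powr p) * (powint M p (\<lambda>y. z N y - g y) + powint M p (z N))"
  proof (rule powint_le_add)
    show "AE y in M. \<bar>g y\<bar> \<le> \<bar>z N y - g y\<bar> + \<bar>z N y\<bar>" by (rule AE_I2) linarith
  qed (use p g(1) zmeas in \<open>auto intro!: borel_measurable_diff\<close>)
  also have "\<dots> < \<infinity>"
    using zfin[of N] le_less_trans[OF spec[OF N, of N, simplified], of \<infinity>] by (auto simp: ennreal_mult_less_top)
  finally have "g \<in> Lp M p" using g(1) by (simp add: Lp_iff)
  then show ?thesis using g(2) that[of g] unfolding Lp_lim_def by blast
qed

section \<open>Pairings with test functions and limits of weak derivatives\<close>

context haar_finite_fields
begin

lemma Lp_locally_integrable:
  assumes "f \<in> Lp lam p" shows "locally_integrable lam f"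
proof -
  note f = assms[unfolded Lp_def]
  have [measurable]: "f \<in> borel_measurable lam" using f by simp
  have "integrable lam (\<lambda>y. indicator K y * f y)" if K: "compact K" for K
  proof -
    have [measurable]: "K \<in> sets lam" using compact_imp_closed[OF K] by simp
    show ?thesis
    proof (rule Bochner_Integration.integrable_bound)
      \<comment> \<open>\<open>le_add_powr\<close> with parameter 1 bounds
        \<open>\<bar>f\<bar>\<close> by \<open>1 + \<bar>f\<bar> powr p\<close>, which is integrable
        on compact sets.\<close>
      show "integrable lam (\<lambda>y. indicator K y + \<bar>f y\<bar> powr p)"
        using f emeasure_compact[OF K] \<open>K \<in> sets lam\<close>
        by (intro Bochner_Integration.integrable_add integrable_real_indicator) auto
      show "AE y in lam. norm (indicator K y * f y) \<le> norm (indicator K y + \<bar>f y\<bar> powr p)"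
        using le_add_powr[OF p_ge_1, of 1] by (intro AE_I2) (auto split: split_indicator)
    qed measurable
  qed
  then show ?thesis by (simp add: locally_integrable_def set_integrable_def)
qed

lemma Cc_infty_Lp: "u \<in> Cc_infty A UNIV \<Longrightarrow> u \<in> Lp lam p"
  using powint_Cc_infty_finite[of u UNIV p] p_ge_1 smooth_fun_measurable[OF Cc_infty_smooth]
  by (simp add: Lp_iff)

text \<open>Integrates \<open>le_add_powr\<close> over the support of \<open>\<phi>\<close>. As
  \<open>e\<close> is arbitrary and \<open>M\<close> independent of it, small energy of
  \<open>h\<close> makes the pairing small: first \<open>e\<close> is chosen, then the
  energy.\<close>

lemma pairing_bound:
  assumes \<phi>: "\<phi> \<in> Cc_infty A UNIV"
  obtains M where "M \<ge> 0" "\<forall>h\<in>Lp lam p. \<forall>e>0. \<bar>\<integral>y. h y * \<phi> y \<partial>lam\<bar> \<le> M * (e + e powr (1 - p) * energy h)"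
proof -
  obtain K where K: "\<phi> \<in> smooth_fun A" "compact K" "\<And>y. y \<notin> K \<Longrightarrow> \<phi> y = 0"
    using Cc_inftyE[OF \<phi>] by metis
  obtain B where B: "B \<ge> 0" "\<forall>y. \<bar>\<phi> y\<bar> \<le> B" by (rule Cc_infty_bounded[OF \<phi>])
  have Ks [measurable]: "K \<in> sets lam" using compact_imp_closed[OF K(2)] by simp
  have iK: "integrable lam (indicator K :: 'g \<Rightarrow> real)"
    using emeasure_compact[OF K(2)] Ks by (intro integrable_real_indicator)
  define M where "M = B * (measure lam K + 1)"
  have "\<bar>\<integral>y. h y * \<phi> y \<partial>lam\<bar> \<le> M * (e + e powr (1 - p) * energy h)" if h: "h \<in> Lp lam p" and e: "e > 0" for h e
  proof -
    have ih: "integrable lam (\<lambda>y. \<bar>h y\<bar> powr p)" using h by (simp add: Lp_def)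
    have en: "(\<integral>y. \<bar>h y\<bar> powr p \<partial>lam) = energy h"
      unfolding energy_def powint_def using h by (intro integral_eq_nn_integral) (auto simp: Lp_def)
    have i: "integrable lam (\<lambda>y. B * (e * indicator K y + e powr (1 - p) * \<bar>h y\<bar> powr p))"
      by (intro integrable_mult_right Bochner_Integration.integrable_add iK ih)
    have "\<bar>\<integral>y. h y * \<phi> y \<partial>lam\<bar> \<le> (\<integral>y. \<bar>h y * \<phi> y\<bar> \<partial>lam)" by (rule integral_abs_bound)
    also have "\<dots> \<le> (\<integral>y. B * (e * indicator K y + e powr (1 - p) * \<bar>h y\<bar> powr p) \<partial>lam)"
    proof (rule integral_mono[OF _ i])
      show "integrable lam (\<lambda>y. \<bar>h y * \<phi> y\<bar>)"
        by (intro integrable_abs locally_integrable_times_Cc_infty[OF Lp_locally_integrable[OF h] \<phi>])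
      fix y
      show "\<bar>h y * \<phi> y\<bar> \<le> B * (e * indicator K y + e powr (1 - p) * \<bar>h y\<bar> powr p)"
      proof (cases "y \<in> K")
        case True
        have "\<bar>h y * \<phi> y\<bar> = \<bar>\<phi> y\<bar> * \<bar>h y\<bar>" by (simp add: abs_mult)
        also have "\<dots> \<le> B * (e + e powr (1 - p) * \<bar>h y\<bar> powr p)"
          using B le_add_powr[OF p_ge_1 e, of "h y"] by (intro mult_mono) auto
        finally show ?thesis using True by simp
      qed (use K(3) B(1) in simp)
    qed
    also have "\<dots> = B * (e * measure lam K + e powr (1 - p) * energy h)"
      using iK ih Ks by (simp add: en)
    also have "\<dots> \<le> M * (e + e powr (1 - p) * energy h)"
    proof -
      have "e * measure lam K + e powr (1 - p) * energy h \<le> (measure lam K + 1) * (e + e powr (1 - p) * energy h)"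
        using e by (simp add: distrib_right distrib_left algebra_simps)
      then show ?thesis using B(1) unfolding M_def mult.assoc by (rule mult_left_mono)
    qed
    finally show ?thesis .
  qed
  then show ?thesis using B(1) by (intro that[of M]) (auto simp: M_def)
qed

lemma Lp_lim_energy:
  assumes "Lp_lim lam p h f" "s > 0"
  shows "\<exists>N. \<forall>n\<ge>N. energy (\<lambda>y. h n y - f y) \<le> s"
proof -
  obtain N where N: "\<forall>n\<ge>N. powint lam p (\<lambda>y. h n y - f y) \<le> ennreal s"
    using assms unfolding Lp_lim_def by blast
  have "energy (\<lambda>y. h n y - f y) \<le> s" if "n \<ge> N" for n
    unfolding energy_def using enn2real_mono[of _ "ennreal s"] N that assms(2) by fastforce
  then show ?thesis by blast
qed

lemma pairing_tendsto:
  assumes \<phi>: "\<phi> \<in> Cc_infty A UNIV" and lim: "Lp_lim lam p h f"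
    and h: "\<And>n. h n \<in> Lp lam p" and f: "f \<in> Lp lam p"
  shows "(\<lambda>n. \<integral>y. h n y * \<phi> y \<partial>lam) \<longlonglongrightarrow> (\<integral>y. f y * \<phi> y \<partial>lam)"
proof (rule LIMSEQ_I)
  fix r :: real assume r: "r > 0"
  obtain M where M: "M \<ge> 0" "\<forall>h\<in>Lp lam p. \<forall>e>0. \<bar>\<integral>y. h y * \<phi> y \<partial>lam\<bar> \<le> M * (e + e powr (1 - p) * energy h)"
    by (rule pairing_bound[OF \<phi>])
  define e where "e = r / (4 * (M + 1))"
  have e: "e > 0" using r M(1) by (simp add: e_def)
  \<comment> \<open>Makes \<open>e powr (1 - p) * s\<close> equal to \<open>e\<close>, so that the
    pairing is at most \<open>M * (2 * e)\<close>, below \<open>r\<close> by the choice of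
    \<open>e\<close>.\<close>
  define s where "s = e / e powr (1 - p)"
  have s: "s > 0" using e by (simp add: s_def)
  obtain N where N: "\<forall>n\<ge>N. energy (\<lambda>y. h n y - f y) \<le> s" using Lp_lim_energy[OF lim s] by blast
  have "norm ((\<integral>y. h n y * \<phi> y \<partial>lam) - (\<integral>y. f y * \<phi> y \<partial>lam)) < r" if n: "n \<ge> N" for n
  proof -
    have d: "(\<lambda>y. h n y - f y) \<in> Lp lam p" using powint_finite_diff[OF _ h f] p_ge_1 by simp
    have "(\<integral>y. h n y * \<phi> y \<partial>lam) - (\<integral>y. f y * \<phi> y \<partial>lam) = (\<integral>y. (h n y - f y) * \<phi> y \<partial>lam)"
      using Bochner_Integration.integral_diff[OF locally_integrable_times_Cc_infty[OF Lp_locally_integrable[OF h] \<phi>]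
          locally_integrable_times_Cc_infty[OF Lp_locally_integrable[OF f] \<phi>], of n]
      by (simp add: left_diff_distrib)
    also have "\<bar>\<dots>\<bar> \<le> M * (e + e powr (1 - p) * energy (\<lambda>y. h n y - f y))"
      by (rule mp[OF spec[OF bspec[OF M(2) d]] e])
    also have "\<dots> \<le> M * (e + e powr (1 - p) * s)"
      using M(1) mp[OF spec[OF N, of n] n] by (intro mult_left_mono add_left_mono) auto
    also have "\<dots> = M * (2 * e)" using e by (simp add: s_def)
    also have "\<dots> < r"
    proof -
      have "M * (2 * e) = r / 2 * (M / (M + 1))" using M(1) by (simp add: e_def field_simps)
      also have "\<dots> \<le> r / 2 * 1" using M(1) r by (intro mult_left_mono) auto
      finally show ?thesis using r by linarith
    qed
    finally show ?thesis by simp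
  qed
  then show "\<exists>no. \<forall>n\<ge>no. norm ((\<integral>y. h n y * \<phi> y \<partial>lam) - (\<integral>y. f y * \<phi> y \<partial>lam)) < r" by blast
qed

text \<open>The defining identity holds for each \<open>u n\<close>, and both of its sides are
  pairings of an \<open>L\<^sup>p\<close> convergent sequence with a fixed test function, since the
  formal adjoint of a test function is again one.\<close>

lemma is_weak_deriv_limit:
  assumes u: "\<And>n. u n \<in> Cc_infty A UNIV" and v: "v \<in> Lp lam p" and f: "f \<in> Lp lam p"
    and lim: "Lp_lim lam p u v" "Lp_lim lam p (\<lambda>n. foldr X I (u n)) f"
  shows "is_weak_deriv A lam X I v f"
  unfolding is_weak_deriv_def
proof (intro conjI ballI Lp_locally_integrable v f)
  fix \<phi> assume \<phi>: "\<phi> \<in> Cc_infty A UNIV"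
  let ?a = "formal_adjoint A lam (foldr X I) \<phi>"
  have a: "?a \<in> Cc_infty A UNIV" "(\<integral>y. foldr X I (u n) y * \<phi> y \<partial>lam) = (\<integral>y. u n y * ?a y \<partial>lam)" for n
    using formal_adjoint_props[OF \<phi>, of I] u[of n] by blast+
  have "(\<lambda>n. \<integral>y. u n y * ?a y \<partial>lam) \<longlonglongrightarrow> (\<integral>y. f y * \<phi> y \<partial>lam)"
    using pairing_tendsto[OF \<phi> lim(2) Cc_infty_Lp[OF iter_Cc_infty[OF u]] f] by (simp add: a(2))
  moreover have "(\<lambda>n. \<integral>y. u n y * ?a y \<partial>lam) \<longlonglongrightarrow> (\<integral>y. v y * ?a y \<partial>lam)"
    by (rule pairing_tendsto[OF a(1) lim(1) Cc_infty_Lp[OF u] v])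
  ultimately show "(\<integral>y. f y * \<phi> y \<partial>lam) = (\<integral>y. v y * ?a y \<partial>lam)" by (rule LIMSEQ_unique)
qed

lemma is_weak_deriv_Nil:
  assumes "locally_integrable lam v" shows "is_weak_deriv A lam X [] v v"
  using assms formal_adjoint_Nil by (simp add: is_weak_deriv_def)

lemma Lp_norm_weak_deriv:
  assumes "is_weak_deriv A lam X I u f"
  shows "Lp_norm lam p (weak_deriv A lam X I u) = Lp_norm lam p f"
    "weak_deriv A lam X I u \<in> borel_measurable lam" "f \<in> borel_measurable lam"
proof -
  have "is_weak_deriv A lam X I u (weak_deriv A lam X I u)"
    unfolding weak_deriv_def by (rule someI[of "is_weak_deriv A lam X I u", OF assms])
  then show m: "weak_deriv A lam X I u \<in> borel_measurable lam" "f \<in> borel_measurable lam"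
    using assms by (auto simp: is_weak_deriv_def locally_integrable_def)
  show "Lp_norm lam p (weak_deriv A lam X I u) = Lp_norm lam p f"
    by (rule Lp_norm_cong_AE[OF m weak_deriv_AE[OF assms]])
qed

end

lemma Lp_norm_vec_less_powint:
  assumes p: "p > 0" and s: "s > 0" and meas: "\<And>i. f i \<in> borel_measurable M"
    and le: "Lp_norm_vec M p f < ennreal (s powr (1 / p))"
  shows "powint M p (f i) \<le> ennreal s"
proof -
  have "Lp_norm M p (f i) \<le> Lp_norm_vec M p f"
    unfolding Lp_norm_vec_def by (rule member_le_sum[of i UNIV "\<lambda>i. Lp_norm M p (f i)"]) auto
  then have "Lp_norm M p (f i) < ennreal (s powr (1 / p))" using le by (rule le_less_trans)
  then have "powint M p (f i) < ennreal ((s powr (1 / p)) powr p)"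
    using Lp_norm_less_iff[OF p _ meas, of "s powr (1 / p)"] s by simp
  then show ?thesis using p s by (simp add: powr_powr less_imp_le)
qed

section \<open>The two inclusions\<close>

context invariant_principal
begin

lemma p_pos: "p > 0"
  using p_ge_1 by linarith

text \<open>\<open>global_estimate\<close> applied to differences of approximants turns convergence
  in the graph norm into convergence of all derivatives up to order \<open>m\<close>. The limits are
  weak derivatives of \<open>\<alpha>\<close>, so the same approximants converge in the Sobolev
  norm.\<close>

lemma dom_closure_subset:
  assumes mh: "maximal_hypoelliptic A lam X m p \<Omega> P" and \<Omega>: "open \<Omega>" "\<Omega> \<noteq> {}"
  shows "dom_closure lam p \<D> P \<subseteq> Sobolev_closure A lam X m p \<D>"
proof
  fix \<alpha> :: "'n \<Rightarrow> 'g \<Rightarrow> real" assume "\<alpha> \<in> dom_closure lam p \<D> P"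
  then obtain g where "(\<alpha>, g) \<in> graph_closure lam p \<D> P" by (auto simp: dom_closure_def)
  then have \<alpha>: "\<alpha> i \<in> Lp lam p" and g: "g j \<in> Lp lam p" and ap: "\<forall>\<epsilon>>0. \<exists>\<beta>\<in>\<D>. Lp_norm_vec lam p (\<lambda>i y. \<alpha> i y - \<beta> i y) < \<epsilon> \<and>
      Lp_norm_vec lam p (\<lambda>j y. g j y - P \<beta> j y) < \<epsilon>" for i j
    by (auto simp: graph_closure_def)
  note \<alpha>m = \<alpha>[unfolded Lp_iff, THEN conjunct1] and gm = g[unfolded Lp_iff, THEN conjunct1]
  \<comment> \<open>The tolerance is a \<open>p\<close>-th root because convergence is measured by
    \<open>powint\<close>, where it becomes \<open>1 / real (Suc n)\<close>.\<close>
  have "\<forall>n. \<exists>\<beta>. \<beta> \<in> \<D> \<and> Lp_norm_vec lam p (\<lambda>i y. \<alpha> i y - \<beta> i y) < ennreal ((1 / real (Suc n)) powr (1 / p)) \<and>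
      Lp_norm_vec lam p (\<lambda>j y. g j y - P \<beta> j y) < ennreal ((1 / real (Suc n)) powr (1 / p))"
    using ap by (auto simp: Bex_def)
  from choice[OF this] obtain \<beta> where \<beta>: "\<forall>n. \<beta> n \<in> \<D> \<and> Lp_norm_vec lam p (\<lambda>i y. \<alpha> i y - \<beta> n i y) < ennreal ((1 / real (Suc n)) powr (1 / p)) \<and>
      Lp_norm_vec lam p (\<lambda>j y. g j y - P (\<beta> n) j y) < ennreal ((1 / real (Suc n)) powr (1 / p))" ..
  have \<beta>D: "\<beta> n \<in> \<D>" for n using \<beta> by blast
  have \<beta>m: "\<beta> n i \<in> borel_measurable lam" for n i by (rule smooth_fun_measurable[OF vec_smooth[OF \<beta>D]])
  have lim0: "Lp_lim lam p (\<lambda>n. \<beta> n i) (\<alpha> i)" for i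
    by (rule Lp_limI_inverse, rule Lp_norm_vec_less_powint[OF p_pos])
      (use \<beta> in \<open>auto intro!: borel_measurable_diff \<alpha>m \<beta>m\<close>)
  have limP: "Lp_lim lam p (\<lambda>n. P (\<beta> n) j) (g j)" for j
    by (rule Lp_limI_inverse, rule Lp_norm_vec_less_powint[OF p_pos])
      (use \<beta> in \<open>auto intro!: borel_measurable_diff gm op_measurable[OF \<beta>D]\<close>)
  obtain C where C: "C \<ge> 0" "\<forall>\<alpha>\<in>\<D>. \<forall>i I. length I \<le> m \<longrightarrow> powint lam p (foldr X I (\<alpha> i)) \<le>
    ennreal C * ((\<Sum>j\<in>UNIV. powint lam p (P \<alpha> j)) + (\<Sum>i\<in>UNIV. powint lam p (\<alpha> i)))"
    using global_estimate[OF mh \<Omega>] by blast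
  have "\<exists>f. f \<in> Lp lam p \<and> Lp_lim lam p (\<lambda>n. foldr X I (\<beta> n i)) f" if I: "length I \<le> m" for i I
  proof (rule Lp_complete_dominated[OF p_pos, of "UNIV :: ('m + 'n) set" lam
        "\<lambda>n k. case k of Inl j \<Rightarrow> P (\<beta> n) j | Inr i \<Rightarrow> \<beta> n i" "\<lambda>k. case k of Inl j \<Rightarrow> g j | Inr i \<Rightarrow> \<alpha> i"
        "\<lambda>n. foldr X I (\<beta> n i)" C])
    show "Lp_lim lam p (\<lambda>n. case k of Inl j \<Rightarrow> P (\<beta> n) j | Inr i \<Rightarrow> \<beta> n i) (case k of Inl j \<Rightarrow> g j | Inr i \<Rightarrow> \<alpha> i)" for k
      using lim0 limP by (cases k) auto
    show "(case k of Inl j \<Rightarrow> g j | Inr i \<Rightarrow> \<alpha> i) \<in> borel_measurable lam" for k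
      using \<alpha>m gm by (cases k) auto
    show "(case k of Inl j \<Rightarrow> P (\<beta> n) j | Inr i \<Rightarrow> \<beta> n i) \<in> borel_measurable lam" for n k
      using \<beta>m op_measurable[OF \<beta>D] by (cases k) auto
    show "foldr X I (\<beta> n i) \<in> borel_measurable lam" for n by (rule smooth_iter_measurable[OF vec_smooth[OF \<beta>D]])
    show "powint lam p (foldr X I (\<beta> n i)) < \<infinity>" for n
      using powint_Cc_infty_finite[OF iter_Cc_infty[OF vec_Cc[OF \<beta>D]]] p_pos by simp
    fix n n'
    have opd: "P (\<lambda>i y. \<beta> n i y - \<beta> n' i y) j = (\<lambda>y. P (\<beta> n) j y - P (\<beta> n') j y)" for j
      by (rule ext, rule op_diff[OF \<beta>D \<beta>D])
    have "foldr X I (\<lambda>y. \<beta> n i y - \<beta> n' i y) = (\<lambda>y. foldr X I (\<beta> n i) y - foldr X I (\<beta> n' i) y)"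
      by (intro iter_diff vec_smooth \<beta>D)
    then show "powint lam p (\<lambda>y. foldr X I (\<beta> n i) y - foldr X I (\<beta> n' i) y) \<le> ennreal C *
       (\<Sum>k\<in>UNIV. powint lam p (\<lambda>y. (case k of Inl j \<Rightarrow> P (\<beta> n) j | Inr i \<Rightarrow> \<beta> n i) y - (case k of Inl j \<Rightarrow> P (\<beta> n') j | Inr i \<Rightarrow> \<beta> n' i) y))"
      using mp[OF spec[OF spec[OF bspec[OF C(2) vec_diff[OF \<beta>D \<beta>D, of n n']], of i], of I] I] opd
      by (simp add: sum_UNIV_sum)
  qed (use C(1) in auto)
  then have "\<forall>q. \<exists>f. length (snd q) \<le> m \<longrightarrow> f \<in> Lp lam p \<and> Lp_lim lam p (\<lambda>n. foldr X (snd q) (\<beta> n (fst q))) f" by auto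
  from choice[OF this] obtain f where f: "\<forall>q. length (snd q) \<le> m \<longrightarrow> f q \<in> Lp lam p \<and>
    Lp_lim lam p (\<lambda>n. foldr X (snd q) (\<beta> n (fst q))) (f q)" ..
  have wd: "is_weak_deriv A lam X I (\<alpha> i) (f (i, I))" if "length I \<le> m" for i I
    using spec[OF f, of "(i, I)"] that
    by (intro is_weak_deriv_limit[OF vec_Cc[OF \<beta>D] \<alpha> _ lim0]) auto
  have sob: "\<alpha> \<in> Sobolev_vec A lam X m p"
    unfolding Sobolev_vec_def Sobolev_def using \<alpha> wd f by fastforce
  have "\<exists>\<beta>\<in>\<D>. Sobolev_norm_vec A lam X m p (\<lambda>i y. \<alpha> i y - \<beta> i y) < \<epsilon>" if \<epsilon>: "\<epsilon> > 0" for \<epsilon>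
  proof -
    let ?F = "UNIV \<times> {I :: 'k list. length I \<le> m} :: ('n \<times> 'k list) set"
    have "\<exists>N. \<forall>n\<ge>N. (\<Sum>q\<in>?F. Lp_norm lam p (\<lambda>y. f q y - foldr X (snd q) (\<beta> n (fst q)) y)) < \<epsilon>"
    proof (rule Lp_lim_sum_norm[OF p_pos _ _ _ _ \<epsilon>])
      show "f q \<in> borel_measurable lam" if "q \<in> ?F" for q using f that by (auto simp: Lp_iff)
      show "foldr X (snd q) (\<beta> n (fst q)) \<in> borel_measurable lam" for n q
        by (rule smooth_iter_measurable[OF vec_smooth[OF \<beta>D]])
      show "Lp_lim lam p (\<lambda>n. foldr X (snd q) (\<beta> n (fst q))) (f q)" if "q \<in> ?F" for q using f that by auto
    qed simp
    then obtain N where N: "(\<Sum>q\<in>?F. Lp_norm lam p (\<lambda>y. f q y - foldr X (snd q) (\<beta> N (fst q)) y)) < \<epsilon>" by blast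
    have "Sobolev_norm_vec A lam X m p (\<lambda>i y. \<alpha> i y - \<beta> N i y) =
      (\<Sum>q\<in>?F. Lp_norm lam p (weak_deriv A lam X (snd q) (\<lambda>y. \<alpha> (fst q) y - \<beta> N (fst q) y)))"
      by (simp add: Sobolev_norm_vec_def Sobolev_norm_def sum.cartesian_product case_prod_unfold)
    also have "\<dots> = (\<Sum>q\<in>?F. Lp_norm lam p (\<lambda>y. f q y - foldr X (snd q) (\<beta> N (fst q)) y))"
    proof (rule sum.cong[OF refl])
      fix q assume "q \<in> ?F"
      then have "is_weak_deriv A lam X (snd q) (\<alpha> (fst q)) (f q)" using wd[of "snd q" "fst q"] by auto
      then show "Lp_norm lam p (weak_deriv A lam X (snd q) (\<lambda>y. \<alpha> (fst q) y - \<beta> N (fst q) y)) =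
        Lp_norm lam p (\<lambda>y. f q y - foldr X (snd q) (\<beta> N (fst q)) y)"
        by (intro Lp_norm_weak_deriv(1) is_weak_deriv_diff is_weak_deriv_Cc_infty vec_Cc \<beta>D)
    qed
    finally have "Sobolev_norm_vec A lam X m p (\<lambda>i y. \<alpha> i y - \<beta> N i y) < \<epsilon>" using N by simp
    then show ?thesis using \<beta>D[of N] by (rule bexI)
  qed
  then show "\<alpha> \<in> Sobolev_closure A lam X m p \<D>"
    using sob by (simp add: Sobolev_closure_def)
qed

text \<open>\<open>operator_bound\<close> applied to differences makes the images under
  \<open>P\<close> of Sobolev approximants a Cauchy sequence. Its limit is the second component of a
  pair in the graph closure.\<close>

lemma Sobolev_closure_subset:
  "Sobolev_closure A lam X m p \<D> \<subseteq> dom_closure lam p \<D> P"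
proof
  fix \<alpha> :: "'n \<Rightarrow> 'g \<Rightarrow> real" assume "\<alpha> \<in> Sobolev_closure A lam X m p \<D>"
  then have sob: "\<alpha> \<in> Sobolev_vec A lam X m p"
    and ap: "\<forall>\<epsilon>>0. \<exists>\<beta>\<in>\<D>. Sobolev_norm_vec A lam X m p (\<lambda>i y. \<alpha> i y - \<beta> i y) < \<epsilon>"
    by (auto simp: Sobolev_closure_def)
  have \<alpha>: "\<alpha> i \<in> Lp lam p" for i using sob by (auto simp: Sobolev_vec_def Sobolev_def)
  note \<alpha>m = \<alpha>[unfolded Lp_iff, THEN conjunct1]
  have "\<forall>q. \<exists>f. length (snd q) \<le> m \<longrightarrow> f \<in> Lp lam p \<and> is_weak_deriv A lam X (snd q) (\<alpha> (fst q)) f"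
    using sob by (fastforce simp: Sobolev_vec_def Sobolev_def)
  from choice[OF this] obtain f where f: "\<forall>q. length (snd q) \<le> m \<longrightarrow> f q \<in> Lp lam p \<and>
    is_weak_deriv A lam X (snd q) (\<alpha> (fst q)) (f q)" ..
  have "\<forall>n. \<exists>\<beta>. \<beta> \<in> \<D> \<and> Sobolev_norm_vec A lam X m p (\<lambda>i y. \<alpha> i y - \<beta> i y) < ennreal ((1 / real (Suc n)) powr (1 / p))"
    using ap by (auto simp: Bex_def)
  from choice[OF this] obtain \<beta> where \<beta>: "\<forall>n. \<beta> n \<in> \<D> \<and>
    Sobolev_norm_vec A lam X m p (\<lambda>i y. \<alpha> i y - \<beta> n i y) < ennreal ((1 / real (Suc n)) powr (1 / p))" ..
  have \<beta>D: "\<beta> n \<in> \<D>" for n using \<beta> by blast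
  have \<beta>m: "\<beta> n i \<in> borel_measurable lam" for n i by (rule smooth_fun_measurable[OF vec_smooth[OF \<beta>D]])
  let ?F = "UNIV \<times> {I :: 'k list. length I \<le> m} :: ('n \<times> 'k list) set"
  have lim: "Lp_lim lam p (\<lambda>n. foldr X (snd q) (\<beta> n (fst q))) (f q)" if q: "q \<in> ?F" for q
  proof (rule Lp_limI_inverse)
    fix n
    let ?d = "\<lambda>y. f q y - foldr X (snd q) (\<beta> n (fst q)) y"
    have len: "length (snd q) \<le> m" using q by auto
    have wd: "is_weak_deriv A lam X (snd q) (\<lambda>y. \<alpha> (fst q) y - \<beta> n (fst q) y) ?d"
      by (intro is_weak_deriv_diff is_weak_deriv_Cc_infty vec_Cc \<beta>D conjunct2[OF mp[OF spec[OF f] len]])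
    have "Lp_norm lam p ?d = Lp_norm lam p (weak_deriv A lam X (snd q) (\<lambda>y. \<alpha> (fst q) y - \<beta> n (fst q) y))"
      by (rule Lp_norm_weak_deriv(1)[OF wd, symmetric])
    also have "\<dots> \<le> Sobolev_norm A lam X m p (\<lambda>y. \<alpha> (fst q) y - \<beta> n (fst q) y)"
      unfolding Sobolev_norm_def
      by (rule member_le_sum[of "snd q" _ "\<lambda>I. Lp_norm lam p (weak_deriv A lam X I (\<lambda>y. \<alpha> (fst q) y - \<beta> n (fst q) y))"])
        (use len in auto)
    also have "\<dots> \<le> Sobolev_norm_vec A lam X m p (\<lambda>i y. \<alpha> i y - \<beta> n i y)"
      unfolding Sobolev_norm_vec_def
      by (rule member_le_sum[of "fst q" UNIV "\<lambda>i. Sobolev_norm A lam X m p (\<lambda>y. \<alpha> i y - \<beta> n i y)"]) auto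
    also have "\<dots> < ennreal ((1 / real (Suc n)) powr (1 / p))" using \<beta> by blast
    finally have "powint lam p ?d < ennreal (((1 / real (Suc n)) powr (1 / p)) powr p)"
      using Lp_norm_less_iff[OF p_pos _ Lp_norm_weak_deriv(3)[OF wd], of "(1 / real (Suc n)) powr (1 / p)"] by simp
    then show "powint lam p ?d \<le> ennreal (1 / real (Suc n))"
      using p_pos by (simp add: powr_powr less_imp_le)
  qed
  have fm: "f q \<in> borel_measurable lam" if "q \<in> ?F" for q using f that by (auto simp: Lp_iff)
  \<comment> \<open>The chosen weak derivative \<open>f (i, [])\<close> of order 0 equals
    \<open>\<alpha> i\<close> only almost everywhere, by uniqueness, so the limit has to be
    transferred.\<close>
  have lim0: "Lp_lim lam p (\<lambda>n. \<beta> n i) (\<alpha> i)" for i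
  proof -
    have "is_weak_deriv A lam X [] (\<alpha> i) (f (i, []))" using spec[OF f, of "(i, [])"] by simp
    then have "AE y in lam. f (i, []) y = \<alpha> i y"
      by (rule is_weak_deriv_unique[OF _ is_weak_deriv_Nil[OF Lp_locally_integrable[OF \<alpha>]]])
    then have "AE y in lam. \<beta> n i y - f (i, []) y = \<beta> n i y - \<alpha> i y" for n by eventually_elim simp
    then have "powint lam p (\<lambda>y. \<beta> n i y - f (i, []) y) = powint lam p (\<lambda>y. \<beta> n i y - \<alpha> i y)" for n
      by (rule powint_cong_AE)
    then show ?thesis using lim[of "(i, [])"] by (simp add: Lp_lim_def)
  qed
  obtain C where C: "C \<ge> 0" "\<forall>\<alpha>\<in>\<D>. \<forall>j. powint lam p (P \<alpha> j) \<le>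
    ennreal C * (\<Sum>(i, I)\<in>UNIV \<times> {I. length I \<le> m}. powint lam p (foldr X I (\<alpha> i)))"
    using operator_bound by blast
  have "\<exists>g. g \<in> Lp lam p \<and> Lp_lim lam p (\<lambda>n. P (\<beta> n) j) g" for j
  proof (rule Lp_complete_dominated[OF p_pos, of ?F lam "\<lambda>n q. foldr X (snd q) (\<beta> n (fst q))" f "\<lambda>n. P (\<beta> n) j" C])
    show "foldr X (snd q) (\<beta> n (fst q)) \<in> borel_measurable lam" for n q
      by (rule smooth_iter_measurable[OF vec_smooth[OF \<beta>D]])
    show "P (\<beta> n) j \<in> borel_measurable lam" "powint lam p (P (\<beta> n) j) < \<infinity>" for n
      by (rule op_measurable[OF \<beta>D] operator_powint_finite[OF \<beta>D])+
    fix n n'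
    have opd: "P (\<lambda>i y. \<beta> n i y - \<beta> n' i y) j = (\<lambda>y. P (\<beta> n) j y - P (\<beta> n') j y)" for j
      by (rule ext, rule op_diff[OF \<beta>D \<beta>D])
    have "foldr X I (\<lambda>y. \<beta> n i y - \<beta> n' i y) = (\<lambda>y. foldr X I (\<beta> n i) y - foldr X I (\<beta> n' i) y)" for i I
      by (intro iter_diff vec_smooth \<beta>D)
    then show "powint lam p (\<lambda>y. P (\<beta> n) j y - P (\<beta> n') j y) \<le>
      ennreal C * (\<Sum>q\<in>?F. powint lam p (\<lambda>y. foldr X (snd q) (\<beta> n (fst q)) y - foldr X (snd q) (\<beta> n' (fst q)) y))"
      using bspec[OF C(2) vec_diff[OF \<beta>D \<beta>D, of n n']]
      by (simp add: opd case_prod_unfold)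
  qed (use lim fm C(1) in auto)
  then have "\<forall>j. \<exists>g. g \<in> Lp lam p \<and> Lp_lim lam p (\<lambda>n. P (\<beta> n) j) g" by blast
  from choice[OF this] obtain g where g: "\<forall>j. g j \<in> Lp lam p \<and> Lp_lim lam p (\<lambda>n. P (\<beta> n) j) (g j)" ..
  have "\<exists>\<beta>\<in>\<D>. Lp_norm_vec lam p (\<lambda>i y. \<alpha> i y - \<beta> i y) < \<epsilon> \<and> Lp_norm_vec lam p (\<lambda>j y. g j y - P \<beta> j y) < \<epsilon>"
    if \<epsilon>: "\<epsilon> > 0" for \<epsilon>
  proof -
    have "\<exists>N. \<forall>n\<ge>N. (\<Sum>i\<in>UNIV. Lp_norm lam p (\<lambda>y. \<alpha> i y - \<beta> n i y)) < \<epsilon>"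
      by (rule Lp_lim_sum_norm[OF p_pos _ _ _ _ \<epsilon>]) (simp_all add: lim0 \<alpha>m \<beta>m)
    then obtain N1 where N1: "\<forall>n\<ge>N1. (\<Sum>i\<in>UNIV. Lp_norm lam p (\<lambda>y. \<alpha> i y - \<beta> n i y)) < \<epsilon>" ..
    have "\<exists>N. \<forall>n\<ge>N. (\<Sum>j\<in>UNIV. Lp_norm lam p (\<lambda>y. g j y - P (\<beta> n) j y)) < \<epsilon>"
      by (rule Lp_lim_sum_norm[OF p_pos _ _ _ _ \<epsilon>]) (use g in \<open>simp_all add: Lp_iff op_measurable[OF \<beta>D]\<close>)
    then obtain N2 where N2: "\<forall>n\<ge>N2. (\<Sum>j\<in>UNIV. Lp_norm lam p (\<lambda>y. g j y - P (\<beta> n) j y)) < \<epsilon>" ..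
    show ?thesis
      using N1 N2 \<beta>D by (intro bexI[of _ "\<beta> (max N1 N2)"]) (auto simp: Lp_norm_vec_def)
  qed
  then have "(\<alpha>, g) \<in> graph_closure lam p \<D> P"
    using \<alpha> g by (simp add: graph_closure_def)
  then show "\<alpha> \<in> dom_closure lam p \<D> P" by (auto simp: dom_closure_def)
qed

end

theorem proposition3p1:
  fixes A :: "('g::{topological_group_add, t2_space, second_countable_topology},
               'e::euclidean_space) atlas"
    and lam :: "'g measure"
    and X :: "'k::finite \<Rightarrow> ('g \<Rightarrow> real) \<Rightarrow> 'g \<Rightarrow> real"
    and a :: "'n::finite \<Rightarrow> 'm::finite \<Rightarrow> 'k list \<Rightarrow> 'g \<Rightarrow> real"
    and P :: "('n \<Rightarrow> 'g \<Rightarrow> real) \<Rightarrow> 'm \<Rightarrow> 'g \<Rightarrow> real"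
    and m :: nat and p :: real and \<Omega> :: "'g set"
  assumes "lie_group A"
    and "connected (UNIV :: 'g set)"
    and "\<not> compact (UNIV :: 'g set)"
    and "left_haar_measure lam"
    and "\<And>i. left_invariant_field A (X i)"
    and "lin_indep_fields A X"
    and "m \<ge> 1"
    and "has_degree lam m a"
    and P_def: "P = diff_op X {I. length I \<le> m} a"
    and "\<And>i j. left_invariant_op A lam (diff_entry X {I. length I = m} (a i j))"
    and "\<And>i j I. length I < m \<Longrightarrow> ess_bounded lam (a i j I)"
    and "p \<ge> 1"
    and "open \<Omega>" and "\<Omega> \<noteq> {}"
    and "maximal_hypoelliptic A lam X m p \<Omega> P"
    and "closable_op lam p (Cc_infty_vec A UNIV) P"
  shows "dom_closure lam p (Cc_infty_vec A UNIV) P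
           = Sobolev_closure A lam X m p (Cc_infty_vec A UNIV)"
proof -
  interpret invariant_principal A lam X p m a
    using assms by unfold_locales (auto simp: has_degree_def)
  show ?thesis
    using dom_closure_subset[OF assms(15)[unfolded P_def] assms(13,14)] Sobolev_closure_subset
    unfolding P_def by (rule subset_antisym)
qed

end
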